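(* Let $R$ be a commutative ring with $1$ in which $2$ is invertible, and let $n\ge2$. Let $\alpha(X)\in \mathrm{Sp}_{2n}(R[X])$ with $\alpha(0)=I_{2n}$. If for every maximal ideal $\mathfrak m$ of $R$ the image $\alpha(X)_{\mathfrak m}$ of $\alpha(X)$ in $\mathrm{Sp}_{2n}(R_{\mathfrak m}[X])$ lies in $H(R_{\mathfrak m}[X])$, then $\alpha(X)\in H(R[X])$.
   Context: Let $\psi_1=\begin{pmatrix}0&1\\-1&0\end{pmatrix}$ and let $\psi_n$ be the $2n\times 2n$ block diagonal matrix with $n$ diagonal blocks equal to $\psi_1$. For a commutative ring $S$, $\mathrm{Sp}_{2n}(S)=\{\alpha\in \mathrm{SL}_{2n}(S): \alpha^t\psi_n\alpha=\psi_n\}$. For $a\in S$ define the $2\times2$ matrices $A(a)=\begin{pmatrix}a&a\\ a&a\end{pmatrix}$, $B(a)=\begin{pmatrix}a&-a\\ a&-a\end{pmatrix}$, $C(a)=\begin{pmatrix}a&a\\ -a&-a\end{pmatrix}$, $D(a)=\begin{pmatrix}-a&a\\ a&-a\end{pmatrix}$. View $2n\times 2n$ matrices as $n\times n$ block matrices with $2\times 2$ blocks. For $2\le k\le n$ and $X\in M_2(S)$ with $\det X=0$, $E^k(X)$ denotes the $2n\times2n$ matrix with $2\times 2$ identity blocks on the diagonal, block $X$ in block position $(1,k)$, block $\psi_1X^t\psi_1$ in block position $(k,1)$, and zero blocks elsewhere; it lies in $\mathrm{Sp}_{2n}(S)$. $H(S)$ is the subgroup of $\mathrm{Sp}_{2n}(S)$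 generated by all $E^k(A(a)),E^k(B(a)),E^k(C(a)),E^k(D(a))$ with $a\in S$, $2\le k\le n$. *)

theory Defs
  imports
    "HOL-Algebra.UnivPoly"
    "HOL-Algebra.Generated_Groups"
    "HOL-Combinatorics.Permutations"
    "Jordan_Normal_Form.Matrix"
begin

section \<open>Matrices over the carrier of a commutative ring\<close>

text \<open>
  The matrix type of \<^theory>\<open>Jordan_Normal_Form.Matrix\<close> serves only as a container here. The
  arithmetic of that theory belongs to type classes, whereas the rings \<open>R\<^sub>\<mm>\<close> and \<open>R\<^sub>\<mm>[X]\<close> depend
  on an ideal and are therefore ring records.
\<close>

definition matrix_one :: "('a, 'b) ring_scheme \<Rightarrow> nat \<Rightarrow> 'a mat" where
  "matrix_one S m = mat m m (\<lambda>(i, j). if i = j then \<one>\<^bsub>S\<^esub> else \<zero>\<^bsub>S\<^esub>)"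

definition matrix_zero :: "('a, 'b) ring_scheme \<Rightarrow> nat \<Rightarrow> 'a mat" where
  "matrix_zero S m = mat m m (\<lambda>_. \<zero>\<^bsub>S\<^esub>)"

definition matrix_mult :: "('a, 'b) ring_scheme \<Rightarrow> 'a mat \<Rightarrow> 'a mat \<Rightarrow> 'a mat" where
  "matrix_mult S A B = mat (dim_row A) (dim_col B)
     (\<lambda>(i, j). \<Oplus>\<^bsub>S\<^esub>k\<in>{..<dim_col A}. A $$ (i, k) \<otimes>\<^bsub>S\<^esub> B $$ (k, j))"

definition matrix_det :: "('a, 'b) ring_scheme \<Rightarrow> 'a mat \<Rightarrow> 'a" where
  "matrix_det S A = (\<Oplus>\<^bsub>S\<^esub>p\<in>{p. p permutes {..<dim_row A}}.
     (if evenperm p then \<one>\<^bsub>S\<^esub> else \<ominus>\<^bsub>S\<^esub> \<one>\<^bsub>S\<^esub>) \<otimes>\<^bsub>S\<^esub> (\<Otimes>\<^bsub>S\<^esub>i\<in>{..<dim_row A}. A $$ (i, p i)))"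

text \<open>Blocks are numbered from 1; matrix rows and columns are numbered from 0.\<close>

definition block_matrix :: "nat \<Rightarrow> (nat \<Rightarrow> nat \<Rightarrow> 'a mat) \<Rightarrow> 'a mat" where
  "block_matrix n F = mat (2 * n) (2 * n)
     (\<lambda>(i, j). F (i div 2 + 1) (j div 2 + 1) $$ (i mod 2, j mod 2))"


section \<open>The symplectic group and the subgroup \<open>H\<close>\<close>

definition psi1 :: "('a, 'b) ring_scheme \<Rightarrow> 'a mat" where
  "psi1 S = mat_of_rows_list 2 [[\<zero>\<^bsub>S\<^esub>, \<one>\<^bsub>S\<^esub>], [\<ominus>\<^bsub>S\<^esub> \<one>\<^bsub>S\<^esub>, \<zero>\<^bsub>S\<^esub>]]"

definition psi :: "nat \<Rightarrow> ('a, 'b) ring_scheme \<Rightarrow> 'a mat" where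
  "psi n S = block_matrix n (\<lambda>p q. if p = q then psi1 S else matrix_zero S 2)"

definition SL :: "nat \<Rightarrow> ('a, 'b) ring_scheme \<Rightarrow> 'a mat set" where
  "SL m S = {\<alpha> \<in> carrier_mat m m. elements_mat \<alpha> \<subseteq> carrier S \<and> matrix_det S \<alpha> = \<one>\<^bsub>S\<^esub>}"

definition Sp :: "nat \<Rightarrow> ('a, 'b) ring_scheme \<Rightarrow> 'a mat monoid" where
  "Sp n S =
     \<lparr>carrier = {\<alpha> \<in> SL (2 * n) S.
        matrix_mult S (matrix_mult S (transpose_mat \<alpha>) (psi n S)) \<alpha> = psi n S},
      monoid.mult = matrix_mult S,
      one = matrix_one S (2 * n)\<rparr>"

definition matA :: "('a, 'b) ring_scheme \<Rightarrow> 'a \<Rightarrow> 'a mat" where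
  "matA S a = mat_of_rows_list 2 [[a, a], [a, a]]"

definition matB :: "('a, 'b) ring_scheme \<Rightarrow> 'a \<Rightarrow> 'a mat" where
  "matB S a = mat_of_rows_list 2 [[a, \<ominus>\<^bsub>S\<^esub> a], [a, \<ominus>\<^bsub>S\<^esub> a]]"

definition matC :: "('a, 'b) ring_scheme \<Rightarrow> 'a \<Rightarrow> 'a mat" where
  "matC S a = mat_of_rows_list 2 [[a, a], [\<ominus>\<^bsub>S\<^esub> a, \<ominus>\<^bsub>S\<^esub> a]]"

definition matD :: "('a, 'b) ring_scheme \<Rightarrow> 'a \<Rightarrow> 'a mat" where
  "matD S a = mat_of_rows_list 2 [[\<ominus>\<^bsub>S\<^esub> a, a], [a, \<ominus>\<^bsub>S\<^esub> a]]"

text \<open>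
  \<open>E_mat n S k X\<close> is \<open>E\<^sup>k(X)\<close> of size \<open>2n\<close>; it is meant for \<open>2 \<le> k \<le> n\<close> and a \<open>2 \<times> 2\<close> matrix \<open>X\<close> over
  \<open>S\<close> with determinant zero, which covers all uses below.
\<close>

definition E_mat :: "nat \<Rightarrow> ('a, 'b) ring_scheme \<Rightarrow> nat \<Rightarrow> 'a mat \<Rightarrow> 'a mat" where
  "E_mat n S k X = block_matrix n (\<lambda>p q.
     if p = q then matrix_one S 2
     else if p = 1 \<and> q = k then X
     else if p = k \<and> q = 1 then matrix_mult S (matrix_mult S (psi1 S) (transpose_mat X)) (psi1 S)
     else matrix_zero S 2)"

definition H_sub :: "nat \<Rightarrow> ('a, 'b) ring_scheme \<Rightarrow> 'a mat set" where
  "H_sub n S = generate (Sp n S)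
     (\<Union>k\<in>{2..n}. \<Union>a\<in>carrier S.
        {E_mat n S k (matA S a), E_mat n S k (matB S a), E_mat n S k (matC S a), E_mat n S k (matD S a)})"


section \<open>Localization\<close>

definition frac_rel :: "('a, 'b) ring_scheme \<Rightarrow> 'a set \<Rightarrow> (('a \<times> 'a) \<times> ('a \<times> 'a)) set" where
  "frac_rel R S = {((r, s), (r', s')). r \<in> carrier R \<and> s \<in> S \<and> r' \<in> carrier R \<and> s' \<in> S \<and>
     (\<exists>t\<in>S. t \<otimes>\<^bsub>R\<^esub> (r \<otimes>\<^bsub>R\<^esub> s' \<ominus>\<^bsub>R\<^esub> r' \<otimes>\<^bsub>R\<^esub> s) = \<zero>\<^bsub>R\<^esub>)}"

definition fraction :: "('a, 'b) ring_scheme \<Rightarrow> 'a set \<Rightarrow> 'a \<Rightarrow> 'a \<Rightarrow> ('a \<times> 'a) set" where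
  "fraction R S r s = frac_rel R S `` {(r, s)}"

text \<open>The unions in the ring operations are over choices of representatives, all giving the same class.\<close>

definition localization :: "('a, 'b) ring_scheme \<Rightarrow> 'a set \<Rightarrow> ('a \<times> 'a) set ring" where
  "localization R S =
     \<lparr>carrier = (carrier R \<times> S) // frac_rel R S,
      monoid.mult = (\<lambda>u v. \<Union>(r, s)\<in>u. \<Union>(r', s')\<in>v. fraction R S (r \<otimes>\<^bsub>R\<^esub> r') (s \<otimes>\<^bsub>R\<^esub> s')),
      one = fraction R S \<one>\<^bsub>R\<^esub> \<one>\<^bsub>R\<^esub>,
      zero = fraction R S \<zero>\<^bsub>R\<^esub> \<one>\<^bsub>R\<^esub>,
      add = (\<lambda>u v. \<Union>(r, s)\<in>u. \<Union>(r', s')\<in>v.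
        fraction R S (r \<otimes>\<^bsub>R\<^esub> s' \<oplus>\<^bsub>R\<^esub> r' \<otimes>\<^bsub>R\<^esub> s) (s \<otimes>\<^bsub>R\<^esub> s'))\<rparr>"

definition localization_at :: "('a, 'b) ring_scheme \<Rightarrow> 'a set \<Rightarrow> ('a \<times> 'a) set ring" where
  "localization_at R \<mm> = localization R (carrier R - \<mm>)"

text \<open>
  The map \<open>R[X] \<rightarrow> R\<^sub>\<mm>[X]\<close> that applies \<open>r \<mapsto> r/1\<close> to each coefficient; elements of \<^term>\<open>UP R\<close> are
  coefficient functions.
\<close>

definition poly_localize_at :: "('a, 'b) ring_scheme \<Rightarrow> 'a set \<Rightarrow> (nat \<Rightarrow> 'a) \<Rightarrow> nat \<Rightarrow> ('a \<times> 'a) set"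
  where "poly_localize_at R \<mm> p = (\<lambda>i. fraction R (carrier R - \<mm>) (p i) \<one>\<^bsub>R\<^esub>)"

end

theory Submission
  imports Defs "HOL-Algebra.Ring_Divisibility"
begin

text \<open>
  Write \<open>\<langle>_, _\<rangle>\<close> for the symplectic form. With \<open>u = (1, 1)\<close> and \<open>v = (1, -1)\<close> in every block, the generators
  are the maps \<open>w \<mapsto> w + c(p\<langle>q, w\<rangle> + q\<langle>p, w\<rangle>)\<close> for basis vectors \<open>p\<close> in the first block and \<open>q\<close> in a later
  one, and \<open>\<langle>u, v\<rangle> = -2\<close> is a unit. Hence commutators produce such a map for every pair of orthogonal
  basis vectors, and conjugation by an isometry only moves \<open>p\<close> and \<open>q\<close>. Let \<open>\<phi> : B \<rightarrow> B'\<close> be a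
  localization and \<open>\<gamma>\<close> a generator over \<open>B'\<close>. For each denominator \<open>s\<close> there is a denominator \<open>t\<close> such
  that \<open>\<gamma>\<close> conjugates every product of these maps with \<open>c \<in> \<phi>(tB)\<close> into a product of maps with
  \<open>c \<in> \<phi>(sB)\<close>.

  Take \<open>B = R[X][Z]\<close> and \<open>B' = R\<^sub>\<mm>[X][Z]\<close>. Peeling off the factors of a word for \<open>\<alpha>\<^sub>\<mm>(X)\<close> one at a time
  gives \<open>\<alpha>(X + tZ) = \<beta> \<alpha>(X)\<close> over \<open>B'\<close> for some \<open>\<beta> \<in> H(B)\<close> and \<open>t \<notin> \<mm>\<close>. After normalizing \<open>\<beta>\<close> to be the
  identity at \<open>Z = 0\<close>, replacing \<open>Z\<close> by a multiple \<open>uZ\<close> with \<open>u \<notin> \<mm>\<close> makes the equation hold over \<open>B\<close>.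
  The \<open>t \<in> R\<close> for which \<open>\<alpha>(X + tZ) \<in> H(B) \<alpha>(X)\<close> form an ideal that lies in no maximal ideal.
  So it contains \<open>1\<close>, and \<open>X = 0\<close> gives \<open>\<alpha>(Z) \<in> H(R[Z])\<close>.
\<close>

section \<open>Matrix algebra over a commutative ring\<close>

text \<open>The invertibility of 2 enters three times. A commutator yields the coefficient
  \<open>a b \<omega>\<close> with \<open>\<omega>\<close> equal to 2 or -2, and it has to reach
  every \<open>c\<close>. An opposite root carries \<open>2 \<omega> a b\<close>. A determinant with
  two equal rows is only seen to equal its own negative.

  The loss of divisibility under conjugation is explicit. If \<open>u y\<close> has no denominator,
  a conjugation with coefficient \<open>y\<close> multiplies coefficients by at most two factors
  \<open>y\<close>, so \<open>u^2\<close> pays for it. For an opposite root the coefficient has to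
  be split over two factors, which costs one more squaring. A word is treated from its left end, and
  each letter fixes what is demanded of the remaining ones.

  The map \<open>\<phi>\<close> need not be injective, so an equation over \<open>B'\<close> alone
  says nothing over \<open>B\<close>. If two polynomials in \<open>Z\<close> have the same image and
  the same value at \<open>Z = 0\<close>, then their difference has constant term 0 and coefficients
  killed by one denominator \<open>u\<close>, so it vanishes under \<open>Z \<mapsto> uZ\<close>.
  This is the reason for the second variable and for normalizing \<open>\<beta>\<close> at
  \<open>Z = 0\<close>.\<close>

definition mats :: "('a, 'b) ring_scheme \<Rightarrow> nat \<Rightarrow> 'a mat set" where
  "mats S m = {A \<in> carrier_mat m m. elements_mat A \<subseteq> carrier S}"

lemma mats_iff:
  "A \<in> mats S m \<longleftrightarrow> dim_row A = m \<and> dim_col A = m \<and> (\<forall>i<m. \<forall>j<m. A $$ (i, j) \<in> carrier S)"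
  unfolding mats_def carrier_mat_def
  by (auto intro: elements_matI dest!: elements_matD)

lemma matsI:
  assumes "dim_row A = m" "dim_col A = m" "\<And>i j. i < m \<Longrightarrow> j < m \<Longrightarrow> A $$ (i, j) \<in> carrier S"
  shows "A \<in> mats S m"
  using assms by (simp add: mats_iff)

lemma mats_entry [simp, intro]: "A \<in> mats S m \<Longrightarrow> i < m \<Longrightarrow> j < m \<Longrightarrow> A $$ (i, j) \<in> carrier S"
  by (simp add: mats_iff)

lemma mats_dim [simp]: "A \<in> mats S m \<Longrightarrow> dim_row A = m" "A \<in> mats S m \<Longrightarrow> dim_col A = m"
  by (auto simp: mats_iff)

lemma (in abelian_monoid) finsum_swap:
  assumes "finite A" "finite B" "\<And>i j. i \<in> A \<Longrightarrow> j \<in> B \<Longrightarrow> f i j \<in> carrier G"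
  shows "(\<Oplus>i\<in>A. \<Oplus>j\<in>B. f i j) = (\<Oplus>j\<in>B. \<Oplus>i\<in>A. f i j)"
  using assms(1,3)
proof (induction A rule: finite_induct)
  case empty
  then show ?case by simp
next
  case (insert a A)
  have "(\<Oplus>i\<in>insert a A. \<Oplus>j\<in>B. f i j) = (\<Oplus>j\<in>B. f a j) \<oplus> (\<Oplus>j\<in>B. \<Oplus>i\<in>A. f i j)"
    using insert by (simp add: finsum_insert Pi_def finsum_closed)
  also have "\<dots> = (\<Oplus>j\<in>B. f a j \<oplus> (\<Oplus>i\<in>A. f i j))"
    using insert.prems by (intro finsum_addf [symmetric]) (auto intro!: finsum_closed)
  also have "\<dots> = (\<Oplus>j\<in>B. \<Oplus>i\<in>insert a A. f i j)"
    using insert by (intro finsum_cong') (auto simp: finsum_insert Pi_def intro!: finsum_closed)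
  finally show ?case .
qed

context cring
begin

lemma matrix_mult_closed [simp, intro]:
  assumes "A \<in> mats R m" "B \<in> mats R m"
  shows "matrix_mult R A B \<in> mats R m"
  using assms by (intro matsI) (auto simp: matrix_mult_def intro!: finsum_closed)

lemma matrix_one_closed [simp, intro]: "matrix_one R m \<in> mats R m"
  by (intro matsI) (auto simp: matrix_one_def)

lemma matrix_mult_entry:
  assumes "A \<in> mats R m" "B \<in> mats R m" "i < m" "j < m"
  shows "matrix_mult R A B $$ (i, j) = (\<Oplus>k\<in>{..<m}. A $$ (i, k) \<otimes> B $$ (k, j))"
  using assms by (simp add: matrix_mult_def)

lemma finsum_delta:
  fixes i :: nat
  assumes "i < m" "\<And>k. k < m \<Longrightarrow> f k \<in> carrier R"
  shows "(\<Oplus>k\<in>{..<m}. (if i = k then \<one> else \<zero>) \<otimes> f k) = f i"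
proof -
  have "(\<Oplus>k\<in>{..<m}. (if i = k then \<one> else \<zero>) \<otimes> f k) = (\<Oplus>k\<in>{..<m}. if i = k then f k else \<zero>)"
    using assms by (intro finsum_cong') auto
  also have "\<dots> = f i"
    using assms by (intro finsum_singleton) auto
  finally show ?thesis .
qed

text \<open>With the square matrices packed into a monoid record, the laws of associativity and of
  the unit can be read off from the library as rewrite rules.\<close>

lemma mat_monoid:
  "monoid \<lparr>carrier = mats R m, monoid.mult = matrix_mult R, one = matrix_one R m\<rparr>"
proof (rule monoidI; simp)
  fix A B C assume ABC: "A \<in> mats R m" "B \<in> mats R m" "C \<in> mats R m"
  show "matrix_mult R (matrix_mult R A B) C = matrix_mult R A (matrix_mult R B C)"
  proof (rule eq_matI)
    fix i j assume "i < dim_row (matrix_mult R A (matrix_mult R B C))"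
      "j < dim_col (matrix_mult R A (matrix_mult R B C))"
    with ABC have ij: "i < m" "j < m" by (simp_all add: matrix_mult_def)
    have "matrix_mult R (matrix_mult R A B) C $$ (i, j)
      = (\<Oplus>k\<in>{..<m}. (\<Oplus>l\<in>{..<m}. A $$ (i, l) \<otimes> B $$ (l, k)) \<otimes> C $$ (k, j))"
      using ABC ij by (auto simp: matrix_mult_entry[where m = m] intro!: finsum_cong' finsum_closed)
    also have "\<dots> = (\<Oplus>k\<in>{..<m}. \<Oplus>l\<in>{..<m}. A $$ (i, l) \<otimes> (B $$ (l, k) \<otimes> C $$ (k, j)))"
      using ABC ij by (intro finsum_cong') (auto simp: finsum_ldistr m_assoc intro!: finsum_closed finsum_cong')
    also have "\<dots> = (\<Oplus>l\<in>{..<m}. \<Oplus>k\<in>{..<m}. A $$ (i, l) \<otimes> (B $$ (l, k) \<otimes> C $$ (k, j)))"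
      using ABC ij by (intro finsum_swap) auto
    also have "\<dots> = (\<Oplus>l\<in>{..<m}. A $$ (i, l) \<otimes> (\<Oplus>k\<in>{..<m}. B $$ (l, k) \<otimes> C $$ (k, j)))"
      using ABC ij by (intro finsum_cong') (auto simp: finsum_rdistr intro!: finsum_closed finsum_cong')
    also have "\<dots> = matrix_mult R A (matrix_mult R B C) $$ (i, j)"
      using ABC ij by (auto simp: matrix_mult_entry[where m = m] intro!: finsum_cong' finsum_closed)
    finally show "matrix_mult R (matrix_mult R A B) C $$ (i, j) = matrix_mult R A (matrix_mult R B C) $$ (i, j)" .
  qed (use ABC in \<open>simp_all add: matrix_mult_def\<close>)
next
  fix A assume A: "A \<in> mats R m"
  show "matrix_mult R (matrix_one R m) A = A"
  proof (rule eq_matI)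
    fix i j assume "i < dim_row A" "j < dim_col A"
    with A have ij: "i < m" "j < m" by simp_all
    have "matrix_mult R (matrix_one R m) A $$ (i, j)
      = (\<Oplus>k\<in>{..<m}. (if i = k then \<one> else \<zero>) \<otimes> A $$ (k, j))"
      using A ij by (subst matrix_mult_entry[OF matrix_one_closed A ij]) (auto simp: matrix_one_def intro!: finsum_cong')
    then show "matrix_mult R (matrix_one R m) A $$ (i, j) = A $$ (i, j)"
      using A ij finsum_delta[of i m "\<lambda>k. A $$ (k, j)"] by simp
  qed (use A in \<open>simp_all add: matrix_mult_def matrix_one_def\<close>)
  show "matrix_mult R A (matrix_one R m) = A"
  proof (rule eq_matI)
    fix i j assume "i < dim_row A" "j < dim_col A"
    with A have ij: "i < m" "j < m" by simp_all
    have "matrix_mult R A (matrix_one R m) $$ (i, j)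
      = (\<Oplus>k\<in>{..<m}. (if j = k then \<one> else \<zero>) \<otimes> A $$ (i, k))"
      using A ij by (subst matrix_mult_entry[OF A matrix_one_closed ij]) (auto simp: matrix_one_def m_comm intro!: finsum_cong')
    then show "matrix_mult R A (matrix_one R m) $$ (i, j) = A $$ (i, j)"
      using A ij finsum_delta[of j m "\<lambda>k. A $$ (i, k)"] by simp
  qed (use A in \<open>simp_all add: matrix_mult_def matrix_one_def\<close>)
qed

lemmas matrix_mult_assoc = monoid.m_assoc[OF mat_monoid, simplified]
  and matrix_mult_one_left [simp] = monoid.l_one[OF mat_monoid, simplified]
  and matrix_mult_one_right [simp] = monoid.r_one[OF mat_monoid, simplified]

end

lemma (in ring_hom_cring) map_mat_closed [simp, intro]:
  assumes "A \<in> mats R m"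
  shows "map_mat h A \<in> mats S m"
  using assms by (intro matsI) auto

lemma (in ring_hom_cring) map_mat_mult:
  assumes "A \<in> mats R m" "B \<in> mats R m"
  shows "map_mat h (matrix_mult R A B) = matrix_mult S (map_mat h A) (map_mat h B)"
proof (rule eq_matI)
  fix i j assume "i < dim_row (matrix_mult S (map_mat h A) (map_mat h B))"
    "j < dim_col (matrix_mult S (map_mat h A) (map_mat h B))"
  with assms have ij: "i < m" "j < m" by (simp_all add: matrix_mult_def)
  have *: "(\<lambda>k. A $$ (i, k) \<otimes> B $$ (k, j)) \<in> {..<m} \<rightarrow> carrier R"
    using assms ij by auto
  have "h (\<Oplus>k\<in>{..<m}. A $$ (i, k) \<otimes> B $$ (k, j))
    = (\<Oplus>\<^bsub>S\<^esub>k\<in>{..<m}. h (A $$ (i, k) \<otimes> B $$ (k, j)))"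
    using hom_finsum[OF *] by (simp only: comp_def)
  also have "\<dots> = (\<Oplus>\<^bsub>S\<^esub>k\<in>{..<m}. map_mat h A $$ (i, k) \<otimes>\<^bsub>S\<^esub> map_mat h B $$ (k, j))"
    using assms ij by (intro S.finsum_cong') (auto simp del: hom_finsum)
  finally show "map_mat h (matrix_mult R A B) $$ (i, j) = matrix_mult S (map_mat h A) (map_mat h B) $$ (i, j)"
    using assms ij by (simp add: matrix_mult_def del: hom_finsum)
qed (use assms in \<open>simp_all add: matrix_mult_def\<close>)

lemma (in ring_hom_cring) map_mat_one: "map_mat h (matrix_one R m) = matrix_one S m"
  by (rule eq_matI) (simp_all add: matrix_one_def)

section \<open>The symplectic form and transvections\<close>

text \<open>This is \<open>v^t psi_n w\<close>. Vectors are functions on all natural numbers, of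
  which only the first \<open>2 * n\<close> values count.\<close>

definition symp_form :: "('a, 'b) ring_scheme \<Rightarrow> nat \<Rightarrow> (nat \<Rightarrow> 'a) \<Rightarrow> (nat \<Rightarrow> 'a) \<Rightarrow> 'a" where
  "symp_form S n v w =
     (\<Oplus>\<^bsub>S\<^esub>k\<in>{..<n}. v (2 * k) \<otimes>\<^bsub>S\<^esub> w (2 * k + 1) \<ominus>\<^bsub>S\<^esub> v (2 * k + 1) \<otimes>\<^bsub>S\<^esub> w (2 * k))"

text \<open>The row vector of the functional \<open><v, _>\<close>, as
  \<open>symp_form_covec\<close> shows. The form is block diagonal, so the entries do not depend on
  the dimension.\<close>

definition covec :: "('a, 'b) ring_scheme \<Rightarrow> (nat \<Rightarrow> 'a) \<Rightarrow> nat \<Rightarrow> 'a" where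
  "covec S v j = (if even j then \<ominus>\<^bsub>S\<^esub> v (j + 1) else v (j - 1))"

text \<open>An Eichler transformation of the symplectic space, which is an isometry when
  \<open>p\<close> and \<open>q\<close> are orthogonal. For \<open>p = q\<close> it is the
  transvection along \<open>p\<close> with parameter \<open>2c\<close>.\<close>

definition transv :: "('a, 'b) ring_scheme \<Rightarrow> nat \<Rightarrow> (nat \<Rightarrow> 'a) \<Rightarrow> (nat \<Rightarrow> 'a) \<Rightarrow> 'a \<Rightarrow> (nat \<Rightarrow> 'a) \<Rightarrow> nat \<Rightarrow> 'a"
  where "transv S n p q c w =
    (\<lambda>i. w i \<oplus>\<^bsub>S\<^esub> c \<otimes>\<^bsub>S\<^esub> (p i \<otimes>\<^bsub>S\<^esub> symp_form S n q w \<oplus>\<^bsub>S\<^esub> q i \<otimes>\<^bsub>S\<^esub> symp_form S n p w))"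

definition tmat :: "('a, 'b) ring_scheme \<Rightarrow> nat \<Rightarrow> (nat \<Rightarrow> 'a) \<Rightarrow> (nat \<Rightarrow> 'a) \<Rightarrow> 'a \<Rightarrow> 'a mat" where
  "tmat S n p q c = mat (2 * n) (2 * n) (\<lambda>(i, j). (if i = j then \<one>\<^bsub>S\<^esub> else \<zero>\<^bsub>S\<^esub>) \<oplus>\<^bsub>S\<^esub>
     c \<otimes>\<^bsub>S\<^esub> (p i \<otimes>\<^bsub>S\<^esub> covec S q j \<oplus>\<^bsub>S\<^esub> q i \<otimes>\<^bsub>S\<^esub> covec S p j))"

text \<open>Products of the matrices \<open>tmat\<close> are compared through their action on
  vectors, where they become compositions of the maps \<open>transv\<close>; see
  \<open>mat_eqI_act\<close> and \<open>tmat_mult_eqI\<close>.\<close>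

definition mat_act :: "('a, 'b) ring_scheme \<Rightarrow> 'a mat \<Rightarrow> (nat \<Rightarrow> 'a) \<Rightarrow> nat \<Rightarrow> 'a" where
  "mat_act S A w i = (\<Oplus>\<^bsub>S\<^esub>k\<in>{..<dim_col A}. A $$ (i, k) \<otimes>\<^bsub>S\<^esub> w k)"

context cring
begin

abbreviation vecs :: "(nat \<Rightarrow> 'a) set" where "vecs \<equiv> UNIV \<rightarrow> carrier R"

lemma vecs_apply: "v \<in> vecs \<Longrightarrow> v i \<in> carrier R"
  by (rule funcset_mem) auto

lemma mat_act_cong:
  assumes "A \<in> mats R m" "w \<in> vecs" "\<And>k. k < m \<Longrightarrow> v k = w k" "i < m"
  shows "mat_act R A v i = mat_act R A w i"
  unfolding mat_act_def using assms by (intro finsum_cong') (auto simp: vecs_apply)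

lemma mat_act_mult:
  assumes "A \<in> mats R m" "B \<in> mats R m" "w \<in> vecs" "i < m"
  shows "mat_act R (matrix_mult R A B) w i = mat_act R A (mat_act R B w) i"
proof -
  note [simp] = vecs_apply[OF assms(3)]
  have "mat_act R (matrix_mult R A B) w i
    = (\<Oplus>k\<in>{..<m}. (\<Oplus>l\<in>{..<m}. A $$ (i, l) \<otimes> B $$ (l, k)) \<otimes> w k)"
    using assms unfolding mat_act_def
    by (intro finsum_cong') (auto simp: matrix_mult_def intro!: finsum_closed)
  also have "\<dots> = (\<Oplus>k\<in>{..<m}. \<Oplus>l\<in>{..<m}. A $$ (i, l) \<otimes> (B $$ (l, k) \<otimes> w k))"
    using assms by (intro finsum_cong') (auto simp: finsum_ldistr m_assoc intro!: finsum_closed finsum_cong')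
  also have "\<dots> = (\<Oplus>l\<in>{..<m}. \<Oplus>k\<in>{..<m}. A $$ (i, l) \<otimes> (B $$ (l, k) \<otimes> w k))"
    using assms by (intro finsum_swap) auto
  also have "\<dots> = mat_act R A (mat_act R B w) i"
    using assms unfolding mat_act_def
    by (intro finsum_cong') (auto simp: finsum_rdistr intro!: finsum_closed finsum_cong')
  finally show ?thesis .
qed

lemma mat_act_unit:
  assumes "A \<in> mats R m" "i < m" "j < m"
  shows "mat_act R A (\<lambda>k. if j = k then \<one> else \<zero>) i = A $$ (i, j)"
proof -
  have "mat_act R A (\<lambda>k. if j = k then \<one> else \<zero>) i
    = (\<Oplus>k\<in>{..<m}. (if j = k then \<one> else \<zero>) \<otimes> A $$ (i, k))"
    unfolding mat_act_def using assms by (intro finsum_cong') (auto simp: m_comm)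
  then show ?thesis
    using assms finsum_delta[of j m "\<lambda>k. A $$ (i, k)"] by simp
qed

lemma mat_eqI_act:
  assumes "A \<in> mats R m" "B \<in> mats R m"
    and "\<And>w i. w \<in> vecs \<Longrightarrow> i < m \<Longrightarrow> mat_act R A w i = mat_act R B w i"
  shows "A = B"
proof (rule eq_matI)
  fix i j assume "i < dim_row B" "j < dim_col B"
  with assms(2) have "i < m" "j < m" by simp_all
  with assms(1,2) assms(3)[of "\<lambda>k. if j = k then \<one> else \<zero>" i] show "A $$ (i, j) = B $$ (i, j)"
    by (simp add: mat_act_unit)
qed (use assms in auto)

lemma symp_form_closed [simp, intro]: "v \<in> vecs \<Longrightarrow> w \<in> vecs \<Longrightarrow> symp_form R n v w \<in> carrier R"
  unfolding symp_form_def by (auto simp: vecs_apply intro!: finsum_closed)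

lemma symp_form_add:
  assumes "v \<in> vecs" "w \<in> vecs" "w' \<in> vecs"
  shows "symp_form R n v (\<lambda>i. w i \<oplus> w' i) = symp_form R n v w \<oplus> symp_form R n v w'"
proof -
  note [simp] = assms[THEN vecs_apply]
  have "symp_form R n v (\<lambda>i. w i \<oplus> w' i)
    = (\<Oplus>k\<in>{..<n}. (v (2 * k) \<otimes> w (2 * k + 1) \<ominus> v (2 * k + 1) \<otimes> w (2 * k)) \<oplus>
        (v (2 * k) \<otimes> w' (2 * k + 1) \<ominus> v (2 * k + 1) \<otimes> w' (2 * k)))"
    unfolding symp_form_def
  proof (intro finsum_cong')
    fix k
    show "v (2 * k) \<otimes> (w (2 * k + 1) \<oplus> w' (2 * k + 1)) \<ominus> v (2 * k + 1) \<otimes> (w (2 * k) \<oplus> w' (2 * k)) =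
      (v (2 * k) \<otimes> w (2 * k + 1) \<ominus> v (2 * k + 1) \<otimes> w (2 * k)) \<oplus>
      (v (2 * k) \<otimes> w' (2 * k + 1) \<ominus> v (2 * k + 1) \<otimes> w' (2 * k))"
      using assms[THEN vecs_apply] by algebra
  qed auto
  also have "\<dots> = symp_form R n v w \<oplus> symp_form R n v w'"
    unfolding symp_form_def by (intro finsum_addf) auto
  finally show ?thesis .
qed

lemma symp_form_smult:
  assumes "v \<in> vecs" "w \<in> vecs" "c \<in> carrier R"
  shows "symp_form R n v (\<lambda>i. c \<otimes> w i) = c \<otimes> symp_form R n v w"
proof -
  note [simp] = assms(1,2)[THEN vecs_apply] assms(3)
  have "symp_form R n v (\<lambda>i. c \<otimes> w i)
    = (\<Oplus>k\<in>{..<n}. c \<otimes> (v (2 * k) \<otimes> w (2 * k + 1) \<ominus> v (2 * k + 1) \<otimes> w (2 * k)))"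
    unfolding symp_form_def
  proof (intro finsum_cong')
    fix k
    show "v (2 * k) \<otimes> (c \<otimes> w (2 * k + 1)) \<ominus> v (2 * k + 1) \<otimes> (c \<otimes> w (2 * k)) =
      c \<otimes> (v (2 * k) \<otimes> w (2 * k + 1) \<ominus> v (2 * k + 1) \<otimes> w (2 * k))"
      using assms(1,2)[THEN vecs_apply] assms(3) by algebra
  qed auto
  also have "\<dots> = c \<otimes> symp_form R n v w"
    unfolding symp_form_def by (intro finsum_rdistr [symmetric]) auto
  finally show ?thesis .
qed

lemma symp_form_skew:
  assumes "v \<in> vecs" "w \<in> vecs"
  shows "symp_form R n w v = \<ominus> symp_form R n v w"
proof -
  note [simp] = assms[THEN vecs_apply]
  have "symp_form R n w v
    = (\<Oplus>k\<in>{..<n}. (\<ominus> \<one>) \<otimes> (v (2 * k) \<otimes> w (2 * k + 1) \<ominus> v (2 * k + 1) \<otimes> w (2 * k)))"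
    unfolding symp_form_def
  proof (intro finsum_cong')
    fix k
    show "w (2 * k) \<otimes> v (2 * k + 1) \<ominus> w (2 * k + 1) \<otimes> v (2 * k) =
      (\<ominus> \<one>) \<otimes> (v (2 * k) \<otimes> w (2 * k + 1) \<ominus> v (2 * k + 1) \<otimes> w (2 * k))"
      using assms[THEN vecs_apply] by algebra
  qed auto
  also have "\<dots> = (\<ominus> \<one>) \<otimes> symp_form R n v w"
    unfolding symp_form_def by (intro finsum_rdistr [symmetric]) auto
  finally show ?thesis using assms by (simp add: l_minus)
qed

lemma symp_form_self:
  assumes "v \<in> vecs"
  shows "symp_form R n v v = \<zero>"
proof -
  note [simp] = assms[THEN vecs_apply]
  have "symp_form R n v v = (\<Oplus>k\<in>{..<n}. \<zero>)"
    unfolding symp_form_def by (intro finsum_cong') (auto simp: m_comm a_minus_def r_neg)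
  then show ?thesis by simp
qed

lemma symp_form_lincomb:
  assumes "u \<in> vecs" "v \<in> vecs" "w \<in> vecs" "b \<in> carrier R" "c \<in> carrier R"
  shows "symp_form R n u (\<lambda>i. b \<otimes> v i \<oplus> c \<otimes> w i) = b \<otimes> symp_form R n u v \<oplus> c \<otimes> symp_form R n u w"
    and "symp_form R n (\<lambda>i. b \<otimes> v i \<oplus> c \<otimes> w i) u = b \<otimes> symp_form R n v u \<oplus> c \<otimes> symp_form R n w u"
proof -
  have [simp]: "(\<lambda>i. b \<otimes> v i) \<in> vecs" "(\<lambda>i. c \<otimes> w i) \<in> vecs" "(\<lambda>i. b \<otimes> v i \<oplus> c \<otimes> w i) \<in> vecs"
    using assms(1-3)[THEN vecs_apply] assms(4,5) by auto
  show *: "symp_form R n u (\<lambda>i. b \<otimes> v i \<oplus> c \<otimes> w i) = b \<otimes> symp_form R n u v \<oplus> c \<otimes> symp_form R n u w"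
    using assms by (simp add: symp_form_add symp_form_smult)
  have "symp_form R n (\<lambda>i. b \<otimes> v i \<oplus> c \<otimes> w i) u = \<ominus> (b \<otimes> symp_form R n u v \<oplus> c \<otimes> symp_form R n u w)"
    using assms by (subst symp_form_skew[of u]) (simp_all add: *)
  also have "\<dots> = b \<otimes> symp_form R n v u \<oplus> c \<otimes> symp_form R n w u"
    using assms symp_form_skew[of v u n] symp_form_skew[of w u n]
    by (simp add: minus_add r_minus)
  finally show "symp_form R n (\<lambda>i. b \<otimes> v i \<oplus> c \<otimes> w i) u = b \<otimes> symp_form R n v u \<oplus> c \<otimes> symp_form R n w u" .
qed

lemma transv_closed [simp, intro]:
  assumes "p \<in> vecs" "q \<in> vecs" "c \<in> carrier R" "w \<in> vecs"
  shows "transv R n p q c w \<in> vecs"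
  using assms by (auto simp: transv_def vecs_apply)

lemma symp_form_transv:
  assumes "u \<in> vecs" "p \<in> vecs" "q \<in> vecs" "c \<in> carrier R" "w \<in> vecs"
  shows "symp_form R n u (transv R n p q c w) = symp_form R n u w \<oplus>
    c \<otimes> (symp_form R n u p \<otimes> symp_form R n q w \<oplus> symp_form R n u q \<otimes> symp_form R n p w)"
proof -
  note * = assms(2,3,5)[THEN vecs_apply] assms(4)
  have [simp]: "(\<lambda>i. c \<otimes> (symp_form R n q w \<otimes> p i \<oplus> symp_form R n p w \<otimes> q i)) \<in> vecs"
    "(\<lambda>i. symp_form R n q w \<otimes> p i \<oplus> symp_form R n p w \<otimes> q i) \<in> vecs"
    using * assms by auto
  have "transv R n p q c w =
    (\<lambda>i. w i \<oplus> c \<otimes> (symp_form R n q w \<otimes> p i \<oplus> symp_form R n p w \<otimes> q i))"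
    using * assms by (auto simp: transv_def m_comm)
  then show ?thesis using assms
    by (simp add: symp_form_add symp_form_smult symp_form_lincomb m_comm)
qed

text \<open>The terms linear in \<open>c\<close> cancel by skew symmetry. Those quadratic in
  \<open>c\<close> contain one of \<open><p, q>\<close>, \<open><p, p>\<close> and
  \<open><q, q>\<close>, which all vanish.\<close>

lemma transv_isometry:
  assumes "p \<in> vecs" "q \<in> vecs" "c \<in> carrier R" "v \<in> vecs" "w \<in> vecs" "symp_form R n p q = \<zero>"
  shows "symp_form R n (transv R n p q c v) (transv R n p q c w) = symp_form R n v w"
proof -
  let ?f = "symp_form R n"
  have qp: "?f q p = \<zero>" using assms symp_form_skew[of p q n] by simp
  have l: "?f (transv R n p q c v) u = ?f v u \<oplus> c \<otimes> (?f p u \<otimes> ?f q v \<oplus> ?f q u \<otimes> ?f p v)"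
    if "u \<in> vecs" for u
  proof -
    have "?f (transv R n p q c v) u = \<ominus> (?f u v \<oplus> c \<otimes> (?f u p \<otimes> ?f q v \<oplus> ?f u q \<otimes> ?f p v))"
      using assms that symp_form_skew[of u "transv R n p q c v" n] by (simp add: symp_form_transv)
    also have "\<dots> = ?f v u \<oplus> c \<otimes> (?f p u \<otimes> ?f q v \<oplus> ?f q u \<otimes> ?f p v)"
    proof -
      have "\<ominus> (\<ominus> x \<oplus> c \<otimes> ((\<ominus> y) \<otimes> s \<oplus> (\<ominus> z) \<otimes> t)) = x \<oplus> c \<otimes> (y \<otimes> s \<oplus> z \<otimes> t)"
        if "x \<in> carrier R" "y \<in> carrier R" "z \<in> carrier R" "s \<in> carrier R" "t \<in> carrier R" for x y z s t
        using that assms(3) by algebra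
      then show ?thesis
        using assms that symp_form_skew[of v u n] symp_form_skew[of p u n] symp_form_skew[of q u n] by simp
    qed
    finally show ?thesis .
  qed
  have "?f (transv R n p q c v) (transv R n p q c w) =
    (?f v w \<oplus> c \<otimes> (?f p w \<otimes> ?f q v \<oplus> ?f q w \<otimes> ?f p v)) \<oplus> c \<otimes> (?f v p \<otimes> ?f q w \<oplus> ?f v q \<otimes> ?f p w)"
    using assms qp by (simp add: l symp_form_transv symp_form_self)
  also have "\<dots> = ?f v w"
  proof -
    have "(a \<oplus> c \<otimes> (t \<otimes> x \<oplus> z \<otimes> y)) \<oplus> c \<otimes> ((\<ominus> y) \<otimes> z \<oplus> (\<ominus> x) \<otimes> t) = a"
      if "a \<in> carrier R" "x \<in> carrier R" "y \<in> carrier R" "z \<in> carrier R" "t \<in> carrier R" for a x y z t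
      using that assms(3) by algebra
    then show ?thesis
      using assms symp_form_skew[of p v n] symp_form_skew[of q v n] by simp
  qed
  finally show ?thesis .
qed

lemma symp_form_covec:
  assumes "q \<in> vecs" "w \<in> vecs"
  shows "(\<Oplus>k\<in>{..<2 * n}. covec R q k \<otimes> w k) = symp_form R n q w"
proof (induction n)
  case 0
  then show ?case by (simp add: symp_form_def)
next
  case (Suc n)
  note * [simp] = assms[THEN vecs_apply]
  have c [simp]: "covec R q k \<in> carrier R" for k by (simp add: covec_def)
  have e: "{..<2 * Suc n} = insert (2 * n + 1) (insert (2 * n) {..<2 * n})" by auto
  have [simp]: "(\<Oplus>k\<in>{..<2 * n}. covec R q k \<otimes> w k) \<in> carrier R" by (intro finsum_closed) auto
  have [simp]: "(\<Oplus>k\<in>{..<n}. q (2 * k) \<otimes> w (2 * k + 1) \<ominus> q (2 * k + 1) \<otimes> w (2 * k)) \<in> carrier R"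
    by (intro finsum_closed) auto
  have "(\<Oplus>k\<in>{..<2 * Suc n}. covec R q k \<otimes> w k)
    = q (2 * n) \<otimes> w (2 * n + 1) \<oplus> ((\<ominus> q (2 * n + 1)) \<otimes> w (2 * n) \<oplus> symp_form R n q w)"
    unfolding e by (subst finsum_insert; (auto simp: Suc)?)+ (simp add: covec_def)
  also have "\<dots> = symp_form R (Suc n) q w"
    unfolding symp_form_def lessThan_Suc
    by (subst finsum_insert) (auto simp: a_minus_def l_minus a_assoc)
  finally show ?case .
qed

lemma tmat_closed [simp, intro]:
  assumes "p \<in> vecs" "q \<in> vecs" "c \<in> carrier R"
  shows "tmat R n p q c \<in> mats R (2 * n)"
  using assms by (intro matsI) (auto simp: tmat_def covec_def vecs_apply)

lemma mat_act_tmat: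
  assumes "p \<in> vecs" "q \<in> vecs" "c \<in> carrier R" "w \<in> vecs" "i < 2 * n"
  shows "mat_act R (tmat R n p q c) w i = transv R n p q c w i"
proof -
  note * [simp] = assms(1,2,4)[THEN vecs_apply] assms(3)
  have c [simp]: "covec R p k \<in> carrier R" "covec R q k \<in> carrier R" for k by (simp_all add: covec_def)
  have "mat_act R (tmat R n p q c) w i = (\<Oplus>k\<in>{..<2 * n}. (if i = k then \<one> else \<zero>) \<otimes> w k \<oplus>
      ((c \<otimes> p i) \<otimes> (covec R q k \<otimes> w k) \<oplus> (c \<otimes> q i) \<otimes> (covec R p k \<otimes> w k)))"
    unfolding mat_act_def
  proof (intro finsum_cong')
    fix k assume "k \<in> {..<2 * n}"
    have "(d \<oplus> c \<otimes> (p i \<otimes> covec R q k \<oplus> q i \<otimes> covec R p k)) \<otimes> w k = d \<otimes> w k \<oplus>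
      ((c \<otimes> p i) \<otimes> (covec R q k \<otimes> w k) \<oplus> (c \<otimes> q i) \<otimes> (covec R p k \<otimes> w k))" if "d \<in> carrier R" for d
      using that * c by algebra
    then show "tmat R n p q c $$ (i, k) \<otimes> w k = (if i = k then \<one> else \<zero>) \<otimes> w k \<oplus>
      ((c \<otimes> p i) \<otimes> (covec R q k \<otimes> w k) \<oplus> (c \<otimes> q i) \<otimes> (covec R p k \<otimes> w k))"
      using \<open>k \<in> _\<close> assms(5) by (simp add: tmat_def)
  qed (auto simp: tmat_def)
  also have "\<dots> = w i \<oplus> ((c \<otimes> p i) \<otimes> symp_form R n q w \<oplus> (c \<otimes> q i) \<otimes> symp_form R n p w)"
    using assms finsum_delta[of i "2 * n" w]
    by (simp add: finsum_addf finsum_rdistr [symmetric] symp_form_covec Pi_def)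
  also have "\<dots> = transv R n p q c w i"
    using assms by (simp add: transv_def r_distr m_assoc)
  finally show ?thesis .
qed

lemma tmat_mult_eqI:
  assumes "p \<in> vecs" "q \<in> vecs" "c \<in> carrier R" "p' \<in> vecs" "q' \<in> vecs" "c' \<in> carrier R"
    and "r \<in> vecs" "s \<in> vecs" "d \<in> carrier R" "r' \<in> vecs" "s' \<in> vecs" "d' \<in> carrier R"
    and "\<And>w i. w \<in> vecs \<Longrightarrow> transv R n p q c (transv R n p' q' c' w) i = transv R n r s d (transv R n r' s' d' w) i"
  shows "matrix_mult R (tmat R n p q c) (tmat R n p' q' c') = matrix_mult R (tmat R n r s d) (tmat R n r' s' d')"
proof (rule mat_eqI_act[of _ "2 * n"])
  have *: "mat_act R (matrix_mult R (tmat R n p q c) (tmat R n p' q' c')) w i =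
    transv R n p q c (transv R n p' q' c' w) i"
    if "p \<in> vecs" "q \<in> vecs" "c \<in> carrier R" "p' \<in> vecs" "q' \<in> vecs" "c' \<in> carrier R" "w \<in> vecs" "i < 2 * n"
    for p q c p' q' c' w i
  proof -
    have "mat_act R (matrix_mult R (tmat R n p q c) (tmat R n p' q' c')) w i =
      mat_act R (tmat R n p q c) (mat_act R (tmat R n p' q' c') w) i"
      using that by (intro mat_act_mult[where m = "2 * n"]) auto
    also have "\<dots> = mat_act R (tmat R n p q c) (transv R n p' q' c' w) i"
      using that by (intro mat_act_cong[where m = "2 * n"]) (auto simp: mat_act_tmat)
    finally show ?thesis using that by (simp add: mat_act_tmat)
  qed
  fix w i assume "w \<in> vecs" "i < 2 * n"
  then show "mat_act R (matrix_mult R (tmat R n p q c) (tmat R n p' q' c')) w i =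
    mat_act R (matrix_mult R (tmat R n r s d) (tmat R n r' s' d')) w i"
    using assms by (simp add: *)
qed (use assms in auto)

lemma tmat_commute_args:
  assumes "p \<in> vecs" "q \<in> vecs" "c \<in> carrier R"
  shows "tmat R n p q c = tmat R n q p c"
proof -
  have "covec R p j \<in> carrier R" "covec R q j \<in> carrier R" for j
    using assms by (simp_all add: covec_def vecs_apply)
  then have "p i \<otimes> covec R q j \<oplus> q i \<otimes> covec R p j = q i \<otimes> covec R p j \<oplus> p i \<otimes> covec R q j" for i j
    using assms by (intro a_comm) (simp_all add: vecs_apply)
  then show ?thesis by (simp add: tmat_def)
qed

text \<open>An isometry \<open>g\<close> conjugates the map of \<open>e\<close>, \<open>f\<close>
  into the map of \<open>g e\<close>, \<open>g f\<close>, because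
  \<open><f, w> = <g f, g w>\<close>. The form \<open>g T = T' g\<close> avoids the inverse of
  \<open>g\<close>.\<close>

lemma tmat_conj:
  assumes "p \<in> vecs" "q \<in> vecs" "y \<in> carrier R" "e \<in> vecs" "f \<in> vecs" "c \<in> carrier R" "symp_form R n p q = \<zero>"
  shows "matrix_mult R (tmat R n p q y) (tmat R n e f c) =
    matrix_mult R (tmat R n (transv R n p q y e) (transv R n p q y f) c) (tmat R n p q y)"
proof (rule tmat_mult_eqI)
  fix w i assume w: "w \<in> vecs"
  let ?f = "symp_form R n"
  note * = vecs_apply[OF assms(1), of i] vecs_apply[OF assms(2), of i] vecs_apply[OF assms(4), of i]
    vecs_apply[OF assms(5), of i] vecs_apply[OF w, of i] assms(3,6)
  have "(w i \<oplus> c \<otimes> (e i \<otimes> a \<oplus> f i \<otimes> b)) \<oplus>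
     y \<otimes> (p i \<otimes> (qw \<oplus> c \<otimes> (qe \<otimes> a \<oplus> qf \<otimes> b)) \<oplus> q i \<otimes> (pw \<oplus> c \<otimes> (pe \<otimes> a \<oplus> pf \<otimes> b)))
    = (w i \<oplus> y \<otimes> (p i \<otimes> qw \<oplus> q i \<otimes> pw)) \<oplus>
      c \<otimes> ((e i \<oplus> y \<otimes> (p i \<otimes> qe \<oplus> q i \<otimes> pe)) \<otimes> a \<oplus> (f i \<oplus> y \<otimes> (p i \<otimes> qf \<oplus> q i \<otimes> pf)) \<otimes> b)"
    if "a \<in> carrier R" "b \<in> carrier R" "qw \<in> carrier R" "qe \<in> carrier R" "qf \<in> carrier R"
       "pw \<in> carrier R" "pe \<in> carrier R" "pf \<in> carrier R" for a b qw qe qf pw pe pf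
    using that * by (simp add: l_distr r_distr m_ac a_ac)
  note alg = this[of "?f f w" "?f e w" "?f q w" "?f q e" "?f q f" "?f p w" "?f p e" "?f p f"]
  have "transv R n p q y (transv R n e f c w) i =
    transv R n e f c w i \<oplus> y \<otimes> (p i \<otimes> ?f q (transv R n e f c w) \<oplus> q i \<otimes> ?f p (transv R n e f c w))"
    by (simp only: transv_def[of R n p q y])
  moreover have "transv R n (transv R n p q y e) (transv R n p q y f) c (transv R n p q y w) i =
    transv R n p q y w i \<oplus> c \<otimes> (transv R n p q y e i \<otimes> ?f f w \<oplus> transv R n p q y f i \<otimes> ?f e w)"
    using assms w by (simp add: transv_def[of R n _ _ c] transv_isometry)
  ultimately show "transv R n p q y (transv R n e f c w) i =
    transv R n (transv R n p q y e) (transv R n p q y f) c (transv R n p q y w) i"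
    using alg assms w by (simp add: symp_form_transv) (simp add: transv_def)
qed (use assms in auto)

text \<open>Additivity in the vector paired with \<open>q\<close>, up to a correction. The right
  factor keeps \<open><q, w>\<close> and changes \<open><p, w>\<close> by
  \<open>c <p, p'> <q, w>\<close>, so the left factor adds \<open>b c <p, p'> <q, w>\<close> times
  \<open>q\<close>. That is a transvection along \<open>q\<close> whose coefficient is half of
  \<open>b c <p, p'>\<close>; \<open>h\<close> names this half.\<close>

lemma tmat_combine:
  assumes "p \<in> vecs" "p' \<in> vecs" "q \<in> vecs" "b \<in> carrier R" "c \<in> carrier R" "h \<in> carrier R"
    and "symp_form R n p q = \<zero>" "symp_form R n p' q = \<zero>" "h \<oplus> h = b \<otimes> c \<otimes> symp_form R n p p'"
  shows "matrix_mult R (tmat R n p q b) (tmat R n p' q c) =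
    matrix_mult R (tmat R n (\<lambda>i. b \<otimes> p i \<oplus> c \<otimes> p' i) q \<one>) (tmat R n q q h)"
proof (rule tmat_mult_eqI)
  show pp: "(\<lambda>i. b \<otimes> p i \<oplus> c \<otimes> p' i) \<in> vecs"
    using assms by (auto simp: vecs_apply)
  fix w i assume w: "w \<in> vecs"
  let ?f = "symp_form R n"
  have o: "?f q q = \<zero>" "?f q p = \<zero>" "?f q p' = \<zero>"
    using assms symp_form_skew[of p q n] symp_form_skew[of p' q n] symp_form_self[of q n] by simp_all
  note * = vecs_apply[OF assms(1), of i] vecs_apply[OF assms(2), of i] vecs_apply[OF assms(3), of i]
    vecs_apply[OF w, of i] assms(4-6)
  have "(w i \<oplus> c \<otimes> (p' i \<otimes> a \<oplus> q i \<otimes> x')) \<oplus> b \<otimes> (p i \<otimes> a \<oplus> q i \<otimes> (x \<oplus> c \<otimes> (d \<otimes> a)))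
    = (w i \<oplus> q i \<otimes> (b \<otimes> c \<otimes> d) \<otimes> a) \<oplus> ((b \<otimes> p i \<oplus> c \<otimes> p' i) \<otimes> a \<oplus> q i \<otimes> (b \<otimes> x \<oplus> c \<otimes> x'))"
    if "a \<in> carrier R" "x \<in> carrier R" "x' \<in> carrier R" "d \<in> carrier R" for a x x' d
    using that * by (simp add: l_distr r_distr m_ac a_ac)
  note alg = this[of "?f q w" "?f p w" "?f p' w" "?f p p'", folded assms(9)]
  have hh: "w i \<oplus> h \<otimes> (q i \<otimes> a \<oplus> q i \<otimes> a) = w i \<oplus> q i \<otimes> (h \<oplus> h) \<otimes> a" if "a \<in> carrier R" for a
    using that * by (simp add: l_distr r_distr m_ac a_ac)
  have "transv R n p q b (transv R n p' q c w) i =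
    transv R n p' q c w i \<oplus> b \<otimes> (p i \<otimes> ?f q (transv R n p' q c w) \<oplus> q i \<otimes> ?f p (transv R n p' q c w))"
    by (simp only: transv_def[of R n p q b])
  moreover have "?f q (transv R n p' q c w) = ?f q w" "?f p (transv R n p' q c w) = ?f p w \<oplus> c \<otimes> (?f p p' \<otimes> ?f q w)"
    using assms w o by (simp_all add: symp_form_transv)
  moreover have "transv R n (\<lambda>i. b \<otimes> p i \<oplus> c \<otimes> p' i) q \<one> (transv R n q q h w) i =
    transv R n q q h w i \<oplus> ((b \<otimes> p i \<oplus> c \<otimes> p' i) \<otimes> ?f q (transv R n q q h w) \<oplus>
      q i \<otimes> (b \<otimes> ?f p (transv R n q q h w) \<oplus> c \<otimes> ?f p' (transv R n q q h w)))"
    using assms w by (simp add: transv_def[of R n _ q \<one>] symp_form_lincomb vecs_apply)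
  moreover have "?f q (transv R n q q h w) = ?f q w" "?f p (transv R n q q h w) = ?f p w"
    "?f p' (transv R n q q h w) = ?f p' w"
    using assms w o by (simp_all add: symp_form_transv)
  ultimately show "transv R n p q b (transv R n p' q c w) i =
    transv R n (\<lambda>i. b \<otimes> p i \<oplus> c \<otimes> p' i) q \<one> (transv R n q q h w) i"
    using alg assms w by (simp add: hh transv_def[of R n p' q c] transv_def[of R n q q h])
qed (use assms in auto)

end

section \<open>Root elements\<close>

text \<open>Inverses are left out because a generator is inverted by negating its coefficient.
  Growth on the left gives an induction that peels off the leftmost factor.\<close>

inductive_set words :: "('a, 'b) ring_scheme \<Rightarrow> nat \<Rightarrow> 'a mat set \<Rightarrow> 'a mat set"
  for S :: "('a, 'b) ring_scheme" and m :: nat and G :: "'a mat set" where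
    one: "matrix_one S m \<in> words S m G"
  | cons: "g \<in> G \<Longrightarrow> w \<in> words S m G \<Longrightarrow> matrix_mult S g w \<in> words S m G"

text \<open>
  The vectors \<open>(1, 1)\<close> and \<open>(1, -1)\<close> of block \<open>k\<close>, counted from 0, have the indices \<open>2k\<close> and \<open>2k + 1\<close>.
  The vector with index \<open>partner i\<close> is the only one that is not orthogonal to the one with index \<open>i\<close>.
\<close>

definition base_vec :: "('a, 'b) ring_scheme \<Rightarrow> nat \<Rightarrow> nat \<Rightarrow> 'a" where
  "base_vec S i j = (if j div 2 = i div 2 then (if odd i \<and> odd j then \<ominus>\<^bsub>S\<^esub> \<one>\<^bsub>S\<^esub> else \<one>\<^bsub>S\<^esub>) else \<zero>\<^bsub>S\<^esub>)"

definition partner :: "nat \<Rightarrow> nat" where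
  "partner i = (if even i then i + 1 else i - 1)"

definition root_mat :: "('a, 'b) ring_scheme \<Rightarrow> nat \<Rightarrow> nat \<Rightarrow> nat \<Rightarrow> 'a \<Rightarrow> 'a mat" where
  "root_mat S n i j c = tmat S n (base_vec S i) (base_vec S j) c"

text \<open>The side condition leaves exactly the orthogonal pairs, \<open>i = j\<close> included.
  The set \<open>J\<close> keeps track of the divisibility of the coefficients.\<close>

definition root_gens :: "('a, 'b) ring_scheme \<Rightarrow> nat \<Rightarrow> 'a set \<Rightarrow> 'a mat set" where
  "root_gens S n J = {root_mat S n i j c | i j c. i < 2 * n \<and> j < 2 * n \<and> j \<noteq> partner i \<and> c \<in> J}"

text \<open>These are the generators of \<open>H\<close>; \<open>E_mat_generators\<close> proves the
  two sets equal.\<close>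

definition elem_gens :: "('a, 'b) ring_scheme \<Rightarrow> nat \<Rightarrow> 'a mat set" where
  "elem_gens S n = {root_mat S n i j c | i j c. i < 2 \<and> 2 \<le> j \<and> j < 2 * n \<and> c \<in> carrier S}"

abbreviation elem_words :: "('a, 'b) ring_scheme \<Rightarrow> nat \<Rightarrow> 'a mat set" where
  "elem_words S n \<equiv> words S (2 * n) (elem_gens S n)"

abbreviation root_words :: "('a, 'b) ring_scheme \<Rightarrow> nat \<Rightarrow> 'a set \<Rightarrow> 'a mat set" where
  "root_words S n J \<equiv> words S (2 * n) (root_gens S n J)"

lemma partner_partner [simp]: "partner (partner i) = i"
  unfolding partner_def by presburger

lemma partner_neq [simp]: "partner i \<noteq> i" "i \<noteq> partner i"
  unfolding partner_def by presburger+

lemma partner_div [simp]: "partner i div 2 = i div 2"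
  unfolding partner_def by presburger

lemma partner_less [simp]: "partner i < 2 * n \<longleftrightarrow> i < 2 * n"
  unfolding partner_def by presburger

lemma partner_iff: "j = partner i \<longleftrightarrow> j div 2 = i div 2 \<and> j \<noteq> i"
  by (cases "even i"; cases "even j") (auto simp: partner_def elim!: evenE oddE, presburger)

lemma partner_eq_iff: "partner i = j \<longleftrightarrow> i = partner j"
  by auto

lemma words_mono: "G \<subseteq> G' \<Longrightarrow> words S m G \<subseteq> words S m G'"
proof
  fix w assume "G \<subseteq> G'" "w \<in> words S m G"
  from this(2,1) show "w \<in> words S m G'" by induction (auto intro: words.intros)
qed

context cring
begin

lemma words_closed:
  assumes "G \<subseteq> mats R m" "w \<in> words R m G"
  shows "w \<in> mats R m"
  using assms(2,1) by induction auto

lemma words_gen: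
  assumes "G \<subseteq> mats R m" "g \<in> G"
  shows "g \<in> words R m G"
  using words.cons[OF assms(2) words.one, of R m] assms by auto

lemma words_mult:
  assumes "G \<subseteq> mats R m" "v \<in> words R m G" "w \<in> words R m G"
  shows "matrix_mult R v w \<in> words R m G"
  using assms(2)
proof induction
  case one
  then show ?case using words_closed[OF assms(1,3)] assms(3) by simp
next
  case (cons g v)
  then have "matrix_mult R (matrix_mult R g v) w = matrix_mult R g (matrix_mult R v w)"
    using assms words_closed by (intro matrix_mult_assoc[of _ m]) auto
  then show ?case using cons by (simp add: words.cons)
qed

lemma words_least:
  assumes "G' \<subseteq> mats R m" "G \<subseteq> words R m G'"
  shows "words R m G \<subseteq> words R m G'"
proof
  fix w assume "w \<in> words R m G"
  then show "w \<in> words R m G'"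
    by induction (use assms in \<open>auto intro: words.one words_mult\<close>)
qed

text \<open>While \<open>\<gamma>\<close> travels to the right end of the word, the factors it
  leaves behind accumulate on its left:
  \<open>\<gamma> g w = k \<gamma> w = k l \<gamma>\<close>.\<close>

lemma words_pass:
  assumes "G \<subseteq> mats R m" "G' \<subseteq> mats R m" "\<gamma> \<in> mats R m"
    and "\<And>g. g \<in> G \<Longrightarrow> \<exists>k\<in>words R m G'. matrix_mult R \<gamma> g = matrix_mult R k \<gamma>"
    and "w \<in> words R m G"
  shows "\<exists>k\<in>words R m G'. matrix_mult R \<gamma> w = matrix_mult R k \<gamma>"
  using assms(5)
proof induction
  case one
  then show ?case using assms(3) by (intro bexI[of _ "matrix_one R m"]) (auto intro: words.one)
next
  case (cons g w)
  obtain k where k: "k \<in> words R m G'" "matrix_mult R \<gamma> g = matrix_mult R k \<gamma>"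
    using assms(4) cons by blast
  obtain l where l: "l \<in> words R m G'" "matrix_mult R \<gamma> w = matrix_mult R l \<gamma>"
    using cons by blast
  have c: "g \<in> mats R m" "w \<in> mats R m" "k \<in> mats R m" "l \<in> mats R m"
    using cons k l assms(1,2) words_closed by blast+
  have "matrix_mult R \<gamma> (matrix_mult R g w) = matrix_mult R (matrix_mult R k \<gamma>) w"
    using c assms(3) k by (simp add: matrix_mult_assoc[symmetric, where m = m])
  also have "\<dots> = matrix_mult R (matrix_mult R k l) \<gamma>"
    using c assms(3) l by (simp add: matrix_mult_assoc[where m = m])
  finally show ?case using words_mult[OF assms(2) k(1) l(1)] by blast
qed

lemma matrix_conj_eq:
  assumes "A \<in> mats R m" "A' \<in> mats R m" "B \<in> mats R m" "C \<in> mats R m"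
    and "matrix_mult R A A' = matrix_one R m" "matrix_mult R A B = matrix_mult R C A"
  shows "matrix_mult R A (matrix_mult R B A') = C"
proof -
  have "matrix_mult R A (matrix_mult R B A') = matrix_mult R (matrix_mult R C A) A'"
    using matrix_mult_assoc[OF assms(1,3,2)] assms(6) by simp
  also have "\<dots> = C"
    using matrix_mult_assoc[OF assms(4,1,2)] assms(4,5) by simp
  finally show ?thesis .
qed

lemma matrix_mult_cancel:
  assumes "A \<in> mats R m" "A' \<in> mats R m" "B \<in> mats R m"
    and "matrix_mult R A' A = matrix_one R m" "matrix_mult R A B = C"
  shows "B = matrix_mult R A' C"
  using matrix_mult_assoc[OF assms(2,1,3)] assms(3-5) by simp

lemma tmat_scale:
  assumes "u \<in> vecs" "q \<in> vecs" "x \<in> carrier R"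
  shows "tmat R n (\<lambda>i. x \<otimes> u i) q \<one> = tmat R n u q x"
proof -
  have c: "covec R u j \<in> carrier R" "covec R q j \<in> carrier R" for j
    using assms by (simp_all add: covec_def vecs_apply)
  have *: "covec R (\<lambda>i. x \<otimes> u i) j = x \<otimes> covec R u j" for j
    using assms by (simp add: covec_def vecs_apply r_minus)
  have "\<one> \<otimes> (x \<otimes> u i \<otimes> covec R q j \<oplus> q i \<otimes> (x \<otimes> covec R u j)) =
    x \<otimes> (u i \<otimes> covec R q j \<oplus> q i \<otimes> covec R u j)" for i j
    using assms c by (simp add: r_distr m_ac vecs_apply)
  then show ?thesis unfolding tmat_def * by simp
qed

lemma tmat_zero:
  assumes "p \<in> vecs" "q \<in> vecs"
  shows "tmat R n p q \<zero> = matrix_one R (2 * n)"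
  using assms by (intro eq_matI) (simp_all add: tmat_def matrix_one_def covec_def vecs_apply)

text \<open>An instance of \<open>tmat_combine\<close> with coefficients \<open>x\<close> and
  \<open>x z\<close>. The vector \<open>p + z p'\<close> is the shape into which
  \<open>transv\<close> moves a basis vector, and \<open>x\<close> is the coefficient that stays in
  front.\<close>

lemma tmat_split:
  assumes "p \<in> vecs" "p' \<in> vecs" "q \<in> vecs" "x \<in> carrier R" "z \<in> carrier R" "h \<in> carrier R"
    and "symp_form R n p q = \<zero>" "symp_form R n p' q = \<zero>" "h \<oplus> h = x \<otimes> (x \<otimes> z) \<otimes> symp_form R n p p'"
  shows "matrix_mult R (tmat R n p q x) (tmat R n p' q (x \<otimes> z)) =
    matrix_mult R (tmat R n (\<lambda>i. p i \<oplus> z \<otimes> p' i) q x) (tmat R n q q h)"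
proof -
  have "(\<lambda>i. x \<otimes> p i \<oplus> (x \<otimes> z) \<otimes> p' i) = (\<lambda>i. x \<otimes> (p i \<oplus> z \<otimes> p' i))"
    using assms by (auto simp: vecs_apply r_distr m_assoc)
  moreover have "(\<lambda>i. p i \<oplus> z \<otimes> p' i) \<in> vecs" using assms by (auto simp: vecs_apply)
  ultimately show ?thesis
    using assms tmat_scale[of "\<lambda>i. p i \<oplus> z \<otimes> p' i" q x n]
    by (subst tmat_combine[where h = h]) auto
qed

lemma tmat_split_orth:
  assumes "p \<in> vecs" "p' \<in> vecs" "q \<in> vecs" "x \<in> carrier R" "z \<in> carrier R"
    and "symp_form R n p q = \<zero>" "symp_form R n p' q = \<zero>" "symp_form R n p p' = \<zero>"
  shows "tmat R n (\<lambda>i. p i \<oplus> z \<otimes> p' i) q x =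
    matrix_mult R (tmat R n p q x) (tmat R n p' q (x \<otimes> z))"
proof -
  have "(\<lambda>i. p i \<oplus> z \<otimes> p' i) \<in> vecs" using assms by (auto simp: vecs_apply)
  then have "tmat R n (\<lambda>i. p i \<oplus> z \<otimes> p' i) q x \<in> mats R (2 * n)" using assms by auto
  with assms show ?thesis
    by (subst tmat_split[where h = \<zero>]) (auto simp: tmat_zero)
qed

lemma tmat_add:
  assumes "p \<in> vecs" "q \<in> vecs" "x \<in> carrier R" "y \<in> carrier R" "symp_form R n p q = \<zero>"
  shows "matrix_mult R (tmat R n p q x) (tmat R n p q y) = tmat R n p q (x \<oplus> y)"
proof -
  have "(\<lambda>i. x \<otimes> p i \<oplus> y \<otimes> p i) = (\<lambda>i. (x \<oplus> y) \<otimes> p i)"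
    using assms by (auto simp: vecs_apply l_distr)
  then show ?thesis
    using assms tmat_closed[of p q "x \<oplus> y" n] tmat_scale[of p q "x \<oplus> y" n]
    by (subst tmat_combine[where h = \<zero>]) (auto simp: symp_form_self tmat_zero)
qed

lemma tmat_inverse:
  assumes "p \<in> vecs" "q \<in> vecs" "x \<in> carrier R" "symp_form R n p q = \<zero>"
  shows "matrix_mult R (tmat R n p q x) (tmat R n p q (\<ominus> x)) = matrix_one R (2 * n)"
    and "matrix_mult R (tmat R n p q (\<ominus> x)) (tmat R n p q x) = matrix_one R (2 * n)"
  using assms by (simp_all add: tmat_add r_neg l_neg tmat_zero)

text \<open>A basis vector is orthogonal to at least one of two basis vectors from different blocks,
  so only one summand of \<open>transv\<close> moves it.\<close>

lemma transv_fix: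
  assumes "p \<in> vecs" "q \<in> vecs" "y \<in> carrier R" "w \<in> vecs" "symp_form R n q w = \<zero>"
  shows "transv R n p q y w = (\<lambda>i. w i \<oplus> (y \<otimes> symp_form R n p w) \<otimes> q i)"
  using assms by (auto simp: transv_def vecs_apply m_ac)

lemma transv_commute:
  assumes "p \<in> vecs" "q \<in> vecs" "w \<in> vecs"
  shows "transv R n p q y w = transv R n q p y w"
  using assms by (auto simp: transv_def vecs_apply a_comm)

lemma base_vec_carrier [simp, intro]: "base_vec R i j \<in> carrier R"
  by (simp add: base_vec_def)

lemma base_vec_closed [simp, intro]: "base_vec R i \<in> vecs"
  by simp

text \<open>Only the block of \<open>i\<close> contributes, and there the form of
  \<open>(1, 1)\<close> and \<open>(1, -1)\<close> is -2.\<close>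

lemma symp_form_base_vec:
  assumes "i < 2 * n"
  shows "symp_form R n (base_vec R i) (base_vec R j) =
    (if j = partner i then (if even i then \<ominus> (\<one> \<oplus> \<one>) else \<one> \<oplus> \<one>) else \<zero>)"
proof -
  define t where "t = (\<lambda>k. base_vec R i (2 * k) \<otimes> base_vec R j (2 * k + 1) \<ominus> base_vec R i (2 * k + 1) \<otimes> base_vec R j (2 * k))"
  have t: "t k \<in> carrier R" for k
    by (auto simp: t_def vecs_apply)
  have "t k = (if i div 2 = k then t k else \<zero>)" for k
    by (auto simp: t_def base_vec_def a_minus_def)
  then have "symp_form R n (base_vec R i) (base_vec R j) = (\<Oplus>k\<in>{..<n}. if i div 2 = k then t k else \<zero>)"
    unfolding symp_form_def t_def[symmetric] by simp
  also have "\<dots> = t (i div 2)"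
    using assms t by (intro finsum_singleton) auto
  also have "\<dots> = (if j = partner i then (if even i then \<ominus> (\<one> \<oplus> \<one>) else \<one> \<oplus> \<one>) else \<zero>)"
  proof -
    consider "j div 2 \<noteq> i div 2" | "j = i" | "j = partner i" using partner_iff by blast
    then show ?thesis
    proof cases
      case 1
      then show ?thesis by (auto simp: t_def base_vec_def a_minus_def)
    next
      case 2
      then show ?thesis by (auto simp: t_def base_vec_def a_minus_def r_neg m_comm)
    next
      case 3
      then have "even j \<longleftrightarrow> odd i" by (auto simp: partner_def)
      then show ?thesis using 3
        by (auto simp: t_def base_vec_def a_minus_def minus_add)
    qed
  qed
  finally show ?thesis .
qed

lemma root_mat_closed [simp, intro]: "c \<in> carrier R \<Longrightarrow> root_mat R n i j c \<in> mats R (2 * n)"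
  by (auto simp: root_mat_def)

lemma root_mat_commute: "c \<in> carrier R \<Longrightarrow> root_mat R n i j c = root_mat R n j i c"
  unfolding root_mat_def by (intro tmat_commute_args) auto

lemma root_mat_inverse:
  assumes "c \<in> carrier R" "i < 2 * n" "j \<noteq> partner i"
  shows "matrix_mult R (root_mat R n i j c) (root_mat R n i j (\<ominus> c)) = matrix_one R (2 * n)"
    and "matrix_mult R (root_mat R n i j (\<ominus> c)) (root_mat R n i j c) = matrix_one R (2 * n)"
  using assms unfolding root_mat_def by (auto intro!: tmat_inverse simp: symp_form_base_vec)

lemma root_gens_closed: "J \<subseteq> carrier R \<Longrightarrow> root_gens R n J \<subseteq> mats R (2 * n)"
  by (auto simp: root_gens_def)

lemma elem_gens_closed: "elem_gens R n \<subseteq> mats R (2 * n)"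
  by (auto simp: elem_gens_def)

text \<open>The root element of \<open>p\<close>, \<open>q\<close> fixes the vector of
  \<open>j\<close> and moves the vector of \<open>partner p\<close> by \<open>a \<omega>\<close>
  times that of \<open>q\<close>. Conjugating the root element of \<open>partner p\<close>,
  \<open>j\<close> with it therefore reproduces that element and adds one for \<open>q\<close>,
  \<open>j\<close> with coefficient \<open>b a \<omega>\<close>; cancelling the first leaves the
  second.\<close>

lemma root_mat_commutator:
  assumes "p < 2 * n" "q < 2 * n" "j < 2 * n" "p div 2 \<noteq> q div 2" "p div 2 \<noteq> j div 2" "j \<noteq> partner q"
    and "a \<in> carrier R" "b \<in> carrier R"
  defines "\<omega> \<equiv> symp_form R n (base_vec R p) (base_vec R (partner p))"
  shows "root_mat R n q j (b \<otimes> (a \<otimes> \<omega>)) =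
    matrix_mult R (root_mat R n (partner p) j (\<ominus> b))
      (matrix_mult R (root_mat R n p q a)
        (matrix_mult R (root_mat R n (partner p) j b) (root_mat R n p q (\<ominus> a))))"
proof -
  let ?m = "matrix_mult R" and ?p' = "partner p" and ?B = "base_vec R"
  have n: "q \<noteq> partner p" "j \<noteq> partner p" "j \<noteq> partner ?p'" "q \<noteq> p" "j \<noteq> p" "partner p \<noteq> partner q" "?p' \<noteq> q"
    using assms(4,5) partner_div by metis+
  have w: "\<omega> \<in> carrier R" unfolding \<omega>_def by auto
  have o: "symp_form R n (?B p) (?B q) = \<zero>" "symp_form R n (?B q) (?B ?p') = \<zero>"
    "symp_form R n (?B q) (?B j) = \<zero>" "symp_form R n (?B p) (?B j) = \<zero>"
    "symp_form R n (?B ?p') (?B q) = \<zero>" "symp_form R n (?B ?p') (?B j) = \<zero>"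
    using assms(1-6) n by (simp_all add: symp_form_base_vec)
  have e1: "transv R n (?B p) (?B q) a (?B ?p') = (\<lambda>i. ?B ?p' i \<oplus> (a \<otimes> \<omega>) \<otimes> ?B q i)"
    unfolding \<omega>_def by (rule transv_fix) (simp_all add: o assms(7))
  have e2: "transv R n (?B p) (?B q) a (?B j) = ?B j"
    by (subst transv_fix) (simp_all add: o assms(7))
  have "?m (root_mat R n p q a) (root_mat R n ?p' j b) =
    ?m (tmat R n (\<lambda>i. ?B ?p' i \<oplus> (a \<otimes> \<omega>) \<otimes> ?B q i) (?B j) b) (root_mat R n p q a)"
    unfolding root_mat_def
    by (subst tmat_conj) (simp_all add: o e1 e2 assms(7,8))
  also have "tmat R n (\<lambda>i. ?B ?p' i \<oplus> (a \<otimes> \<omega>) \<otimes> ?B q i) (?B j) b =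
    ?m (root_mat R n ?p' j b) (root_mat R n q j (b \<otimes> (a \<otimes> \<omega>)))"
    unfolding root_mat_def by (rule tmat_split_orth) (simp_all add: o w assms(7,8))
  finally have "?m (root_mat R n p q a) (root_mat R n ?p' j b) =
    ?m (?m (root_mat R n ?p' j b) (root_mat R n q j (b \<otimes> (a \<otimes> \<omega>)))) (root_mat R n p q a)" .
  then have "?m (root_mat R n p q a) (?m (root_mat R n ?p' j b) (root_mat R n p q (\<ominus> a))) =
    ?m (root_mat R n ?p' j b) (root_mat R n q j (b \<otimes> (a \<otimes> \<omega>)))"
    using assms(7,8) w root_mat_inverse(1)[OF assms(7,1) n(1)]
    by - (rule matrix_conj_eq[where m = "2 * n"], simp_all)
  then show ?thesis
    using assms(7,8) w root_mat_inverse(2)[of b ?p' n j] assms(1) n(3)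
    by - (rule matrix_mult_cancel[where m = "2 * n"], simp_all)
qed

text \<open>The transvection along \<open>partner p\<close> moves the vector of \<open>p\<close> by
  \<open>a (\<omega> + \<omega>)\<close> times that of \<open>partner p\<close> and fixes the one of
  \<open>partner q\<close>. Conjugating the root element of \<open>p\<close>,
  \<open>partner q\<close> with it and splitting the result produces the opposite root element.
  Every factor on the right avoids the pair \<open>partner p\<close>,
  \<open>partner q\<close>.\<close>

lemma root_mat_opposite:
  assumes "p < 2 * n" "q < 2 * n" "p div 2 \<noteq> q div 2" "a \<in> carrier R" "b \<in> carrier R"
  defines "\<omega> \<equiv> symp_form R n (base_vec R (partner p)) (base_vec R p)"
  shows "root_mat R n (partner p) (partner q) (b \<otimes> (a \<otimes> (\<omega> \<oplus> \<omega>))) =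
    matrix_mult R (root_mat R n p (partner q) (\<ominus> b))
      (matrix_mult R (root_mat R n (partner p) (partner p) a)
        (matrix_mult R (root_mat R n p (partner q) b)
          (matrix_mult R (root_mat R n (partner p) (partner p) (\<ominus> a))
            (root_mat R n (partner q) (partner q) (\<ominus> (b \<otimes> (b \<otimes> a) \<otimes> (\<omega> \<otimes> \<omega>)))))))"
proof -
  let ?m = "matrix_mult R" and ?p' = "partner p" and ?q' = "partner q" and ?B = "base_vec R"
  have n: "q \<noteq> partner p" "q \<noteq> p" "partner p \<noteq> partner q" "?p' \<noteq> q" "?q' \<noteq> p" "?q' \<noteq> ?p'" "p \<noteq> ?q'"
    using assms(3) partner_div by metis+
  have w: "\<omega> \<in> carrier R" unfolding \<omega>_def by auto
  have o: "symp_form R n (?B ?p') (?B ?q') = \<zero>" "symp_form R n (?B p) (?B ?q') = \<zero>"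
    using assms(1-3) n by (simp_all add: symp_form_base_vec)
  \<comment> \<open>The correction from \<open>tmat_split\<close>, because \<open>p\<close> and
    \<open>partner p\<close> are not orthogonal. Since \<open><p, partner p> = -\<omega>\<close> and
    \<open>?z\<close> contains \<open>\<omega> + \<omega>\<close>, the half of
    \<open>b (b ?z) (-\<omega>)\<close> exists without dividing.\<close>
  let ?h = "\<ominus> (b \<otimes> (b \<otimes> a) \<otimes> (\<omega> \<otimes> \<omega>))"
  let ?z = "a \<otimes> (\<omega> \<oplus> \<omega>)"
  let ?T = "tmat R n (\<lambda>i. ?B p i \<oplus> ?z \<otimes> ?B ?p' i) (?B ?q') b"
  have pw: "symp_form R n (?B p) (?B ?p') = \<ominus> \<omega>"
    unfolding \<omega>_def by (rule symp_form_skew) auto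
  have zv: "(\<lambda>i. ?B p i \<oplus> ?z \<otimes> ?B ?p' i) \<in> vecs"
    using w assms(4) by (auto simp: vecs_apply)
  have T: "?T \<in> mats R (2 * n)" using zv assms(5) by auto
  have e1: "transv R n (?B ?p') (?B ?p') a (?B p) = (\<lambda>i. ?B p i \<oplus> ?z \<otimes> ?B ?p' i)"
    unfolding transv_def \<omega>_def[symmetric] using w assms(4)
    by (simp add: r_distr l_distr m_ac)
  have e2: "transv R n (?B ?p') (?B ?p') a (?B ?q') = ?B ?q'"
    by (subst transv_fix) (simp_all add: o assms(4))
  have "?m (root_mat R n ?p' ?p' a) (root_mat R n p ?q' b) = ?m ?T (root_mat R n ?p' ?p' a)"
    unfolding root_mat_def
    by (subst tmat_conj) (simp_all add: o e1 e2 assms(4,5) symp_form_self)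
  then have 1: "?m (root_mat R n ?p' ?p' a) (?m (root_mat R n p ?q' b) (root_mat R n ?p' ?p' (\<ominus> a))) = ?T"
    using assms(4,5) T root_mat_inverse(1)[of a ?p' n ?p'] assms(1)
    by - (rule matrix_conj_eq[where m = "2 * n"], simp_all)
  have hh: "?h \<oplus> ?h = b \<otimes> (b \<otimes> ?z) \<otimes> (\<ominus> \<omega>)"
    using w assms(4,5) by (simp add: r_distr l_distr m_ac r_minus minus_add)
  have 2: "?m (root_mat R n p ?q' b) (root_mat R n ?p' ?q' (b \<otimes> ?z)) = ?m ?T (root_mat R n ?q' ?q' ?h)"
    unfolding root_mat_def by (rule tmat_split) (simp_all add: o w hh pw assms(4,5))
  have "root_mat R n ?p' ?q' (b \<otimes> ?z) = ?m (root_mat R n p ?q' (\<ominus> b)) (?m ?T (root_mat R n ?q' ?q' ?h))"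
    using assms(4,5) w 2 root_mat_inverse(2)[of b p n ?q'] assms(1) n
    by - (rule matrix_mult_cancel[where m = "2 * n"], simp_all)
  then show ?thesis
    unfolding 1[symmetric] using assms(4,5) w
    by (simp add: matrix_mult_assoc[where m = "2 * n"])
qed

lemma base_form_unit:
  assumes "\<one> \<oplus> \<one> \<in> Units R" "i < 2 * n"
  shows "symp_form R n (base_vec R i) (base_vec R (partner i)) \<in> Units R"
proof -
  have "\<ominus> (\<one> \<oplus> \<one>) \<in> Units R"
  proof -
    obtain v where "v \<in> carrier R" "(\<one> \<oplus> \<one>) \<otimes> v = \<one>" using assms(1) by (auto simp: Units_def m_comm)
    then have "(\<ominus> (\<one> \<oplus> \<one>)) \<otimes> (\<ominus> v) = \<one>" by (simp add: l_minus r_minus)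
    then show ?thesis using \<open>v \<in> carrier R\<close> by (auto simp: Units_def m_comm)
  qed
  then show ?thesis using assms by (auto simp: symp_form_base_vec)
qed

lemma elem_gens_root:
  assumes "i < 2" "2 \<le> j" "j < 2 * n" "c \<in> carrier R"
  shows "root_mat R n i j c \<in> elem_words R n"
    and "root_mat R n j i c \<in> elem_words R n"
proof -
  show 1: "root_mat R n i j c \<in> elem_words R n"
    using assms by (intro words_gen elem_gens_closed) (auto simp: elem_gens_def)
  then show "root_mat R n j i c \<in> elem_words R n"
    using assms root_mat_commute[of c n i j] by simp
qed

text \<open>A pair that does not join the first block to a later one is reached by a commutator
  through an auxiliary index \<open>p\<close> in a block different from those of the pair. Since
  \<open>\<omega>\<close> is a unit, the coefficients \<open>c / \<omega>\<close> and 1 give exactly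
  \<open>c\<close>.\<close>

lemma root_gens_elementary:
  assumes "\<one> \<oplus> \<one> \<in> Units R" "n \<ge> 2"
  shows "root_words R n (carrier R) \<subseteq> elem_words R n"
proof (rule words_least[OF elem_gens_closed], rule subsetI)
  let ?W = "elem_words R n"
  fix g assume "g \<in> root_gens R n (carrier R)"
  then obtain i j c where g: "g = root_mat R n i j c" and ij: "i < 2 * n" "j < 2 * n" "j \<noteq> partner i"
    and c: "c \<in> carrier R" by (auto simp: root_gens_def)
  have *: "root_mat R n q j c \<in> ?W"
    if "p < 2 * n" "q < 2 * n" "j < 2 * n" "p div 2 \<noteq> q div 2" "p div 2 \<noteq> j div 2" "j \<noteq> partner q"
      "\<And>b. b \<in> carrier R \<Longrightarrow> root_mat R n (partner p) j b \<in> ?W"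
      "\<And>a. a \<in> carrier R \<Longrightarrow> root_mat R n p q a \<in> ?W" for p q j
  proof -
    let ?w = "symp_form R n (base_vec R p) (base_vec R (partner p))"
    have w: "?w \<in> Units R" using assms(1) that(1) by (rule base_form_unit)
    then have "\<one> \<otimes> (c \<otimes> inv ?w \<otimes> ?w) = c" using c by (simp add: m_assoc)
    moreover have cw: "c \<otimes> inv ?w \<in> carrier R" using c w by simp
    ultimately have "root_mat R n q j c =
      matrix_mult R (root_mat R n (partner p) j (\<ominus> \<one>))
      (matrix_mult R (root_mat R n p q (c \<otimes> inv ?w))
        (matrix_mult R (root_mat R n (partner p) j \<one>) (root_mat R n p q (\<ominus> (c \<otimes> inv ?w)))))"
      using root_mat_commutator[OF that(1-6) cw one_closed] by (simp only:)
    then show ?thesis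
      using that cw by (simp add: words_mult elem_gens_closed)
  qed
  consider "i < 2" "2 \<le> j" | "2 \<le> i" "j < 2" | "2 \<le> i" "2 \<le> j" | "i < 2" "j = i"
    using ij(3) partner_iff[of j i] by force
  then show "g \<in> ?W"
  proof cases
    \<comment> \<open>Both vectors lie in later blocks, so the commutator goes through index 0 of
      the first block.\<close>
    case 3
    then show ?thesis unfolding g using ij
      by (intro *[of 0 i j]) (auto simp: partner_def intro: elem_gens_root)
  next
    \<comment> \<open>Both vectors lie in the first block and coincide. Index 2 belongs to the
      second block, which exists because \<open>n \<ge> 2\<close>.\<close>
    case 4
    then show ?thesis unfolding g using ij assms(2)
      by (intro *[of 2 i j]) (auto simp: partner_def intro: elem_gens_root)
  qed (use g ij c in \<open>auto intro: elem_gens_root\<close>)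
qed

text \<open>Used twice in \<open>local_shift\<close>: to cancel the image of \<open>\<alpha>\<close>
  and to normalize \<open>\<beta>\<close> at \<open>Z = 0\<close> without leaving the words.\<close>

lemma elem_words_inverse:
  assumes "w \<in> elem_words R n"
  shows "\<exists>v\<in>elem_words R n. matrix_mult R w v = matrix_one R (2 * n)"
  using assms
proof induction
  case one
  then show ?case by (intro bexI[of _ "matrix_one R (2 * n)"]) (auto intro: words.one)
next
  case (cons g w)
  obtain i j c where g: "g = root_mat R n i j c" "i < 2" "2 \<le> j" "j < 2 * n" "c \<in> carrier R"
    using cons(1) by (auto simp: elem_gens_def)
  then have j: "j \<noteq> partner i" by (auto simp: partner_def)
  obtain v where v: "v \<in> elem_words R n" "matrix_mult R w v = matrix_one R (2 * n)"
    using cons by blast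
  let ?g = "root_mat R n i j (\<ominus> c)"
  have c: "w \<in> mats R (2 * n)" "v \<in> mats R (2 * n)" "g \<in> mats R (2 * n)" "?g \<in> mats R (2 * n)"
    using cons v g words_closed[OF elem_gens_closed] by auto
  have "matrix_mult R (matrix_mult R g w) (matrix_mult R v ?g) = matrix_mult R g (matrix_mult R (matrix_mult R w v) ?g)"
    using c by (simp add: matrix_mult_assoc[where m = "2 * n"])
  also have "\<dots> = matrix_one R (2 * n)"
    using c v g j by (simp add: root_mat_inverse)
  finally show ?case using v g
    by (intro bexI[of _ "matrix_mult R v ?g"]) (simp_all add: words_mult elem_gens_closed elem_gens_root(1))
qed

end

section \<open>Conjugation of root elements over a localization\<close>

context ring_hom_cring
begin

lemma hom_base_vec: "h (base_vec R i j) = base_vec S i j"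
  by (simp add: base_vec_def)

lemma hom_symp_form_base_vec:
  "h (symp_form R n (base_vec R i) (base_vec R j)) = symp_form S n (base_vec S i) (base_vec S j)"
proof -
  define t where "t = (\<lambda>k. base_vec R i (2 * k) \<otimes> base_vec R j (2 * k + 1) \<ominus> base_vec R i (2 * k + 1) \<otimes> base_vec R j (2 * k))"
  have t: "t \<in> {..<n} \<rightarrow> carrier R" by (simp add: t_def)
  have "h (t k) = base_vec S i (2 * k) \<otimes>\<^bsub>S\<^esub> base_vec S j (2 * k + 1)
      \<ominus>\<^bsub>S\<^esub> base_vec S i (2 * k + 1) \<otimes>\<^bsub>S\<^esub> base_vec S j (2 * k)" for k
    by (simp add: t_def a_minus_def hom_base_vec)
  with hom_finsum[OF t] show ?thesis
    by (simp only: symp_form_def t_def[symmetric] comp_def)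
qed

lemma map_root_mat:
  assumes "c \<in> carrier R"
  shows "map_mat h (root_mat R n i j c) = root_mat S n i j (h c)"
proof -
  have c: "covec R (base_vec R i) k \<in> carrier R" "h (covec R (base_vec R i) k) = covec S (base_vec S i) k" for i k
    by (simp_all add: covec_def hom_base_vec)
  show ?thesis
    by (rule eq_matI) (simp_all add: root_mat_def tmat_def assms c hom_base_vec)
qed

lemma map_words:
  assumes "G \<subseteq> mats R m" "w \<in> words R m G" "\<And>g. g \<in> G \<Longrightarrow> map_mat h g \<in> G'"
  shows "map_mat h w \<in> words S m G'"
  using assms(2)
proof induction
  case one
  then show ?case by (simp add: map_mat_one words.one)
next
  case (cons g w)
  then have "w \<in> mats R m" using R.words_closed[OF assms(1)] by blast
  then have "map_mat h (matrix_mult R g w) = matrix_mult S (map_mat h g) (map_mat h w)"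
    using cons assms(1) by (intro map_mat_mult) auto
  with cons assms(3) show ?case by (simp add: words.cons)
qed

lemma map_elem_words:
  assumes "w \<in> elem_words R n"
  shows "map_mat h w \<in> elem_words S n"
proof (rule map_words[OF R.elem_gens_closed assms])
  fix g assume "g \<in> elem_gens R n"
  then show "map_mat h g \<in> elem_gens S n"
    unfolding elem_gens_def by (force simp: map_root_mat)
qed

text \<open>Basis vectors go to basis vectors, so only the coefficients need preimages. The lift
  depends on the chosen preimages.\<close>

lemma lift_root_words:
  assumes "k \<in> root_words S n (h ` carrier R)"
  shows "\<exists>v\<in>root_words R n (carrier R). map_mat h v = k"
  using assms
proof induction
  case one
  show ?case
    by (intro bexI[of _ "matrix_one R (2 * n)"]) (simp_all add: map_mat_one words.one)
next
  case (cons g k)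
  obtain i j c where g: "g = root_mat S n i j (h c)" "i < 2 * n" "j < 2 * n" "j \<noteq> partner i" "c \<in> carrier R"
    using cons(1) by (auto simp: root_gens_def)
  obtain v where v: "v \<in> root_words R n (carrier R)" "map_mat h v = k"
    using cons by blast
  have "root_mat R n i j c \<in> root_gens R n (carrier R)"
    using g by (auto simp: root_gens_def)
  moreover have "v \<in> mats R (2 * n)"
    using R.words_closed[OF R.root_gens_closed v(1)] by simp
  ultimately show ?case using g v
    by (intro bexI[of _ "matrix_mult R (root_mat R n i j c) v"] words.cons)
      (simp_all add: map_mat_mult[where m = "2 * n"] map_root_mat)
qed

lemma hom_Units:
  assumes "x \<in> Units R"
  shows "h x \<in> Units S"
proof -
  have x: "x \<in> carrier R" "inv x \<in> carrier R" "inv x \<otimes> x = \<one>" "x \<otimes> inv x = \<one>"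
    using assms by (auto intro: R.Units_closed)
  from x(3,4) have "h (inv x) \<otimes>\<^bsub>S\<^esub> h x = \<one>\<^bsub>S\<^esub>" "h x \<otimes>\<^bsub>S\<^esub> h (inv x) = \<one>\<^bsub>S\<^esub>"
    using hom_mult[OF x(1,2)] hom_mult[OF x(2,1)] by simp_all
  with x(1,2) show ?thesis unfolding Units_def by blast
qed

end

text \<open>A localization described by denominators and annihilators alone. In this form the notion
  passes to polynomial rings, with the elements of \<open>M\<close> as constants, so two
  applications of \<open>localization_hom_UP\<close> reach the map of
  \<open>R[X][Z]\<close>.\<close>

locale localization_hom = ring_hom_cring R S h for R (structure) and S (structure) and h +
  fixes M
  assumes M_subset: "M \<subseteq> carrier R"
    and M_one [simp, intro]: "\<one> \<in> M"
    and M_mult [simp, intro]: "\<lbrakk>s \<in> M; t \<in> M\<rbrakk> \<Longrightarrow> s \<otimes> t \<in> M"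
    and denominator: "y \<in> carrier S \<Longrightarrow> \<exists>u\<in>M. \<exists>b\<in>carrier R. h u \<otimes>\<^bsub>S\<^esub> y = h b"
    and annihilator: "\<lbrakk>b \<in> carrier R; h b = \<zero>\<^bsub>S\<^esub>\<rbrakk> \<Longrightarrow> \<exists>u\<in>M. u \<otimes> b = \<zero>"
begin

lemma M_carrier [simp, intro]: "s \<in> M \<Longrightarrow> s \<in> carrier R"
  using M_subset by blast

text \<open>The image in \<open>S\<close> of the principal ideal of \<open>s\<close>. These sets
  play the part of neighbourhoods of zero.\<close>

definition multiples :: "'a \<Rightarrow> 'c set" where
  "multiples s = (\<lambda>b. h (s \<otimes> b)) ` carrier R"

lemma multiples_subset: "s \<in> M \<Longrightarrow> multiples s \<subseteq> carrier S"
  by (auto simp: multiples_def)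

lemma multiplesI: "s \<in> M \<Longrightarrow> b \<in> carrier R \<Longrightarrow> x = h (s \<otimes> b) \<Longrightarrow> x \<in> multiples s"
  by (auto simp: multiples_def)

lemma multiples_antimono:
  assumes "s \<in> M" "t \<in> M"
  shows "multiples (s \<otimes> t) \<subseteq> multiples s"
proof
  fix x assume "x \<in> multiples (s \<otimes> t)"
  then obtain c where c: "c \<in> carrier R" "x = h (s \<otimes> t \<otimes> c)" by (auto simp: multiples_def)
  then show "x \<in> multiples s"
    using assms by (intro multiplesI[of s "t \<otimes> c"]) (simp_all add: S.m_assoc)
qed

text \<open>
  Opposite roots are excluded because the conjugate then does not expand into root elements;
  \<open>root_mat_opposite\<close> writes a root element of the opposite root as a product of others.
\<close>

lemma conj_root_mat:
  assumes pq: "p < 2 * n" "q < 2 * n" "p div 2 \<noteq> q div 2"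
    and ef: "e < 2 * n" "f < 2 * n" "f \<noteq> partner e"
    and nopp: "\<not> (e = partner p \<and> f = partner q)" "\<not> (e = partner q \<and> f = partner p)"
    and s: "s \<in> M" and u: "u \<in> M" and b: "b \<in> carrier R"
    and y: "y \<in> carrier S" "h u \<otimes>\<^bsub>S\<^esub> y = h b"
    and x: "x \<in> multiples (s \<otimes> (u \<otimes> u))"
  shows "\<exists>k\<in>root_words S n (multiples s).
    matrix_mult S (root_mat S n p q y) (root_mat S n e f x) = matrix_mult S k (root_mat S n p q y)"
proof -
  let ?B = "base_vec S" and ?F = "symp_form S n"
  \<comment> \<open>The conjugating map sends the basis vector of \<open>i\<close> to itself plus
    \<open>z i\<close> times the basis vector of \<open>g i\<close>. For the fixed vectors
    \<open>z i\<close> is zero and \<open>g i = i\<close> is only a placeholder.\<close>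
  define g where "g i = (if i = partner p then q else if i = partner q then p else i)" for i
  define w where "w i = (if i = partner p then symp_form R n (base_vec R p) (base_vec R (partner p))
    else if i = partner q then symp_form R n (base_vec R q) (base_vec R (partner q)) else \<zero>)" for i
  define z where "z i = y \<otimes>\<^bsub>S\<^esub> h (w i)" for i
  have w: "w i \<in> carrier R" for i by (simp add: w_def)
  have z: "z i \<in> carrier S" for i using y w by (simp add: z_def)
  have xc: "x \<in> carrier S" using x s u multiples_subset[of "s \<otimes> (u \<otimes> u)"] by auto
  have pq': "q \<noteq> partner p" "p \<noteq> partner q" "partner p \<noteq> partner q" "p \<noteq> q"
    using pq(3) partner_div by metis+
  have act: "transv S n (?B p) (?B q) y (?B i) = (\<lambda>k. ?B i k \<oplus>\<^bsub>S\<^esub> z i \<otimes>\<^bsub>S\<^esub> ?B (g i) k)" for i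
  proof -
    consider "i = partner p" | "i = partner q" | "i \<noteq> partner p" "i \<noteq> partner q" by blast
    then show ?thesis
    proof cases
      case 1
      have "?F (?B q) (?B (partner p)) = \<zero>\<^bsub>S\<^esub>"
        using pq pq' by (simp add: S.symp_form_base_vec)
      then show ?thesis using 1 y
        by (simp add: S.transv_fix g_def z_def w_def hom_symp_form_base_vec)
    next
      case 2
      have "?F (?B p) (?B (partner q)) = \<zero>\<^bsub>S\<^esub>"
        using pq pq' by (simp add: S.symp_form_base_vec)
      then show ?thesis using 2 y pq'
        by (simp add: S.transv_commute[of "?B p"] S.transv_fix g_def z_def w_def hom_symp_form_base_vec)
    next
      case 3
      then have "?F (?B p) (?B i) = \<zero>\<^bsub>S\<^esub>" "?F (?B q) (?B i) = \<zero>\<^bsub>S\<^esub>"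
        using pq by (simp_all add: S.symp_form_base_vec)
      then show ?thesis using 3 y
        by (simp add: S.transv_fix g_def z_def w_def)
    qed
  qed
  have gl: "g e < 2 * n" "g f < 2 * n" using pq ef by (simp_all add: g_def)
  \<comment> \<open>Orthogonality of all pairs in the expansion. For the excluded
    \<open>e = partner p\<close>, \<open>f = partner q\<close> one has \<open>g e = q\<close>, which
    is not orthogonal to \<open>f\<close>.\<close>
  have or: "f \<noteq> partner (g e)" "g f \<noteq> partner e" "g f \<noteq> partner (g e)" "g e \<noteq> partner e" "g f \<noteq> partner f"
    using pq' ef nopp unfolding g_def by (auto simp: partner_eq_iff)
  have fe: "e \<noteq> partner f" "g e \<noteq> partner f" "e \<noteq> partner (g f)" "g e \<noteq> partner (g f)"
    using or ef by auto
  note F = S.symp_form_base_vec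
  let ?Q = "\<lambda>k. ?B f k \<oplus>\<^bsub>S\<^esub> z f \<otimes>\<^bsub>S\<^esub> ?B (g f) k"
  have Q: "?Q \<in> S.vecs" using z by simp
  have Q0: "?F (?B i) ?Q = \<zero>\<^bsub>S\<^esub>" if "i < 2 * n" "f \<noteq> partner i" "g f \<noteq> partner i" for i
    using that z S.symp_form_add[of "?B i" "?B f" "\<lambda>k. z f \<otimes>\<^bsub>S\<^esub> ?B (g f) k" n]
      S.symp_form_smult[of "?B i" "?B (g f)" "z f" n]
    by (simp add: F)
  have exp: "tmat S n (?B i) ?Q x' = matrix_mult S (root_mat S n f i x') (root_mat S n (g f) i (x' \<otimes>\<^bsub>S\<^esub> z f))"
    if "i < 2 * n" "f \<noteq> partner i" "g f \<noteq> partner i" "x' \<in> carrier S" for i x'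
  proof -
    have "tmat S n (?B i) ?Q x' = tmat S n ?Q (?B i) x'"
      using Q that by (intro S.tmat_commute_args) auto
    also have "\<dots> = matrix_mult S (root_mat S n f i x') (root_mat S n (g f) i (x' \<otimes>\<^bsub>S\<^esub> z f))"
      unfolding root_mat_def using that z ef gl or
      by (intro S.tmat_split_orth) (auto simp: F)
    finally show ?thesis .
  qed
  have x1: "x \<otimes>\<^bsub>S\<^esub> z e \<in> carrier S" using xc z by simp
  \<comment> \<open>Both vectors of the conjugate are sums of two basis vectors; expanding in each
    of them gives four root elements, with coefficients \<open>x\<close>, \<open>x z\<close>,
    \<open>x z\<close> and \<open>x z z\<close>.\<close>
  let ?k = "matrix_mult S
    (matrix_mult S (root_mat S n f e x) (root_mat S n (g f) e (x \<otimes>\<^bsub>S\<^esub> z f)))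
    (matrix_mult S (root_mat S n f (g e) (x \<otimes>\<^bsub>S\<^esub> z e)) (root_mat S n (g f) (g e) (x \<otimes>\<^bsub>S\<^esub> z e \<otimes>\<^bsub>S\<^esub> z f)))"
  have "matrix_mult S (root_mat S n p q y) (root_mat S n e f x) =
    matrix_mult S (tmat S n (\<lambda>k. ?B e k \<oplus>\<^bsub>S\<^esub> z e \<otimes>\<^bsub>S\<^esub> ?B (g e) k) ?Q x) (root_mat S n p q y)"
    unfolding root_mat_def using y xc pq pq'
    by (subst S.tmat_conj) (simp_all add: act F)
  also have "tmat S n (\<lambda>k. ?B e k \<oplus>\<^bsub>S\<^esub> z e \<otimes>\<^bsub>S\<^esub> ?B (g e) k) ?Q x =
    matrix_mult S (tmat S n (?B e) ?Q x) (tmat S n (?B (g e)) ?Q (x \<otimes>\<^bsub>S\<^esub> z e))"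
    using Q xc z Q0[of e] Q0[of "g e"] ef gl or
    by (intro S.tmat_split_orth) (simp_all add: F)
  also have "\<dots> = ?k"
    using ef gl or xc x1 by (simp add: exp)
  finally have eq: "matrix_mult S (root_mat S n p q y) (root_mat S n e f x) = matrix_mult S ?k (root_mat S n p q y)" .
  obtain c where c: "c \<in> carrier R" "x = h (s \<otimes> (u \<otimes> u) \<otimes> c)"
    using x by (auto simp: multiples_def)
  have xs: "x \<in> multiples s"
    using multiples_antimono[of s "u \<otimes> u"] s u x by auto
  \<comment> \<open>Each \<open>z\<close> contains one factor \<open>y\<close>, and each of the two
    factors \<open>u\<close> in \<open>x\<close> clears one of them.\<close>
  have xz: "x \<otimes>\<^bsub>S\<^esub> z i \<in> multiples s" for i
  proof (rule multiplesI[OF s])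
    show "u \<otimes> c \<otimes> b \<otimes> w i \<in> carrier R" using u c b w by simp
    have "x \<otimes>\<^bsub>S\<^esub> z i = h s \<otimes>\<^bsub>S\<^esub> (h u \<otimes>\<^bsub>S\<^esub> h c \<otimes>\<^bsub>S\<^esub> (h u \<otimes>\<^bsub>S\<^esub> y) \<otimes>\<^bsub>S\<^esub> h (w i))"
      using s u c y(1) w by (simp add: z_def S.m_ac)
    then show "x \<otimes>\<^bsub>S\<^esub> z i = h (s \<otimes> (u \<otimes> c \<otimes> b \<otimes> w i))"
      using s u c b w y(2) by simp
  qed
  have xzz: "x \<otimes>\<^bsub>S\<^esub> z i \<otimes>\<^bsub>S\<^esub> z j \<in> multiples s" for i j
  proof (rule multiplesI[OF s])
    show "c \<otimes> b \<otimes> w i \<otimes> (b \<otimes> w j) \<in> carrier R" using u c b w by simp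
    have "x \<otimes>\<^bsub>S\<^esub> z i \<otimes>\<^bsub>S\<^esub> z j =
      h s \<otimes>\<^bsub>S\<^esub> (h c \<otimes>\<^bsub>S\<^esub> (h u \<otimes>\<^bsub>S\<^esub> y) \<otimes>\<^bsub>S\<^esub> h (w i) \<otimes>\<^bsub>S\<^esub> ((h u \<otimes>\<^bsub>S\<^esub> y) \<otimes>\<^bsub>S\<^esub> h (w j)))"
      using s u c y(1) w by (simp add: z_def S.m_ac)
    then show "x \<otimes>\<^bsub>S\<^esub> z i \<otimes>\<^bsub>S\<^esub> z j = h (s \<otimes> (c \<otimes> b \<otimes> w i \<otimes> (b \<otimes> w j)))"
      using s u c b w y(2) by simp
  qed
  have G: "root_gens S n (multiples s) \<subseteq> mats S (2 * n)"
    using s by (intro S.root_gens_closed multiples_subset)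
  have gen: "root_mat S n i j x' \<in> root_words S n (multiples s)"
    if "i < 2 * n" "j < 2 * n" "j \<noteq> partner i" "x' \<in> multiples s" for i j x'
    using that by (intro S.words_gen[OF G]) (auto simp: root_gens_def)
  have "?k \<in> root_words S n (multiples s)"
    using ef gl fe xs xz xzz by (intro S.words_mult[OF G] gen) auto
  with eq show ?thesis by blast
qed

end

context localization_hom
begin

lemma root_gens_multiples: "s \<in> M \<Longrightarrow> root_gens S n (multiples s) \<subseteq> mats S (2 * n)"
  by (intro S.root_gens_closed multiples_subset)

text \<open>Root elements that are not opposite to the conjugating one are covered by
  \<open>conj_root_mat\<close>. An opposite one is first rewritten by
  \<open>root_mat_opposite\<close>, which needs its coefficient as a product of two elements of
  \<open>multiples t\<close>, up to a unit. Hence the final denominator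
  \<open>t \<otimes> t\<close>.\<close>

lemma conj_root_gens:
  assumes two: "\<one> \<oplus> \<one> \<in> Units R"
    and pq: "p < 2 * n" "q < 2 * n" "p div 2 \<noteq> q div 2" and s: "s \<in> M" and y: "y \<in> carrier S"
  shows "\<exists>t\<in>M. \<forall>w\<in>root_words S n (multiples t).
    \<exists>k\<in>root_words S n (multiples s).
      matrix_mult S (root_mat S n p q y) w = matrix_mult S k (root_mat S n p q y)"
proof -
  obtain u b where u: "u \<in> M" "b \<in> carrier R" "h u \<otimes>\<^bsub>S\<^esub> y = h b"
    using denominator[OF y] by blast
  define t where "t = s \<otimes> (u \<otimes> u)"
  have t: "t \<in> M" using s u by (simp add: t_def)
  \<comment> \<open>The generators with coefficients in \<open>multiples t\<close> to which
    \<open>conj_root_mat\<close> applies.\<close>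
  define N where "N = {root_mat S n e f x | e f x. e < 2 * n \<and> f < 2 * n \<and> f \<noteq> partner e \<and>
    \<not> (e = partner p \<and> f = partner q) \<and> \<not> (e = partner q \<and> f = partner p) \<and> x \<in> multiples t}"
  have N: "N \<subseteq> mats S (2 * n)"
    using multiples_subset[OF t] by (auto simp: N_def)
  have NI: "root_mat S n e f x \<in> words S (2 * n) N" if "e < 2 * n" "f < 2 * n" "f \<noteq> partner e"
    "\<not> (e = partner p \<and> f = partner q)" "\<not> (e = partner q \<and> f = partner p)" "x \<in> multiples t" for e f x
    using that by (intro S.words_gen[OF N]) (auto simp: N_def)
  have pq': "q \<noteq> partner p" "p \<noteq> partner q" "partner p \<noteq> partner q" "p \<noteq> q" "partner q \<noteq> partner p"
    using pq(3) partner_div by metis+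
  have opp: "root_mat S n (partner p) (partner q) x \<in> words S (2 * n) N" if x: "x \<in> multiples (t \<otimes> t)" for x
  proof -
    obtain c where c: "c \<in> carrier R" "x = h (t \<otimes> t \<otimes> c)" using x by (auto simp: multiples_def)
    define wR where "wR = symp_form R n (base_vec R (partner p)) (base_vec R p)"
    define w where "w = symp_form S n (base_vec S (partner p)) (base_vec S p)"
    have hw: "h wR = w" unfolding wR_def w_def by (rule hom_symp_form_base_vec)
    have wS: "w \<in> carrier S" by (simp add: w_def)
    have wU: "wR \<in> Units R"
      using R.base_form_unit[OF two, of "partner p" n] pq(1) by (simp add: wR_def)
    have wc: "wR \<in> carrier R" using wU by (rule R.Units_closed)
    have "wR \<oplus> wR = wR \<otimes> (\<one> \<oplus> \<one>)" using wc by (simp add: R.r_distr)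
    then have w2: "wR \<oplus> wR \<in> Units R" using wU two by simp
    define v where "v = inv (wR \<oplus> wR)"
    have v: "v \<in> carrier R" "v \<otimes> (wR \<oplus> wR) = \<one>" using w2 by (simp_all add: v_def)
    \<comment> \<open>With this \<open>a\<close>, and with \<open>h t\<close> for the other
      coefficient, the product in \<open>root_mat_opposite\<close> is \<open>x\<close>: one factor
      \<open>t\<close> goes to each, and \<open>v\<close> cancels
      \<open>wR \<oplus> wR\<close>.\<close>
    define a where "a = h (t \<otimes> (c \<otimes> v))"
    have tc: "t \<in> carrier R" using t by blast
    have ac: "a \<in> carrier S" using tc c v by (simp add: a_def)
    have "t \<otimes> (t \<otimes> (c \<otimes> v) \<otimes> (wR \<oplus> wR)) = t \<otimes> t \<otimes> c \<otimes> (v \<otimes> (wR \<oplus> wR))"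
      using tc c v wc by (simp add: R.m_assoc)
    also have "\<dots> = t \<otimes> t \<otimes> c" using tc c v by simp
    finally have "h (t \<otimes> (t \<otimes> (c \<otimes> v) \<otimes> (wR \<oplus> wR))) = x" using c by simp
    then have xe: "h t \<otimes>\<^bsub>S\<^esub> (a \<otimes>\<^bsub>S\<^esub> (w \<oplus>\<^bsub>S\<^esub> w)) = x"
      using tc c v wc by (simp add: a_def hw)
    have mem: "h t \<in> multiples t" "\<ominus>\<^bsub>S\<^esub> h t \<in> multiples t" "a \<in> multiples t" "\<ominus>\<^bsub>S\<^esub> a \<in> multiples t"
      using t tc c v
      by (auto intro: multiplesI[OF t, of \<one>] multiplesI[OF t, of "\<ominus> \<one>"] multiplesI[OF t, of "c \<otimes> v"]
          multiplesI[OF t, of "\<ominus> (c \<otimes> v)"] simp: a_def R.r_minus)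
    have last: "\<ominus>\<^bsub>S\<^esub> (h t \<otimes>\<^bsub>S\<^esub> (h t \<otimes>\<^bsub>S\<^esub> a) \<otimes>\<^bsub>S\<^esub> (w \<otimes>\<^bsub>S\<^esub> w)) \<in> multiples t"
      using t tc c v wc wS
      by (intro multiplesI[OF t, of "\<ominus> (t \<otimes> (t \<otimes> (c \<otimes> v)) \<otimes> (wR \<otimes> wR))"])
        (simp_all add: a_def hw R.r_minus S.m_assoc S.r_minus)
    have "root_mat S n (partner p) (partner q) x =
      matrix_mult S (root_mat S n p (partner q) (\<ominus>\<^bsub>S\<^esub> h t))
      (matrix_mult S (root_mat S n (partner p) (partner p) a)
        (matrix_mult S (root_mat S n p (partner q) (h t))
          (matrix_mult S (root_mat S n (partner p) (partner p) (\<ominus>\<^bsub>S\<^esub> a))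
            (root_mat S n (partner q) (partner q) (\<ominus>\<^bsub>S\<^esub> (h t \<otimes>\<^bsub>S\<^esub> (h t \<otimes>\<^bsub>S\<^esub> a) \<otimes>\<^bsub>S\<^esub> (w \<otimes>\<^bsub>S\<^esub> w)))))))"
      using S.root_mat_opposite[OF pq ac hom_closed[OF tc], folded w_def, unfolded xe] .
    also have "\<dots> \<in> words S (2 * n) N"
      using pq pq' mem last by (intro S.words_mult[OF N] NI) (auto simp: partner_eq_iff)
    finally show ?thesis .
  qed
  have sub: "root_words S n (multiples (t \<otimes> t)) \<subseteq> words S (2 * n) N"
  proof (rule S.words_least[OF N], rule subsetI)
    fix g assume "g \<in> root_gens S n (multiples (t \<otimes> t))"
    then obtain e f x where g: "g = root_mat S n e f x" "e < 2 * n" "f < 2 * n" "f \<noteq> partner e"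
      "x \<in> multiples (t \<otimes> t)" by (auto simp: root_gens_def)
    have x: "x \<in> multiples t" "x \<in> carrier S"
      using g(5) multiples_antimono[OF t t] multiples_subset[OF t] by auto
    consider "e = partner p" "f = partner q" | "e = partner q" "f = partner p"
      | "\<not> (e = partner p \<and> f = partner q)" "\<not> (e = partner q \<and> f = partner p)" by blast
    then show "g \<in> words S (2 * n) N"
    proof cases
      case 1
      then show ?thesis using opp g by simp
    next
      case 2
      then show ?thesis using opp g S.root_mat_commute[OF x(2), of n "partner q" "partner p"] by simp
    next
      case 3
      then show ?thesis using NI g x by simp
    qed
  qed
  have "\<exists>k\<in>root_words S n (multiples s).
      matrix_mult S (root_mat S n p q y) w = matrix_mult S k (root_mat S n p q y)"
    if "w \<in> words S (2 * n) N" for w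
  proof (rule S.words_pass[OF N root_gens_multiples[OF s] _ _ that])
    show "root_mat S n p q y \<in> mats S (2 * n)" using y by simp
    fix g assume "g \<in> N"
    then show "\<exists>k\<in>root_words S n (multiples s).
      matrix_mult S (root_mat S n p q y) g = matrix_mult S k (root_mat S n p q y)"
      unfolding N_def t_def using conj_root_mat[OF pq _ _ _ _ _ s u(1,2) y u(3)] by blast
  qed
  with sub show ?thesis using t by (intro bexI[of _ "t \<otimes> t"]) auto
qed

text \<open>
  Here \<open>past t t'\<close> says that \<open>t'\<close> is a multiple of \<open>t\<close>. The conclusion covers all such \<open>t'\<close> so that the
  requirements of the individual factors of a word can be met simultaneously.
\<close>

lemma translate_elem_words:
  assumes two: "\<one> \<oplus> \<one> \<in> Units R"
    and \<sigma>: "\<And>t. t \<in> T \<Longrightarrow> ring_hom_cring A S (\<sigma> t)" and \<iota>: "ring_hom_cring A S \<iota>"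
    and T: "T \<noteq> {}" and dir: "\<And>t t'. t \<in> T \<Longrightarrow> t' \<in> T \<Longrightarrow> \<exists>t''\<in>T. past t t'' \<and> past t' t''"
    and past_trans: "\<And>t t' t''. past t t' \<Longrightarrow> past t' t'' \<Longrightarrow> past t t''"
    and close: "\<And>f s. f \<in> carrier A \<Longrightarrow> s \<in> M \<Longrightarrow> \<exists>t\<in>T. \<forall>t'\<in>T. past t t' \<longrightarrow> (\<exists>b\<in>carrier R. \<sigma> t' f = \<iota> f \<oplus>\<^bsub>S\<^esub> h (s \<otimes> b))"
    and W: "W \<in> elem_words A n" and s: "s \<in> M"
  shows "\<exists>t\<in>T. \<forall>t'\<in>T. past t t' \<longrightarrow> (\<exists>k\<in>root_words S n (multiples s).
    map_mat (\<sigma> t') W = matrix_mult S k (map_mat \<iota> W))"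
  using W s
proof (induction arbitrary: s)
  case one
  have "map_mat (\<sigma> t) (matrix_one A (2 * n)) =
    matrix_mult S (matrix_one S (2 * n)) (map_mat \<iota> (matrix_one A (2 * n)))" if "t \<in> T" for t
    using ring_hom_cring.map_mat_one[OF \<sigma>[OF that]] ring_hom_cring.map_mat_one[OF \<iota>] by simp
  then show ?case using T words.one by blast
next
  case (cons g W)
  interpret I: ring_hom_cring A S \<iota> by fact
  obtain i j f where g: "g = root_mat A n i j f" "i < 2" "2 \<le> j" "j < 2 * n" "f \<in> carrier A"
    using cons(1) by (auto simp: elem_gens_def)
  have ij: "i < 2 * n" "i div 2 \<noteq> j div 2" "j \<noteq> partner i" using g(2-4) by (auto simp: partner_def)
  have If: "\<iota> f \<in> carrier S" using g(5) by simp
  let ?\<gamma> = "root_mat S n i j (\<iota> f)"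
  \<comment> \<open>The demand \<open>s\<close> on the whole word is handed on through its leftmost
    factor: \<open>s'\<close> is what both the remaining word and the change of the coefficient
    \<open>f\<close> have to satisfy.\<close>
  obtain s' where s': "s' \<in> M" "\<And>w. w \<in> root_words S n (multiples s') \<Longrightarrow>
    \<exists>k\<in>root_words S n (multiples s). matrix_mult S ?\<gamma> w = matrix_mult S k ?\<gamma>"
    using conj_root_gens[OF two ij(1) g(4) ij(2) cons(4) If] by blast
  obtain t1 where t1: "t1 \<in> T" "\<And>t'. t' \<in> T \<Longrightarrow> past t1 t' \<Longrightarrow> \<exists>b\<in>carrier R. \<sigma> t' f = \<iota> f \<oplus>\<^bsub>S\<^esub> h (s' \<otimes> b)"
    using close[OF g(5) s'(1)] by blast
  obtain t2 where t2: "t2 \<in> T" "\<And>t'. t' \<in> T \<Longrightarrow> past t2 t' \<Longrightarrow>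
    \<exists>k\<in>root_words S n (multiples s'). map_mat (\<sigma> t') W = matrix_mult S k (map_mat \<iota> W)"
    using cons.IH[OF s'(1)] by blast
  obtain t where t: "t \<in> T" "past t1 t" "past t2 t" using dir t1(1) t2(1) by blast
  have Wc: "W \<in> mats A (2 * n)" "g \<in> mats A (2 * n)"
    using cons(1,2) I.R.words_closed I.R.elem_gens_closed by blast+
  have "\<exists>k\<in>root_words S n (multiples s).
    map_mat (\<sigma> t') (matrix_mult A g W) = matrix_mult S k (map_mat \<iota> (matrix_mult A g W))"
    if t': "t' \<in> T" "past t t'" for t'
  proof -
    interpret H: ring_hom_cring A S "\<sigma> t'" using \<sigma> t'(1) .
    obtain b where b: "b \<in> carrier R" "\<sigma> t' f = \<iota> f \<oplus>\<^bsub>S\<^esub> h (s' \<otimes> b)"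
      using t1(2)[OF t'(1) past_trans[OF t(2) t'(2)]] by blast
    let ?x = "h (s' \<otimes> b)"
    obtain k where k: "k \<in> root_words S n (multiples s')"
      "map_mat (\<sigma> t') W = matrix_mult S k (map_mat \<iota> W)"
      using t2(2)[OF t'(1) past_trans[OF t(3) t'(2)]] by blast
    have x: "?x \<in> carrier S" "?x \<in> multiples s'" using b(1) s'(1) by (auto simp: multiples_def)
    have "root_mat S n i j ?x \<in> root_gens S n (multiples s')"
      using ij g(4) x by (auto simp: root_gens_def)
    then have "matrix_mult S (root_mat S n i j ?x) k \<in> root_words S n (multiples s')"
      using k(1) by (rule words.cons)
    then obtain l where l: "l \<in> root_words S n (multiples s)"
      "matrix_mult S ?\<gamma> (matrix_mult S (root_mat S n i j ?x) k) = matrix_mult S l ?\<gamma>"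
      using s'(2) by blast
    have c: "?\<gamma> \<in> mats S (2 * n)" "root_mat S n i j ?x \<in> mats S (2 * n)" "k \<in> mats S (2 * n)"
      "l \<in> mats S (2 * n)" "map_mat \<iota> W \<in> mats S (2 * n)"
      using If x k(1) l(1) Wc S.words_closed root_gens_multiples s'(1) cons(4) by auto blast+
    have split: "root_mat S n i j (\<iota> f \<oplus>\<^bsub>S\<^esub> ?x) = matrix_mult S ?\<gamma> (root_mat S n i j ?x)"
      unfolding root_mat_def using If x(1) ij
      by (subst S.tmat_add) (simp_all add: S.symp_form_base_vec)
    \<comment> \<open>The leftmost factor has coefficient \<open>\<iota> f\<close> plus
      \<open>?x\<close>, so it splits into \<open>?\<gamma>\<close> and a root element of
      \<open>?x\<close>. That element joins \<open>k\<close>, and \<open>?\<gamma>\<close> then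
      moves the product to its left.\<close>
    have "map_mat (\<sigma> t') (matrix_mult A g W) =
      matrix_mult S (matrix_mult S ?\<gamma> (root_mat S n i j ?x)) (matrix_mult S k (map_mat \<iota> W))"
      using Wc k(2) H.map_mat_mult[OF Wc(2,1)] g(1,5) b(2) split by (simp add: H.map_root_mat)
    also have "\<dots> = matrix_mult S (matrix_mult S ?\<gamma> (matrix_mult S (root_mat S n i j ?x) k)) (map_mat \<iota> W)"
      using c S.matrix_mult_closed by (simp only: S.matrix_mult_assoc[where m = "2 * n"])
    also have "\<dots> = matrix_mult S l (map_mat \<iota> (matrix_mult A g W))"
      unfolding l(2) using c I.map_mat_mult[OF Wc(2,1)] g(1,5)
      by (simp add: S.matrix_mult_assoc[where m = "2 * n"] I.map_root_mat)
    finally show ?thesis using l(1) by blast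
  qed
  then show ?case using t(1) by blast
qed

end

section \<open>The group \<open>H\<close>\<close>

context cring
begin

text \<open>With entries given by a function, replacing a row is the function update
  \<open>f(i := r)\<close>.\<close>

abbreviation fun_det :: "nat \<Rightarrow> (nat \<Rightarrow> nat \<Rightarrow> 'a) \<Rightarrow> 'a" where
  "fun_det m f \<equiv> matrix_det R (mat m m (\<lambda>(i, j). f i j))"

abbreviation perm_sign :: "(nat \<Rightarrow> nat) \<Rightarrow> 'a" where
  "perm_sign p \<equiv> if evenperm p then \<one> else \<ominus> \<one>"

lemma perm_term_closed:
  assumes "\<And>i j. i < m \<Longrightarrow> j < m \<Longrightarrow> f i j \<in> carrier R" "p permutes {..<m}" "A \<subseteq> {..<m}"
  shows "(\<Otimes>i\<in>A. f i (p i)) \<in> carrier R"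
proof (intro finprod_closed funcsetI)
  fix i assume "i \<in> A"
  then have "i < m" using assms(3) by auto
  then have "p i < m" using permutes_in_image[OF assms(2), of i] by simp
  with \<open>i < m\<close> show "f i (p i) \<in> carrier R" using assms(1) by simp
qed

lemma fun_det_eq:
  assumes "\<And>i j. i < m \<Longrightarrow> j < m \<Longrightarrow> f i j \<in> carrier R"
  shows "fun_det m f = (\<Oplus>p\<in>{p. p permutes {..<m}}. perm_sign p \<otimes> (\<Otimes>i\<in>{..<m}. f i (p i)))"
proof -
  have "(\<Otimes>i\<in>{..<m}. mat m m (\<lambda>(i, j). f i j) $$ (i, p i)) = (\<Otimes>i\<in>{..<m}. f i (p i))"
    if "p permutes {..<m}" for p
  proof (rule finprod_cong')
    fix i assume "i \<in> {..<m}"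
    then have "p i < m" using permutes_in_image[OF that, of i] by simp
    with \<open>i \<in> _\<close> show "mat m m (\<lambda>(i, j). f i j) $$ (i, p i) = f i (p i)" by simp
  next
    show "(\<lambda>i. f i (p i)) \<in> {..<m} \<rightarrow> carrier R"
      using assms permutes_in_image[OF that] by auto
  qed simp
  then show ?thesis
    unfolding matrix_det_def dim_row_mat using assms
    by (intro finsum_cong') (auto intro!: perm_term_closed[OF assms])
qed

text \<open>Every permutation term contains exactly one entry of row \<open>i\<close>. With that
  entry pulled out of the product, the term is visibly linear in the row.\<close>

lemma fun_det_row_add:
  assumes f: "\<And>i j. i < m \<Longrightarrow> j < m \<Longrightarrow> f i j \<in> carrier R"
    and r: "\<And>k. k < m \<Longrightarrow> a k \<in> carrier R" "\<And>k. k < m \<Longrightarrow> b k \<in> carrier R" and "c \<in> carrier R" "i < m"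
  shows "fun_det m (f(i := \<lambda>k. a k \<oplus> c \<otimes> b k)) = fun_det m (f(i := a)) \<oplus> c \<otimes> fun_det m (f(i := b))"
proof -
  define P where "P = {p. p permutes {..<m}}"
  define t where "t g p = perm_sign p \<otimes> (g (p i) \<otimes> (\<Otimes>l\<in>{..<m} - {i}. f l (p l)))" for g p
  have pm: "p l < m" if "p \<in> P" "l < m" for p l
    using that permutes_in_image[of p "{..<m}" l] by (simp add: P_def)
  have fp: "finite P" by (simp add: P_def finite_permutations)
  have rest: "(\<Otimes>l\<in>{..<m} - {i}. f l (p l)) \<in> carrier R" if "p \<in> P" for p
    using that f by (intro perm_term_closed[where m = m]) (auto simp: P_def)
  have tc: "t g p \<in> carrier R" if "\<And>k. k < m \<Longrightarrow> g k \<in> carrier R" "p \<in> P" for g p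
    using that rest pm \<open>i < m\<close> by (simp add: t_def)
  have D: "fun_det m (f(i := g)) = (\<Oplus>p\<in>P. t g p)" if g: "\<And>k. k < m \<Longrightarrow> g k \<in> carrier R" for g
  proof -
    have "(\<Otimes>l\<in>{..<m}. (f(i := g)) l (p l)) = g (p i) \<otimes> (\<Otimes>l\<in>{..<m} - {i}. f l (p l))" if p: "p \<in> P" for p
    proof -
      have e: "{..<m} = insert i ({..<m} - {i})" using \<open>i < m\<close> by auto
      have "(\<Otimes>l\<in>insert i ({..<m} - {i}). (f(i := g)) l (p l)) =
        (f(i := g)) i (p i) \<otimes> (\<Otimes>l\<in>{..<m} - {i}. (f(i := g)) l (p l))"
        using g f pm[OF p] \<open>i < m\<close> by (intro finprod_insert) auto
      also have "(\<Otimes>l\<in>{..<m} - {i}. (f(i := g)) l (p l)) = (\<Otimes>l\<in>{..<m} - {i}. f l (p l))"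
        using f pm[OF p] by (intro finprod_cong') auto
      finally show ?thesis using e by simp
    qed
    moreover have "fun_det m (f(i := g)) = (\<Oplus>p\<in>P. perm_sign p \<otimes> (\<Otimes>l\<in>{..<m}. (f(i := g)) l (p l)))"
      unfolding P_def using f g by (intro fun_det_eq) auto
    moreover have "(\<lambda>p. t g p) \<in> P \<rightarrow> carrier R" using tc[of g, OF g] by blast
    ultimately show ?thesis by (auto simp: t_def intro!: finsum_cong' simp del: fun_upd_apply)
  qed
  have "fun_det m (f(i := \<lambda>k. a k \<oplus> c \<otimes> b k)) = (\<Oplus>p\<in>P. t (\<lambda>k. a k \<oplus> c \<otimes> b k) p)"
    using r assms(4) by (intro D) auto
  also have "\<dots> = (\<Oplus>p\<in>P. t a p \<oplus> c \<otimes> t b p)"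
  proof (intro finsum_cong')
    fix p assume p: "p \<in> P"
    have "perm_sign p \<in> carrier R" "a (p i) \<in> carrier R" "b (p i) \<in> carrier R"
      using r pm[OF p] \<open>i < m\<close> by simp_all
    then show "t (\<lambda>k. a k \<oplus> c \<otimes> b k) p = t a p \<oplus> c \<otimes> t b p"
      unfolding t_def using rest[OF p] assms(4) by (simp only: r_distr l_distr m_ac m_closed a_closed)
  qed (use tc[of a] tc[of b] r assms(4) in auto)
  also have "\<dots> = (\<Oplus>p\<in>P. t a p) \<oplus> c \<otimes> (\<Oplus>p\<in>P. t b p)"
    using tc[of a] tc[of b] r assms(4) by (simp add: finsum_addf finsum_rdistr[OF fp] Pi_def)
  finally show ?thesis using D r by simp
qed

text \<open>Composing a permutation with the transposition of \<open>i\<close> and \<open>j\<close>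
  flips its sign and, the two rows being equal, keeps its product. So the determinant equals its
  negative, and 2 is a unit.\<close>

lemma fun_det_equal_rows:
  assumes two: "\<one> \<oplus> \<one> \<in> Units R"
    and f: "\<And>i j. i < m \<Longrightarrow> j < m \<Longrightarrow> f i j \<in> carrier R" and ij: "i < m" "j < m" "i \<noteq> j" "f i = f j"
  shows "fun_det m f = \<zero>"
proof -
  define P where "P = {p. p permutes {..<m}}"
  define \<tau> where "\<tau> = transpose i j"
  have \<tau>: "\<tau> permutes {..<m}" using ij by (simp add: \<tau>_def permutes_swap_id)
  have \<tau>\<tau>: "\<tau> \<circ> \<tau> = id" by (simp add: \<tau>_def)
  have f\<tau>: "f (\<tau> l) = f l" for l using ij(4) by (auto simp: \<tau>_def transpose_def)
  define t where "t p = perm_sign p \<otimes> (\<Otimes>l\<in>{..<m}. f l (p l))" for p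
  have prod: "(\<Otimes>l\<in>{..<m}. f l (p l)) \<in> carrier R" if "p \<in> P" for p
    using that f by (intro perm_term_closed[where m = m]) (auto simp: P_def)
  then have tc: "t \<in> P \<rightarrow> carrier R" by (auto simp: t_def)
  have pm: "p l < m" if "p \<in> P" "l < m" for p l
    using that permutes_in_image[of p "{..<m}" l] by (simp add: P_def)
  have im: "(\<lambda>p. p \<circ> \<tau>) ` P = P"
  proof (intro equalityI subsetI)
    fix p assume "p \<in> P"
    moreover from this have "p \<circ> \<tau> \<in> P" using \<tau> by (simp add: P_def permutes_compose)
    moreover have "p = (p \<circ> \<tau>) \<circ> \<tau>" using \<tau>\<tau> by (simp add: comp_assoc)
    ultimately show "p \<in> (\<lambda>p. p \<circ> \<tau>) ` P" by blast
  qed (use \<tau> in \<open>auto simp: P_def permutes_compose\<close>)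
  have inj: "inj_on (\<lambda>p. p \<circ> \<tau>) P"
    by (rule inj_on_inverseI[where g = "\<lambda>p. p \<circ> \<tau>"]) (simp add: comp_assoc \<tau>\<tau>)
  have neg: "t (p \<circ> \<tau>) = \<ominus> t p" if p: "p \<in> P" for p
  proof -
    have perm: "permutation p" "permutation \<tau>"
      using p \<tau> permutes_imp_permutation[of "{..<m}"] by (auto simp: P_def)
    have "evenperm (p \<circ> \<tau>) = (\<not> evenperm p)"
      using perm ij by (simp add: evenperm_comp) (simp add: \<tau>_def evenperm_swap)
    moreover have "(\<Otimes>l\<in>{..<m}. f l ((p \<circ> \<tau>) l)) = (\<Otimes>l\<in>{..<m}. f l (p l))"
    proof -
      have "(\<Otimes>l\<in>\<tau> ` {..<m}. f l (p l)) = (\<Otimes>l\<in>{..<m}. f (\<tau> l) (p (\<tau> l)))"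
        using f pm[OF p] permutes_inj_on[OF \<tau>] permutes_image[OF \<tau>]
        by (intro finprod_reindex) auto
      then show ?thesis using permutes_image[OF \<tau>] by (simp add: f\<tau>)
    qed
    ultimately show ?thesis using prod[OF p] by (simp add: t_def l_minus)
  qed
  have D: "fun_det m f = (\<Oplus>p\<in>P. t p)"
    unfolding t_def P_def using f by (rule fun_det_eq)
  have c: "(\<Oplus>p\<in>P. t p) \<in> carrier R" using tc by (rule finsum_closed)
  have "(\<Oplus>p\<in>P. t p) = (\<Oplus>p\<in>P. t (p \<circ> \<tau>))"
    using finsum_reindex[OF _ inj, of t] tc by (simp add: im)
  also have "\<dots> = (\<Oplus>p\<in>P. (\<ominus> \<one>) \<otimes> t p)"
    using neg tc by (intro finsum_cong') (auto simp: l_minus Pi_iff)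
  also have "\<dots> = (\<ominus> \<one>) \<otimes> (\<Oplus>p\<in>P. t p)"
    using tc by (intro finsum_rdistr[symmetric]) (auto simp: P_def finite_permutations)
  finally have self_neg: "(\<Oplus>p\<in>P. t p) = (\<ominus> \<one>) \<otimes> (\<Oplus>p\<in>P. t p)" .
  have "x \<oplus> x = \<zero>" if "x \<in> carrier R" "x = (\<ominus> \<one>) \<otimes> x" for x
    using that by (metis l_minus l_one one_closed r_neg)
  from this[OF c self_neg] have "(\<one> \<oplus> \<one>) \<otimes> (\<Oplus>p\<in>P. t p) = \<zero>"
    using c by (simp add: l_distr)
  then have "inv (\<one> \<oplus> \<one>) \<otimes> ((\<one> \<oplus> \<one>) \<otimes> (\<Oplus>p\<in>P. t p)) = \<zero>" using two by simp
  then have "(\<Oplus>p\<in>P. t p) = \<zero>"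
    using two c by (simp add: m_assoc[symmetric])
  then show ?thesis using D by simp
qed

lemma fun_det_row_op:
  assumes two: "\<one> \<oplus> \<one> \<in> Units R"
    and f: "\<And>i j. i < m \<Longrightarrow> j < m \<Longrightarrow> f i j \<in> carrier R" and ij: "i < m" "j < m" "i \<noteq> j" and c: "c \<in> carrier R"
  shows "fun_det m (f(i := \<lambda>k. f i k \<oplus> c \<otimes> f j k)) = fun_det m f"
proof -
  have "fun_det m (f(i := \<lambda>k. f i k \<oplus> c \<otimes> f j k)) = fun_det m (f(i := f i)) \<oplus> c \<otimes> fun_det m (f(i := f j))"
    using assms by (intro fun_det_row_add) auto
  also have "fun_det m (f(i := f j)) = \<zero>"
    using f ij by (intro fun_det_equal_rows[OF two, of m _ i j]) auto
  also have "f(i := f i) = f" by simp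
  finally have "fun_det m (f(i := \<lambda>k. f i k \<oplus> c \<otimes> f j k)) = fun_det m f \<oplus> c \<otimes> \<zero>" .
  moreover have "fun_det m f \<in> carrier R"
    using perm_term_closed[of m f] f
    by (subst fun_det_eq) (auto intro!: finsum_closed m_closed simp del: finprod_closed)
  ultimately show ?thesis using c by simp
qed

lemma fun_det_one: "fun_det m (\<lambda>i j. if i = j then \<one> else \<zero>) = \<one>"
proof -
  let ?d = "\<lambda>i j. if i = j then \<one> else \<zero>"
  have "(\<Otimes>i\<in>{..<m}. ?d i (p i)) = (if id = p then \<one> else \<zero>)" if p: "p permutes {..<m}" for p
  proof (cases "id = p")
    case True
    then have "(\<Otimes>i\<in>{..<m}. ?d i (p i)) = (\<Otimes>i\<in>{..<m}. \<one>)" by (intro finprod_cong') auto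
    with True show ?thesis by simp
  next
    case False
    then obtain i where i: "p i \<noteq> i" by (metis eq_id_iff)
    then have im: "i \<in> {..<m}" using p unfolding permutes_def by blast
    have e: "{..<m} = insert i ({..<m} - {i})" using im by auto
    have "(\<Otimes>i\<in>insert i ({..<m} - {i}). ?d i (p i)) = ?d i (p i) \<otimes> (\<Otimes>i\<in>{..<m} - {i}. ?d i (p i))"
      by (intro finprod_insert) auto
    also have "\<dots> = \<zero>" using i by (simp add: finprod_closed)
    finally show ?thesis using e False by simp
  qed
  then have "fun_det m ?d = (\<Oplus>p\<in>{p. p permutes {..<m}}. if id = p then \<one> else \<zero>)"
    by (subst fun_det_eq) (auto intro!: finsum_cong')
  also have "\<dots> = \<one>"
    by (intro finsum_singleton) (auto simp: finite_permutations permutes_id)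
  finally show ?thesis .
qed

text \<open>The row operations of \<open>det_root_mat\<close> add a combination of both rows of a
  block at once.\<close>

lemma fun_det_row_op2:
  assumes two: "\<one> \<oplus> \<one> \<in> Units R"
    and f: "\<And>i j. i < m \<Longrightarrow> j < m \<Longrightarrow> f i j \<in> carrier R"
    and ij: "i < m" "j < m" "j' < m" "i \<noteq> j" "i \<noteq> j'" and c: "c \<in> carrier R" "c' \<in> carrier R"
  shows "fun_det m (f(i := \<lambda>k. f i k \<oplus> c \<otimes> f j k \<oplus> c' \<otimes> f j' k)) = fun_det m f"
proof -
  let ?g = "f(i := \<lambda>k. f i k \<oplus> c \<otimes> f j k)"
  have g: "k < m \<Longrightarrow> l < m \<Longrightarrow> ?g k l \<in> carrier R" for k l using f ij c by auto
  have "f(i := \<lambda>k. f i k \<oplus> c \<otimes> f j k \<oplus> c' \<otimes> f j' k) = ?g(i := \<lambda>k. ?g i k \<oplus> c' \<otimes> ?g j' k)"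
    using ij by auto
  then have "fun_det m (f(i := \<lambda>k. f i k \<oplus> c \<otimes> f j k \<oplus> c' \<otimes> f j' k)) =
    fun_det m (?g(i := \<lambda>k. ?g i k \<oplus> c' \<otimes> ?g j' k))"
    by (simp only:)
  also have "\<dots> = fun_det m ?g"
    by (rule fun_det_row_op[OF two g ij(1,3,5) c(2)])
  also have "\<dots> = fun_det m f"
    by (rule fun_det_row_op[OF two f ij(1,2,4) c(1)])
  finally show ?thesis .
qed

lemma covec_base_vec:
  "covec R (base_vec R i) j =
    (if j div 2 = i div 2 then (if even j \<and> even i then \<ominus> \<one> else \<one>) else \<zero>)"
  by (cases "even j") (auto simp: covec_def base_vec_def elim!: evenE oddE)

lemma root_mat_entry:
  assumes "k < 2 * n" "l < 2 * n"
  shows "root_mat R n i j c $$ (k, l) = (if k = l then \<one> else \<zero>) \<oplus>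
    c \<otimes> (base_vec R i k \<otimes> covec R (base_vec R j) l \<oplus> base_vec R j k \<otimes> covec R (base_vec R i) l)"
  using assms by (simp add: root_mat_def tmat_def)

text \<open>
  For \<open>2 \<times> 2\<close> matrices \<open>P\<close>, \<open>Q\<close> with \<open>QP = 0\<close>, adding \<open>P\<close> times the rows of a later block to those of the
  first block of the identity, and then \<open>Q\<close> times the rows of the first block to those of the later
  one, produces the blocks \<open>P\<close> and \<open>Q\<close> and nothing else.
\<close>

lemma det_root_mat:
  assumes two: "\<one> \<oplus> \<one> \<in> Units R" and ij: "i < 2" "2 \<le> j" "j < 2 * n" and c: "c \<in> carrier R"
  shows "matrix_det R (root_mat R n i j c) = \<one>"
proof -
  let ?B = "base_vec R" and ?C = "\<lambda>i. covec R (base_vec R i)" and ?m = "2 * n"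
  \<comment> \<open>The first of the two row indices in the block of \<open>j\<close>.\<close>
  define e where "e = 2 * (j div 2)"
  have e: "e \<ge> 2" "e + 1 < 2 * n" "even e" using ij unfolding e_def by presburger+
  have C [simp]: "?C i k \<in> carrier R" for i k by (simp add: covec_base_vec)
  define f0 where "f0 = (\<lambda>k l. if k = (l::nat) then \<one> else \<zero>)"
  \<comment> \<open>\<open>f1\<close> and \<open>f2\<close> change the two rows of the first block
    with the rows of the later block; \<open>f3\<close> and \<open>f4\<close> change the rows of the
    later block with the new rows of the first.\<close>
  define f1 where "f1 = f0(0 := \<lambda>l. f0 0 l \<oplus> (c \<otimes> (?B i 0 \<otimes> ?C j e)) \<otimes> f0 e l \<oplus> (c \<otimes> (?B i 0 \<otimes> ?C j (e + 1))) \<otimes> f0 (e + 1) l)"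
  define f2 where "f2 = f1(1 := \<lambda>l. f1 1 l \<oplus> (c \<otimes> (?B i 1 \<otimes> ?C j e)) \<otimes> f1 e l \<oplus> (c \<otimes> (?B i 1 \<otimes> ?C j (e + 1))) \<otimes> f1 (e + 1) l)"
  define f3 where "f3 = f2(e := \<lambda>l. f2 e l \<oplus> (c \<otimes> (?B j e \<otimes> ?C i 0)) \<otimes> f2 0 l \<oplus> (c \<otimes> (?B j e \<otimes> ?C i 1)) \<otimes> f2 1 l)"
  define f4 where "f4 = f3(e + 1 := \<lambda>l. f3 (e + 1) l \<oplus> (c \<otimes> (?B j (e + 1) \<otimes> ?C i 0)) \<otimes> f3 0 l \<oplus> (c \<otimes> (?B j (e + 1) \<otimes> ?C i 1)) \<otimes> f3 1 l)"
  have f0: "f0 k l \<in> carrier R" for k l by (simp add: f0_def)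
  have f1: "f1 k l \<in> carrier R" for k l using c by (simp add: f1_def f0)
  have f2: "f2 k l \<in> carrier R" for k l using c by (simp add: f2_def f1)
  have f3: "f3 k l \<in> carrier R" for k l using c by (simp add: f3_def f2)
  have "fun_det ?m f4 = fun_det ?m f3" unfolding f4_def
    by (rule fun_det_row_op2[OF two]) (use e c f3 in auto)
  also have "\<dots> = fun_det ?m f2" unfolding f3_def
    by (rule fun_det_row_op2[OF two]) (use e c f2 in auto)
  also have "\<dots> = fun_det ?m f1" unfolding f2_def
    by (rule fun_det_row_op2[OF two]) (use e c f1 in auto)
  also have "\<dots> = fun_det ?m f0" unfolding f1_def
    by (rule fun_det_row_op2[OF two]) (use e c f0 in auto)
  also have "\<dots> = \<one>" unfolding f0_def by (rule fun_det_one)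
  finally have "fun_det ?m f4 = \<one>" .
  moreover have "root_mat R n i j c = mat ?m ?m (\<lambda>(k, l). f4 k l)"
  proof (rule eq_matI)
    fix k l assume "k < dim_row (mat ?m ?m (\<lambda>(k, l). f4 k l))" "l < dim_col (mat ?m ?m (\<lambda>(k, l). f4 k l))"
    then have kl: "k < ?m" "l < ?m" by simp_all
    have j: "j div 2 = e div 2" "i div 2 = 0" using ij by (auto simp: e_def)
    have row01: "f2 k l = f0 k l \<oplus> c \<otimes> (?B i k \<otimes> ?C j l)" if "k = 0 \<or> k = 1" for k
    proof -
      have "f2 k l = f0 k l \<oplus> (c \<otimes> (?B i k \<otimes> ?C j e)) \<otimes> f0 e l \<oplus> (c \<otimes> (?B i k \<otimes> ?C j (e + 1))) \<otimes> f0 (e + 1) l"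
        using that e by (auto simp: f2_def f1_def)
      also have "\<dots> = f0 k l \<oplus> c \<otimes> (?B i k \<otimes> ?C j l)"
        using c e by (auto simp: f0_def covec_base_vec[of j l] j elim!: evenE oddE)
      finally show ?thesis .
    qed
    have rowe: "f4 k l = f0 k l \<oplus> c \<otimes> (?B j k \<otimes> ?C i l)" if "k = e \<or> k = e + 1"
    proof -
      have "f4 k l = f0 k l \<oplus> (c \<otimes> (?B j k \<otimes> ?C i 0)) \<otimes> (f0 0 l \<oplus> c \<otimes> (?B i 0 \<otimes> ?C j l)) \<oplus>
        (c \<otimes> (?B j k \<otimes> ?C i 1)) \<otimes> (f0 1 l \<oplus> c \<otimes> (?B i 1 \<otimes> ?C j l))"
        using that e row01[of 0] row01[of 1] by (auto simp: f4_def f3_def) (auto simp: f2_def f1_def)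
      also have "\<dots> = f0 k l \<oplus> c \<otimes> (?B j k \<otimes> ?C i l)"
      proof -
        have iz: "?C i 0 = (if i = 0 then \<ominus> \<one> else \<one>)" "?C i 1 = \<one>" "?B i 0 = \<one>" "?B i 1 = \<ominus> ?C i 0"
          using ij by (auto simp: covec_base_vec base_vec_def elim: oddE)
        \<comment> \<open>The terms with \<open>z\<close> cancel. This is \<open>QP = 0\<close>, and
          it holds because the basis vector of \<open>i\<close> is orthogonal to itself:
          \<open>C i 0 B i 0 + C i 1 B i 1 = 0\<close>.\<close>
        have alg: "x \<oplus> (c \<otimes> (y \<otimes> a)) \<otimes> (x0 \<oplus> c \<otimes> (\<one> \<otimes> z)) \<oplus> (c \<otimes> (y \<otimes> \<one>)) \<otimes> (x1 \<oplus> c \<otimes> ((\<ominus> a) \<otimes> z))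
          = x \<oplus> c \<otimes> (y \<otimes> (a \<otimes> x0 \<oplus> x1))"
          if "x \<in> carrier R" "y \<in> carrier R" "a \<in> carrier R" "x0 \<in> carrier R" "x1 \<in> carrier R" "z \<in> carrier R"
          for x y a x0 x1 z using that c by algebra
        have "f0 k l \<oplus> (c \<otimes> (?B j k \<otimes> ?C i 0)) \<otimes> (f0 0 l \<oplus> c \<otimes> (?B i 0 \<otimes> ?C j l)) \<oplus>
          (c \<otimes> (?B j k \<otimes> ?C i 1)) \<otimes> (f0 1 l \<oplus> c \<otimes> (?B i 1 \<otimes> ?C j l)) =
          f0 k l \<oplus> c \<otimes> (?B j k \<otimes> (?C i 0 \<otimes> f0 0 l \<oplus> f0 1 l))"
          unfolding iz(2-4) by (rule alg) (simp_all add: f0)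
        moreover have "?C i 0 \<otimes> f0 0 l \<oplus> f0 1 l = ?C i l"
        proof -
          consider "l = 0" | "l = 1" | "l div 2 \<noteq> 0" by (cases l; cases "l - 1") auto
          then show ?thesis
            using iz by cases (auto simp: f0_def covec_base_vec[of i l] j)
        qed
        ultimately show ?thesis by simp
      qed
      finally show ?thesis .
    qed
    consider "k = 0 \<or> k = 1" | "k = e \<or> k = e + 1" | "k \<noteq> 0" "k \<noteq> 1" "k \<noteq> e" "k \<noteq> e + 1" by blast
    then have "f0 k l \<oplus> c \<otimes> (?B i k \<otimes> ?C j l \<oplus> ?B j k \<otimes> ?C i l) = f4 k l"
    proof cases
      case 1
      then have "f4 k l = f2 k l" "?B j k = \<zero>"
        using e j by (auto simp: f4_def f3_def base_vec_def)
      then show ?thesis using 1 row01[of k] c by simp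
    next
      case 2
      then have "?B i k = \<zero>" using e j by (auto simp: base_vec_def)
      then show ?thesis using 2 rowe c by simp
    next
      case 3
      then have "k div 2 \<noteq> 0" "k div 2 \<noteq> e div 2" using e(3) by (auto elim!: evenE)
      then have "?B i k = \<zero>" "?B j k = \<zero>" by (simp_all add: base_vec_def j)
      moreover have "f4 k l = f0 k l" using 3 by (simp add: f4_def f3_def f2_def f1_def)
      ultimately show ?thesis using c f0 by simp
    qed
    then show "root_mat R n i j c $$ (k, l) = mat ?m ?m (\<lambda>(k, l). f4 k l) $$ (k, l)"
      using kl by (simp add: root_mat_entry f0_def)
  qed (simp_all add: root_mat_def tmat_def)
  ultimately show ?thesis by simp
qed

end

section \<open>Symplecticity of the generators, and \<open>H\<close> as a set of words\<close>

context cring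
begin

lemma symp_form_cong:
  assumes "v' \<in> vecs" "w' \<in> vecs" "\<And>k. k < 2 * n \<Longrightarrow> v k = v' k" "\<And>k. k < 2 * n \<Longrightarrow> w k = w' k"
  shows "symp_form R n v w = symp_form R n v' w'"
  unfolding symp_form_def
proof (rule finsum_cong')
  fix k assume "k \<in> {..<n}"
  then have "2 * k < 2 * n" "2 * k + 1 < 2 * n" by simp_all
  then show "v (2 * k) \<otimes> w (2 * k + 1) \<ominus> v (2 * k + 1) \<otimes> w (2 * k) =
    v' (2 * k) \<otimes> w' (2 * k + 1) \<ominus> v' (2 * k + 1) \<otimes> w' (2 * k)"
    by (simp only: assms(3,4))
qed (use assms(1,2) in \<open>auto simp: vecs_apply\<close>)

abbreviation std_vec :: "nat \<Rightarrow> nat \<Rightarrow> 'a" where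
  "std_vec i k \<equiv> if i = k then \<one> else \<zero>"

lemma psi_entry:
  assumes "i < 2 * n" "j < 2 * n"
  shows "psi n R $$ (i, j) = covec R (std_vec i) j"
proof -
  have "psi n R $$ (i, j) =
    (if i div 2 = j div 2 then [[\<zero>, \<one>], [\<ominus> \<one>, \<zero>]] ! (i mod 2) ! (j mod 2) else \<zero>)"
    using assms by (simp add: psi_def block_matrix_def psi1_def matrix_zero_def mat_of_rows_list_def)
  then show ?thesis
    by (cases "even i"; cases "even j") (auto simp: covec_def elim!: evenE oddE, presburger)
qed

lemma symp_form_std_vec:
  assumes "i < 2 * n" "j < 2 * n"
  shows "symp_form R n (std_vec i) (std_vec j) = psi n R $$ (i, j)"
proof -
  have c: "covec R (std_vec i) k \<in> carrier R" for k by (simp add: covec_def)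
  have "symp_form R n (std_vec i) (std_vec j) = (\<Oplus>k\<in>{..<2 * n}. covec R (std_vec i) k \<otimes> std_vec j k)"
    by (rule symp_form_covec[symmetric]) auto
  also have "\<dots> = (\<Oplus>k\<in>{..<2 * n}. std_vec j k \<otimes> covec R (std_vec i) k)"
    using c by (intro finsum_cong') (auto simp: m_comm)
  also have "\<dots> = covec R (std_vec i) j"
    using assms(2) c by (intro finsum_delta) auto
  finally show ?thesis using assms by (simp add: psi_entry)
qed

lemma psi_closed [simp]: "psi n R \<in> mats R (2 * n)"
proof (rule matsI)
  fix i j assume "i < 2 * n" "j < 2 * n"
  then show "psi n R $$ (i, j) \<in> carrier R" by (simp add: psi_entry covec_def)
qed (simp_all add: psi_def block_matrix_def)

text \<open>The entries of \<open>A^t psi A\<close> are the form values of pairs of columns of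
  \<open>A\<close>, and the columns are the images of the unit vectors.\<close>

lemma symplectic_of_isometry:
  assumes A: "A \<in> mats R (2 * n)"
    and iso: "\<And>i j. i < 2 * n \<Longrightarrow> j < 2 * n \<Longrightarrow>
      symp_form R n (mat_act R A (std_vec i)) (mat_act R A (std_vec j)) = symp_form R n (std_vec i) (std_vec j)"
  shows "matrix_mult R (matrix_mult R (transpose_mat A) (psi n R)) A = psi n R"
proof (rule eq_matI)
  have AT: "transpose_mat A \<in> mats R (2 * n)"
    using A by (intro matsI) auto
  have ATp: "matrix_mult R (transpose_mat A) (psi n R) \<in> mats R (2 * n)"
    using AT by simp
  fix i j assume "i < dim_row (psi n R)" "j < dim_col (psi n R)"
  then have ij: "i < 2 * n" "j < 2 * n" using mats_dim[OF psi_closed[of n]] by simp_all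
  \<comment> \<open>Column \<open>i\<close> of \<open>A\<close>, extended by zero because vectors
    are functions on all natural numbers.\<close>
  define v where "v i k = (if k < 2 * n then A $$ (k, i) else \<zero>)" for i k
  have v: "v i \<in> vecs" "v j \<in> vecs" using A ij by (auto simp: v_def)
  have c: "covec R (v i) k \<in> carrier R" for k using v(1) by (simp add: covec_def vecs_apply)
  have 1: "matrix_mult R (transpose_mat A) (psi n R) $$ (i, l) = covec R (v i) l" if l: "l < 2 * n" for l
  proof -
    have "matrix_mult R (transpose_mat A) (psi n R) $$ (i, l) = (\<Oplus>k\<in>{..<2 * n}. v i k \<otimes> psi n R $$ (k, l))"
      using AT A ij l mats_entry[OF psi_closed[of n] _ l]
      by (auto simp: matrix_mult_entry[OF AT psi_closed ij(1) l] v_def intro!: finsum_cong')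
    \<comment> \<open>Column \<open>l\<close> of \<open>psi\<close> vanishes outside row
      \<open>partner l\<close>.\<close>
    also have "\<dots> = (\<Oplus>k\<in>{..<2 * n}. std_vec (partner l) k \<otimes> covec R (v i) l)"
    proof (intro finsum_cong')
      fix k assume k: "k \<in> {..<2 * n}"
      have "v i k \<otimes> psi n R $$ (k, l) = v i k \<otimes> covec R (std_vec k) l" using k l by (simp add: psi_entry)
      also have "\<dots> = std_vec (partner l) k \<otimes> covec R (v i) l"
      proof (cases "even l")
        case True
        then show ?thesis using v(1) by (auto simp: covec_def partner_def vecs_apply r_minus)
      next
        case False
        then have "0 < l" by (auto intro: gr0I)
        with False show ?thesis using v(1) by (auto simp: covec_def partner_def vecs_apply)
      qed
      finally show "v i k \<otimes> psi n R $$ (k, l) = std_vec (partner l) k \<otimes> covec R (v i) l" .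
    qed (use c in auto)
    also have "\<dots> = covec R (v i) l"
      using l c by (intro finsum_delta[of _ _ "\<lambda>k. covec R (v i) l"]) auto
    finally show ?thesis .
  qed
  have "matrix_mult R (matrix_mult R (transpose_mat A) (psi n R)) A $$ (i, j) =
    (\<Oplus>l\<in>{..<2 * n}. covec R (v i) l \<otimes> v j l)"
    using c v A ij by (auto simp: matrix_mult_entry[OF ATp A ij] 1 v_def[of j] vecs_apply intro!: finsum_cong')
  also have "\<dots> = symp_form R n (v i) (v j)" using v by (rule symp_form_covec)
  also have "\<dots> = symp_form R n (mat_act R A (std_vec i)) (mat_act R A (std_vec j))"
    using A ij by (intro symp_form_cong[OF v, symmetric]) (auto simp: v_def mat_act_unit)
  also have "\<dots> = psi n R $$ (i, j)" using ij by (simp add: iso symp_form_std_vec)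
  finally show "matrix_mult R (matrix_mult R (transpose_mat A) (psi n R)) A $$ (i, j) = psi n R $$ (i, j)" .
qed (use A mats_dim[OF psi_closed[of n]] in \<open>simp_all add: matrix_mult_def\<close>)

lemma root_mat_Sp:
  assumes two: "\<one> \<oplus> \<one> \<in> Units R" and ij: "i < 2" "2 \<le> j" "j < 2 * n" and c: "c \<in> carrier R"
  shows "root_mat R n i j c \<in> carrier (Sp n R)"
proof -
  have j: "j \<noteq> partner i" "i < 2 * n" using ij by (auto simp: partner_def)
  let ?A = "root_mat R n i j c"
  have A: "?A \<in> mats R (2 * n)" using c by simp
  have "matrix_mult R (matrix_mult R (transpose_mat ?A) (psi n R)) ?A = psi n R"
  proof (rule symplectic_of_isometry[OF A])
    fix k l assume kl: "k < 2 * n" "l < 2 * n"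
    have act: "mat_act R ?A (std_vec k) r = transv R n (base_vec R i) (base_vec R j) c (std_vec k) r"
      if "r < 2 * n" for k r
      using that c unfolding root_mat_def by (intro mat_act_tmat) auto
    have "symp_form R n (mat_act R ?A (std_vec k)) (mat_act R ?A (std_vec l)) =
      symp_form R n (transv R n (base_vec R i) (base_vec R j) c (std_vec k))
        (transv R n (base_vec R i) (base_vec R j) c (std_vec l))"
      using c by (intro symp_form_cong act transv_closed) auto
    also have "\<dots> = symp_form R n (std_vec k) (std_vec l)"
      using c j by (intro transv_isometry) (auto simp: symp_form_base_vec)
    finally show "symp_form R n (mat_act R ?A (std_vec k)) (mat_act R ?A (std_vec l)) =
      symp_form R n (std_vec k) (std_vec l)" .
  qed
  moreover have "?A \<in> SL (2 * n) R"
    using A det_root_mat[OF two ij c] by (simp add: SL_def mats_def)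
  ultimately show ?thesis by (simp add: Sp_def)
qed

lemma finsum_two:
  assumes "f 0 \<in> carrier R" "f 1 \<in> carrier R"
  shows "(\<Oplus>k\<in>{..<2::nat}. f k) = f 0 \<oplus> f 1"
proof -
  have "{..<2::nat} = insert 0 {1}" by auto
  then show ?thesis using assms by (simp add: Pi_def)
qed

text \<open>The result is minus the adjugate of the given matrix. For determinant zero its product
  with that matrix is therefore zero, which makes the two off-diagonal blocks of
  \<open>E_mat\<close> compatible.\<close>

lemma psi1_conj:
  assumes "a \<in> carrier R" "b \<in> carrier R" "c \<in> carrier R" "d \<in> carrier R"
  shows "matrix_mult R (matrix_mult R (psi1 R) (transpose_mat (mat_of_rows_list 2 [[a, b], [c, d]]))) (psi1 R) =
    mat_of_rows_list 2 [[\<ominus> d, b], [c, \<ominus> a]]"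
proof (rule eq_matI)
  fix i j assume "i < dim_row (mat_of_rows_list 2 [[\<ominus> d, b], [c, \<ominus> a]])"
    "j < dim_col (mat_of_rows_list 2 [[\<ominus> d, b], [c, \<ominus> a]])"
  then have "i = 0 \<or> i = 1" "j = 0 \<or> j = 1" by (auto simp: mat_of_rows_list_def)
  then show "matrix_mult R (matrix_mult R (psi1 R) (transpose_mat (mat_of_rows_list 2 [[a, b], [c, d]]))) (psi1 R) $$ (i, j) =
    mat_of_rows_list 2 [[\<ominus> d, b], [c, \<ominus> a]] $$ (i, j)"
    using assms
    by (auto simp: matrix_mult_def psi1_def mat_of_rows_list_def finsum_two l_minus r_minus numeral_2_eq_2[symmetric])
qed (simp_all add: matrix_mult_def psi1_def mat_of_rows_list_def)

text \<open>The block is \<open>a\<close> times the outer product of the basis vector of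
  \<open>i\<close> and the covector of that of \<open>r\<close>; the factor
  \<open>base_vec R i 0 = \<one>\<close> is omitted in the first row. Block \<open>k\<close>,
  counted from 1, starts at index \<open>2 * (k - 1)\<close>.\<close>

lemma E_mat_root_mat:
  assumes k: "2 \<le> k" "k \<le> n" and i: "i < 2" and r: "r < 2" and a: "a \<in> carrier R"
  shows "E_mat n R k (mat_of_rows_list 2
    [[a \<otimes> covec R (base_vec R r) 0, a \<otimes> covec R (base_vec R r) 1],
     [base_vec R i 1 \<otimes> (a \<otimes> covec R (base_vec R r) 0), base_vec R i 1 \<otimes> (a \<otimes> covec R (base_vec R r) 1)]])
    = root_mat R n i (2 * (k - 1) + r) a"
proof (rule eq_matI)
  let ?j = "2 * (k - 1) + r"
  fix x y assume "x < dim_row (root_mat R n i ?j a)" "y < dim_col (root_mat R n i ?j a)"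
  then have xy: "x < 2 * n" "y < 2 * n" by (simp_all add: root_mat_def tmat_def)
  obtain k' where k': "k = k' + 1" "k' \<noteq> 0" using k(1) by (cases k) auto
  have ir: "i = 0 \<or> i = 1" "r = 0 \<or> r = 1" using i r by auto
  have eq: "x = y \<longleftrightarrow> x div 2 = y div 2 \<and> even x = even y" by (metis mult_div_mod_eq parity_cases)
  have jB: "base_vec R ?j l = (if l div 2 = k' then (if r = 1 \<and> odd l then \<ominus> \<one> else \<one>) else \<zero>)"
    "covec R (base_vec R ?j) l = (if l div 2 = k' then (if r = 0 \<and> even l then \<ominus> \<one> else \<one>) else \<zero>)"
    "base_vec R i l = (if l div 2 = 0 then (if i = 1 \<and> odd l then \<ominus> \<one> else \<one>) else \<zero>)"
    "covec R (base_vec R i) l = (if l div 2 = 0 then (if i = 0 \<and> even l then \<ominus> \<one> else \<one>) else \<zero>)" for l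
    using ir k' by (auto simp: covec_base_vec base_vec_def)
  have rC: "covec R (base_vec R r) 0 = (if r = 0 then \<ominus> \<one> else \<one>)" "covec R (base_vec R r) (Suc 0) = \<one>"
    "base_vec R i (Suc 0) = (if i = 1 then \<ominus> \<one> else \<one>)"
    using ir by (auto simp: covec_base_vec base_vec_def)
  have m: "l mod 2 = (if even l then 0 else 1)" for l :: nat by presburger
  have E: "E_mat n R k (mat_of_rows_list 2 [[a1, b1], [c1, d1]]) $$ (x, y) =
    (if x div 2 = y div 2 then (if even x = even y then \<one> else \<zero>)
     else if x div 2 = 0 \<and> y div 2 = k' then (if even x then (if even y then a1 else b1) else (if even y then c1 else d1))
     else if x div 2 = k' \<and> y div 2 = 0 then (if even x then (if even y then \<ominus> d1 else b1) else (if even y then c1 else \<ominus> a1))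
     else \<zero>)"
    if "a1 \<in> carrier R" "b1 \<in> carrier R" "c1 \<in> carrier R" "d1 \<in> carrier R" for a1 b1 c1 d1
    using xy k' unfolding E_mat_def psi1_conj[OF that]
    by (simp add: block_matrix_def matrix_one_def matrix_zero_def mat_of_rows_list_def m)
  show "E_mat n R k (mat_of_rows_list 2
    [[a \<otimes> covec R (base_vec R r) 0, a \<otimes> covec R (base_vec R r) 1],
     [base_vec R i 1 \<otimes> (a \<otimes> covec R (base_vec R r) 0), base_vec R i 1 \<otimes> (a \<otimes> covec R (base_vec R r) 1)]]) $$ (x, y)
    = root_mat R n i ?j a $$ (x, y)"
  proof -
    \<comment> \<open>\<open>u\<close> is the first entry of the covector of \<open>r\<close> and
      \<open>v\<close> the second entry of the basis vector of \<open>i\<close>. These two signs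
      distinguish the four types of generators.\<close>
    define u where "u = (if r = 0 then \<ominus> \<one> else \<one>)"
    define v where "v = (if i = 1 then \<ominus> \<one> else \<one>)"
    have uv: "u \<in> carrier R" "v \<in> carrier R" "u \<otimes> u = \<one>" "v \<otimes> v = \<one>"
      by (simp_all add: u_def v_def l_minus)
    have B: "base_vec R ?j l = (if l div 2 = k' then (if even l then \<one> else \<ominus> u) else \<zero>)"
      "covec R (base_vec R ?j) l = (if l div 2 = k' then (if even l then u else \<one>) else \<zero>)"
      "base_vec R i l = (if l div 2 = 0 then (if even l then \<one> else v) else \<zero>)"
      "covec R (base_vec R i) l = (if l div 2 = 0 then (if even l then \<ominus> v else \<one>) else \<zero>)" for l
      using ir unfolding jB u_def v_def by auto
    \<comment> \<open>With block numbers and parities as free variables, the comparison of entries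
      becomes a finite case distinction.\<close>
    have key: "(if dx = dy then (if ex = ey then \<one> else \<zero>)
     else if dx = 0 \<and> dy = k' then (if ex then (if ey then a \<otimes> u else a \<otimes> \<one>) else (if ey then v \<otimes> (a \<otimes> u) else v \<otimes> (a \<otimes> \<one>)))
     else if dx = k' \<and> dy = 0 then (if ex then (if ey then \<ominus> (v \<otimes> (a \<otimes> \<one>)) else a \<otimes> \<one>)
       else (if ey then v \<otimes> (a \<otimes> u) else \<ominus> (a \<otimes> u)))
     else \<zero>) = (if dx = dy \<and> ex = ey then \<one> else \<zero>) \<oplus> a \<otimes>
      ((if dx = 0 then (if ex then \<one> else v) else \<zero>) \<otimes> (if dy = k' then (if ey then u else \<one>) else \<zero>) \<oplus>
       (if dx = k' then (if ex then \<one> else \<ominus> u) else \<zero>) \<otimes> (if dy = 0 then (if ey then \<ominus> v else \<one>) else \<zero>))"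
      for dx dy :: nat and ex ey :: bool
    proof -
      consider "dx = dy" | "dx = 0" "dy = k'" | "dx = k'" "dy = 0"
        | "dx \<noteq> dy" "\<not> (dx = 0 \<and> dy = k')" "\<not> (dx = k' \<and> dy = 0)" by metis
      then show ?thesis
        using k'(2) a uv
        by cases (cases ex; cases ey; auto simp: l_minus r_minus m_ac)+
    qed
    have "root_mat R n i ?j a $$ (x, y) = (if x div 2 = y div 2 \<and> even x = even y then \<one> else \<zero>) \<oplus> a \<otimes>
      (base_vec R i x \<otimes> covec R (base_vec R ?j) y \<oplus> base_vec R ?j x \<otimes> covec R (base_vec R i) y)"
      using xy unfolding eq[symmetric] by (rule root_mat_entry)
    moreover have "E_mat n R k (mat_of_rows_list 2 [[a \<otimes> u, a \<otimes> \<one>], [v \<otimes> (a \<otimes> u), v \<otimes> (a \<otimes> \<one>)]]) $$ (x, y) =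
      root_mat R n i ?j a $$ (x, y)"
      unfolding calculation B using a uv by (subst E) (simp_all only: key m_closed one_closed)
    moreover have "covec R (base_vec R r) 0 = u" "covec R (base_vec R r) 1 = \<one>" "base_vec R i 1 = v"
      using rC by (simp_all add: u_def v_def)
    ultimately show ?thesis by (simp only:)
  qed
qed (simp_all add: E_mat_def block_matrix_def root_mat_def tmat_def)

text \<open>The covector of \<open>(1, 1)\<close> is \<open>(-1, 1)\<close>. Its outer product with
  \<open>(1, 1)\<close> is \<open>B(-1)\<close> and that with \<open>(1, -1)\<close> is
  \<open>D(1)\<close>, hence the sign in the second equation only.\<close>

lemma E_mat_ABCD:
  assumes "2 \<le> k" "k \<le> n" "a \<in> carrier R"
  shows "E_mat n R k (matA R a) = root_mat R n 0 (2 * (k - 1) + 1) a"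
    and "E_mat n R k (matB R a) = root_mat R n 0 (2 * (k - 1)) (\<ominus> a)"
    and "E_mat n R k (matC R a) = root_mat R n 1 (2 * (k - 1) + 1) a"
    and "E_mat n R k (matD R a) = root_mat R n 1 (2 * (k - 1)) a"
proof -
  note E = E_mat_root_mat[OF assms(1,2), unfolded covec_base_vec base_vec_def]
  show "E_mat n R k (matA R a) = root_mat R n 0 (2 * (k - 1) + 1) a"
    using E[of 0 1 a] assms(3) by (simp add: matA_def)
  show "E_mat n R k (matB R a) = root_mat R n 0 (2 * (k - 1)) (\<ominus> a)"
    using E[of 0 0 "\<ominus> a"] assms(3) by (simp add: matB_def r_minus)
  show "E_mat n R k (matC R a) = root_mat R n 1 (2 * (k - 1) + 1) a"
    using E[of 1 1 a] assms(3) by (simp add: matC_def l_minus)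
  show "E_mat n R k (matD R a) = root_mat R n 1 (2 * (k - 1)) a"
    using E[of 1 0 a] assms(3) by (simp add: matD_def l_minus r_minus)
qed

lemma E_mat_generators:
  "(\<Union>k\<in>{2..n}. \<Union>a\<in>carrier R.
    {E_mat n R k (matA R a), E_mat n R k (matB R a), E_mat n R k (matC R a), E_mat n R k (matD R a)}) = elem_gens R n"
  (is "?E = _")
proof (intro equalityI subsetI)
  fix g assume "g \<in> ?E"
  then obtain k a where ka: "2 \<le> k" "k \<le> n" "a \<in> carrier R"
    and g: "g \<in> {E_mat n R k (matA R a), E_mat n R k (matB R a), E_mat n R k (matC R a), E_mat n R k (matD R a)}"
    by auto
  have I: "root_mat R n i j c \<in> elem_gens R n" if "i < 2" "2 \<le> j" "j < 2 * n" "c \<in> carrier R" for i j c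
    using that by (auto simp: elem_gens_def)
  from g show "g \<in> elem_gens R n"
    using ka by (auto simp: E_mat_ABCD[OF ka] intro!: I)
next
  fix g assume "g \<in> elem_gens R n"
  then obtain i j c where g: "g = root_mat R n i j c" "i < 2" "2 \<le> j" "j < 2 * n" "c \<in> carrier R"
    by (auto simp: elem_gens_def)
  define k where "k = j div 2 + 1"
  have k: "2 \<le> k" "k \<le> n" using g(3,4) by (auto simp: k_def)
  have i: "i = 0 \<or> i = 1" using g(2) by auto
  have j: "j = 2 * (k - 1) \<or> j = 2 * (k - 1) + 1" by (auto simp: k_def)
  have mc: "\<ominus> c \<in> carrier R" "\<ominus> (\<ominus> c) = c" using g(5) by simp_all
  have "g \<in> {E_mat n R k (matA R c), E_mat n R k (matB R (\<ominus> c)), E_mat n R k (matC R c), E_mat n R k (matD R c)}"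
    using i j unfolding g(1) E_mat_ABCD[OF k g(5)] E_mat_ABCD[OF k mc(1)] mc(2) by blast
  with k g(5) mc(1) show "g \<in> ?E" by fastforce
qed

text \<open>The inverses in \<open>generate\<close> are taken in \<open>Sp n R\<close> and are
  characterized by membership in its carrier. Identifying them with negated coefficients therefore
  uses \<open>root_mat_Sp\<close>, including the determinant.\<close>

lemma H_sub_words:
  assumes two: "\<one> \<oplus> \<one> \<in> Units R"
  shows "H_sub n R = elem_words R n"
proof (intro equalityI subsetI)
  let ?W = "elem_words R n"
  fix x assume "x \<in> H_sub n R"
  then have "x \<in> generate (Sp n R) (elem_gens R n)" by (simp only: H_sub_def E_mat_generators)
  then show "x \<in> ?W"
  proof induction
    case one
    then show ?case by (simp add: Sp_def words.one)
  next
    case (incl h)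
    then show ?case by (rule words_gen[OF elem_gens_closed])
  next
    case (inv h)
    then obtain i j c where h: "h = root_mat R n i j c" "i < 2" "2 \<le> j" "j < 2 * n" "c \<in> carrier R"
      by (auto simp: elem_gens_def)
    have ij: "i < 2 * n" "j \<noteq> partner i" using h by (auto simp: partner_def)
    let ?g = "root_mat R n i j (\<ominus> c)"
    have "inv\<^bsub>Sp n R\<^esub> h = ?g"
      unfolding m_inv_def
    proof (rule the_equality)
      show "?g \<in> carrier (Sp n R) \<and> h \<otimes>\<^bsub>Sp n R\<^esub> ?g = \<one>\<^bsub>Sp n R\<^esub> \<and> ?g \<otimes>\<^bsub>Sp n R\<^esub> h = \<one>\<^bsub>Sp n R\<^esub>"
        using root_mat_Sp[OF two h(2-4), of "\<ominus> c"] h root_mat_inverse[OF h(5) ij] by (simp add: Sp_def)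
      fix y assume y: "y \<in> carrier (Sp n R) \<and> h \<otimes>\<^bsub>Sp n R\<^esub> y = \<one>\<^bsub>Sp n R\<^esub> \<and> y \<otimes>\<^bsub>Sp n R\<^esub> h = \<one>\<^bsub>Sp n R\<^esub>"
      then have "y \<in> mats R (2 * n)" "matrix_mult R h y = matrix_one R (2 * n)"
        by (auto simp: Sp_def SL_def mats_def)
      then have "y = matrix_mult R ?g (matrix_one R (2 * n))"
        using h root_mat_inverse[OF h(5) ij]
        by - (rule matrix_mult_cancel[where m = "2 * n" and A = h], simp_all)
      then show "y = ?g" using h by simp
    qed
    then show ?case using h by (simp add: elem_gens_root)
  next
    case (eng h1 h2)
    then show ?case by (simp add: Sp_def words_mult[OF elem_gens_closed])
  qed
next
  fix x assume "x \<in> elem_words R n"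
  then have "x \<in> generate (Sp n R) (elem_gens R n)"
  proof induction
    case one
    show ?case using generate.one[of "Sp n R"] by (simp add: Sp_def)
  next
    case (cons g w)
    then have "g \<otimes>\<^bsub>Sp n R\<^esub> w \<in> generate (Sp n R) (elem_gens R n)"
      by (meson generate.eng generate.incl)
    then show ?case by (simp add: Sp_def)
  qed
  then show "x \<in> H_sub n R" by (simp only: H_sub_def E_mat_generators)
qed

end

section \<open>Rings of fractions\<close>

text \<open>Collapses the unions over representatives in the operations of
  \<open>localization\<close>, given that all of them yield one class and that representatives
  exist.\<close>

lemma UN_pair_const:
  assumes "\<And>r s r' s'. (r, s) \<in> X \<Longrightarrow> (r', s') \<in> Y \<Longrightarrow> F r s r' s' = C" "(a, b) \<in> X" "(c, d) \<in> Y"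
  shows "(\<Union>(r, s)\<in>X. \<Union>(r', s')\<in>Y. F r s r' s') = C"
proof (intro equalityI subsetI)
  fix x assume "x \<in> C"
  then have "x \<in> F a b c d" using assms(1)[OF assms(2,3)] by simp
  with assms(2,3) show "x \<in> (\<Union>(r, s)\<in>X. \<Union>(r', s')\<in>Y. F r s r' s')" by blast
next
  fix x assume "x \<in> (\<Union>(r, s)\<in>X. \<Union>(r', s')\<in>Y. F r s r' s')"
  then obtain r s r' s' where "(r, s) \<in> X" "(r', s') \<in> Y" "x \<in> F r s r' s'" by blast
  then show "x \<in> C" using assms(1) by simp
qed

locale multiplicative_subset = cring R for R (structure) +
  fixes M
  assumes M: "M \<subseteq> carrier R" "\<one> \<in> M" "\<And>s t. s \<in> M \<Longrightarrow> t \<in> M \<Longrightarrow> s \<otimes> t \<in> M"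
begin

lemma M_in_carrier [simp, intro]: "s \<in> M \<Longrightarrow> s \<in> carrier R"
  using M(1) by blast

lemma frac_rel_iff:
  "((r, s), (r', s')) \<in> frac_rel R M \<longleftrightarrow> r \<in> carrier R \<and> s \<in> M \<and> r' \<in> carrier R \<and> s' \<in> M \<and>
    (\<exists>t\<in>M. t \<otimes> (r \<otimes> s' \<ominus> r' \<otimes> s) = \<zero>)"
  by (simp add: frac_rel_def)

lemma frac_rel_equiv: "equiv (carrier R \<times> M) (frac_rel R M)"
proof (rule equivI)
  show "frac_rel R M \<subseteq> (carrier R \<times> M) \<times> (carrier R \<times> M)"
    by (auto simp: frac_rel_def)
  show "refl_on (carrier R \<times> M) (frac_rel R M)"
    using M(2) by (auto simp: refl_on_def frac_rel_def a_minus_def r_neg intro!: bexI[of _ \<one>])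
  show "sym (frac_rel R M)"
  proof (rule symI)
    fix x y assume "(x, y) \<in> frac_rel R M"
    then obtain r s r' s' t where x: "x = (r, s)" "y = (r', s')" "r \<in> carrier R" "s \<in> M" "r' \<in> carrier R" "s' \<in> M"
      and t: "t \<in> M" "t \<otimes> (r \<otimes> s' \<ominus> r' \<otimes> s) = \<zero>" by (auto simp: frac_rel_def)
    have "t \<otimes> (a \<ominus> b) = \<ominus> (t \<otimes> (b \<ominus> a))" if "a \<in> carrier R" "b \<in> carrier R" for a b
      using that M_in_carrier[OF t(1)] by algebra
    from this[of "r' \<otimes> s" "r \<otimes> s'"] have "t \<otimes> (r' \<otimes> s \<ominus> r \<otimes> s') = \<zero>" using t(2) x by simp
    then show "(y, x) \<in> frac_rel R M" using x t(1) by (auto simp: frac_rel_iff)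
  qed
  show "trans (frac_rel R M)"
  proof (rule transI)
    fix x y z assume "(x, y) \<in> frac_rel R M" "(y, z) \<in> frac_rel R M"
    then obtain r s r' s' r'' s'' t t' where x: "x = (r, s)" "y = (r', s')" "z = (r'', s'')"
      "r \<in> carrier R" "s \<in> M" "r' \<in> carrier R" "s' \<in> M" "r'' \<in> carrier R" "s'' \<in> M"
      and t: "t \<in> M" "t \<otimes> (r \<otimes> s' \<ominus> r' \<otimes> s) = \<zero>" "t' \<in> M" "t' \<otimes> (r' \<otimes> s'' \<ominus> r'' \<otimes> s') = \<zero>"
      by (auto simp: frac_rel_def)
    note c = x(4,6,8) x(5,7,9)[THEN M_in_carrier] t(1,3)[THEN M_in_carrier]
    \<comment> \<open>The middle denominator \<open>s'\<close> cannot be cancelled, so it is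
      absorbed into the witness.\<close>
    have "t \<otimes> t' \<otimes> s' \<otimes> (r \<otimes> s'' \<ominus> r'' \<otimes> s) =
      t' \<otimes> s'' \<otimes> (t \<otimes> (r \<otimes> s' \<ominus> r' \<otimes> s)) \<oplus> t \<otimes> s \<otimes> (t' \<otimes> (r' \<otimes> s'' \<ominus> r'' \<otimes> s'))"
      using c by algebra
    also have "\<dots> = \<zero>" using c t(2,4) by simp
    finally show "(x, z) \<in> frac_rel R M" using x t(1,3) M(3) by (auto simp: frac_rel_iff)
  qed
qed

lemma fraction_eq_iff:
  assumes "r \<in> carrier R" "s \<in> M" "r' \<in> carrier R" "s' \<in> M"
  shows "fraction R M r s = fraction R M r' s' \<longleftrightarrow> (\<exists>t\<in>M. t \<otimes> (r \<otimes> s' \<ominus> r' \<otimes> s) = \<zero>)"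
  unfolding fraction_def using assms
  by (subst eq_equiv_class_iff[OF frac_rel_equiv]) (auto simp: frac_rel_iff)

lemma fraction_eqI:
  assumes "r \<in> carrier R" "s \<in> M" "r' \<in> carrier R" "s' \<in> M" "r \<otimes> s' = r' \<otimes> s"
  shows "fraction R M r s = fraction R M r' s'"
  using assms M(2) by (subst fraction_eq_iff) (auto intro!: bexI[of _ \<one>] simp: a_minus_def r_neg)

lemma fraction_self: "r \<in> carrier R \<Longrightarrow> s \<in> M \<Longrightarrow> (r, s) \<in> fraction R M r s"
  unfolding fraction_def by (rule equiv_class_self[OF frac_rel_equiv]) simp

lemma fraction_memD:
  assumes "r \<in> carrier R" "s \<in> M" "(r', s') \<in> fraction R M r s"
  shows "r' \<in> carrier R" "s' \<in> M" "\<exists>t\<in>M. t \<otimes> (r \<otimes> s' \<ominus> r' \<otimes> s) = \<zero>"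
  using assms by (auto simp: fraction_def frac_rel_iff)

lemma fraction_mult:
  assumes "a \<in> carrier R" "s \<in> M" "b \<in> carrier R" "u \<in> M"
  shows "fraction R M a s \<otimes>\<^bsub>localization R M\<^esub> fraction R M b u = fraction R M (a \<otimes> b) (s \<otimes> u)"
proof -
  have *: "fraction R M (r \<otimes> r') (s' \<otimes> u') = fraction R M (a \<otimes> b) (s \<otimes> u)"
    if rs: "(r, s') \<in> fraction R M a s" and ru: "(r', u') \<in> fraction R M b u" for r s' r' u'
  proof -
    note d = fraction_memD[OF assms(1,2) rs] fraction_memD[OF assms(3,4) ru]
    obtain t t' where t: "t \<in> M" "t \<otimes> (a \<otimes> s' \<ominus> r \<otimes> s) = \<zero>" "t' \<in> M" "t' \<otimes> (b \<otimes> u' \<ominus> r' \<otimes> u) = \<zero>"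
      using d by blast
    note c = assms(1,3) d(1,4) assms(2,4)[THEN M_in_carrier] d(2,5)[THEN M_in_carrier] t(1,3)[THEN M_in_carrier]
    have "t \<otimes> t' \<otimes> (a \<otimes> b \<otimes> (s' \<otimes> u') \<ominus> r \<otimes> r' \<otimes> (s \<otimes> u)) =
      t' \<otimes> b \<otimes> u' \<otimes> (t \<otimes> (a \<otimes> s' \<ominus> r \<otimes> s)) \<oplus> t \<otimes> r \<otimes> s \<otimes> (t' \<otimes> (b \<otimes> u' \<ominus> r' \<otimes> u))"
      using c by algebra
    also have "\<dots> = \<zero>" using c t by simp
    finally have "fraction R M (a \<otimes> b) (s \<otimes> u) = fraction R M (r \<otimes> r') (s' \<otimes> u')"
      using assms d t M(3) by (subst fraction_eq_iff) auto
    then show ?thesis ..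
  qed
  show ?thesis
    unfolding localization_def monoid.simps ring.simps
    by (rule UN_pair_const[OF * fraction_self fraction_self]) (use assms in auto)
qed

lemma fraction_add:
  assumes "a \<in> carrier R" "s \<in> M" "b \<in> carrier R" "u \<in> M"
  shows "fraction R M a s \<oplus>\<^bsub>localization R M\<^esub> fraction R M b u = fraction R M (a \<otimes> u \<oplus> b \<otimes> s) (s \<otimes> u)"
proof -
  have *: "fraction R M (r \<otimes> u' \<oplus> r' \<otimes> s') (s' \<otimes> u') = fraction R M (a \<otimes> u \<oplus> b \<otimes> s) (s \<otimes> u)"
    if rs: "(r, s') \<in> fraction R M a s" and ru: "(r', u') \<in> fraction R M b u" for r s' r' u'
  proof -
    note d = fraction_memD[OF assms(1,2) rs] fraction_memD[OF assms(3,4) ru]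
    obtain t t' where t: "t \<in> M" "t \<otimes> (a \<otimes> s' \<ominus> r \<otimes> s) = \<zero>" "t' \<in> M" "t' \<otimes> (b \<otimes> u' \<ominus> r' \<otimes> u) = \<zero>"
      using d by blast
    note c = assms(1,3) d(1,4) assms(2,4)[THEN M_in_carrier] d(2,5)[THEN M_in_carrier] t(1,3)[THEN M_in_carrier]
    have "t \<otimes> t' \<otimes> ((a \<otimes> u \<oplus> b \<otimes> s) \<otimes> (s' \<otimes> u') \<ominus> (r \<otimes> u' \<oplus> r' \<otimes> s') \<otimes> (s \<otimes> u)) =
      t' \<otimes> u \<otimes> u' \<otimes> (t \<otimes> (a \<otimes> s' \<ominus> r \<otimes> s)) \<oplus> t \<otimes> s \<otimes> s' \<otimes> (t' \<otimes> (b \<otimes> u' \<ominus> r' \<otimes> u))"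
      using c by algebra
    also have "\<dots> = \<zero>" using c t by simp
    finally have "fraction R M (a \<otimes> u \<oplus> b \<otimes> s) (s \<otimes> u) = fraction R M (r \<otimes> u' \<oplus> r' \<otimes> s') (s' \<otimes> u')"
      using assms d t M(3) by (subst fraction_eq_iff) auto
    then show ?thesis ..
  qed
  show ?thesis
    unfolding localization_def monoid.simps ring.simps
    by (rule UN_pair_const[OF * fraction_self fraction_self]) (use assms in auto)
qed

lemma localization_carrier: "carrier (localization R M) = {fraction R M r s | r s. r \<in> carrier R \<and> s \<in> M}"
  by (auto simp: localization_def quotient_def fraction_def)

lemma fraction_closed: "r \<in> carrier R \<Longrightarrow> s \<in> M \<Longrightarrow> fraction R M r s \<in> carrier (localization R M)"
  by (auto simp: localization_carrier)

lemma localization_cases: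
  assumes "x \<in> carrier (localization R M)"
  obtains r s where "r \<in> carrier R" "s \<in> M" "x = fraction R M r s"
  using assms by (auto simp: localization_carrier)

lemma localization_one: "\<one>\<^bsub>localization R M\<^esub> = fraction R M \<one> \<one>"
  and localization_zero: "\<zero>\<^bsub>localization R M\<^esub> = fraction R M \<zero> \<one>"
  by (simp_all add: localization_def)

lemma localization_cring: "cring (localization R M)"
proof (intro cringI abelian_groupI comm_monoidI)
  let ?L = "localization R M"
  note ops = fraction_mult fraction_add fraction_closed localization_one localization_zero
  fix x y assume "x \<in> carrier ?L" "y \<in> carrier ?L"
  then obtain a s b t where x: "a \<in> carrier R" "s \<in> M" "x = fraction R M a s"
    and y: "b \<in> carrier R" "t \<in> M" "y = fraction R M b t" by (auto elim!: localization_cases)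
  show "x \<oplus>\<^bsub>?L\<^esub> y \<in> carrier ?L" "x \<otimes>\<^bsub>?L\<^esub> y \<in> carrier ?L"
    using x y M by (simp_all add: ops)
  show "x \<oplus>\<^bsub>?L\<^esub> y = y \<oplus>\<^bsub>?L\<^esub> x"
    using x y M by (simp add: ops a_comm m_comm)
  show "x \<otimes>\<^bsub>?L\<^esub> y = y \<otimes>\<^bsub>?L\<^esub> x"
    using x y M by (simp add: ops m_comm)
  fix z assume "z \<in> carrier ?L"
  then obtain c u where z: "c \<in> carrier R" "u \<in> M" "z = fraction R M c u" by (auto elim!: localization_cases)
  note cc = x(1) y(1) z(1) x(2)[THEN M_in_carrier] y(2)[THEN M_in_carrier] z(2)[THEN M_in_carrier]
  show "x \<oplus>\<^bsub>?L\<^esub> y \<oplus>\<^bsub>?L\<^esub> z = x \<oplus>\<^bsub>?L\<^esub> (y \<oplus>\<^bsub>?L\<^esub> z)"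
  proof -
    have "((a \<otimes> t \<oplus> b \<otimes> s) \<otimes> u \<oplus> c \<otimes> (s \<otimes> t)) \<otimes> (s \<otimes> (t \<otimes> u)) =
      (a \<otimes> (t \<otimes> u) \<oplus> (b \<otimes> u \<oplus> c \<otimes> t) \<otimes> s) \<otimes> (s \<otimes> t \<otimes> u)"
      using cc by algebra
    then have "fraction R M ((a \<otimes> t \<oplus> b \<otimes> s) \<otimes> u \<oplus> c \<otimes> (s \<otimes> t)) (s \<otimes> t \<otimes> u) =
      fraction R M (a \<otimes> (t \<otimes> u) \<oplus> (b \<otimes> u \<oplus> c \<otimes> t) \<otimes> s) (s \<otimes> (t \<otimes> u))"
      using x y z M by (intro fraction_eqI) auto
    then show ?thesis using x y z M by (simp add: ops)
  qed
  show "x \<otimes>\<^bsub>?L\<^esub> y \<otimes>\<^bsub>?L\<^esub> z = x \<otimes>\<^bsub>?L\<^esub> (y \<otimes>\<^bsub>?L\<^esub> z)"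
    using x y z M by (simp add: ops m_assoc)
  show "(x \<oplus>\<^bsub>?L\<^esub> y) \<otimes>\<^bsub>?L\<^esub> z = x \<otimes>\<^bsub>?L\<^esub> z \<oplus>\<^bsub>?L\<^esub> y \<otimes>\<^bsub>?L\<^esub> z"
  proof -
    have "(a \<otimes> t \<oplus> b \<otimes> s) \<otimes> c \<otimes> (s \<otimes> u \<otimes> (t \<otimes> u)) =
      (a \<otimes> c \<otimes> (t \<otimes> u) \<oplus> b \<otimes> c \<otimes> (s \<otimes> u)) \<otimes> (s \<otimes> t \<otimes> u)"
      using cc by algebra
    then have "fraction R M ((a \<otimes> t \<oplus> b \<otimes> s) \<otimes> c) (s \<otimes> t \<otimes> u) =
      fraction R M (a \<otimes> c \<otimes> (t \<otimes> u) \<oplus> b \<otimes> c \<otimes> (s \<otimes> u)) (s \<otimes> u \<otimes> (t \<otimes> u))"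
      using x y z M by (intro fraction_eqI) auto
    then show ?thesis using x y z M by (simp add: ops)
  qed
next
  let ?L = "localization R M"
  note ops = fraction_mult fraction_add fraction_closed localization_one localization_zero
  show "\<zero>\<^bsub>?L\<^esub> \<in> carrier ?L" "\<one>\<^bsub>?L\<^esub> \<in> carrier ?L" using M by (simp_all add: ops)
  fix x assume "x \<in> carrier ?L"
  then obtain a s where x: "a \<in> carrier R" "s \<in> M" "x = fraction R M a s" by (auto elim!: localization_cases)
  show "\<zero>\<^bsub>?L\<^esub> \<oplus>\<^bsub>?L\<^esub> x = x" "\<one>\<^bsub>?L\<^esub> \<otimes>\<^bsub>?L\<^esub> x = x"
    using x M by (simp_all add: ops)
  show "\<exists>y\<in>carrier ?L. y \<oplus>\<^bsub>?L\<^esub> x = \<zero>\<^bsub>?L\<^esub>"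
  proof
    show "fraction R M (\<ominus> a) s \<in> carrier ?L" using x by (simp add: ops)
    have "\<ominus> a \<otimes> s \<oplus> a \<otimes> s = \<zero>" using x by (simp add: l_minus l_neg)
    moreover have "fraction R M \<zero> (s \<otimes> s) = fraction R M \<zero> \<one>"
      using x M by (intro fraction_eqI) auto
    ultimately show "fraction R M (\<ominus> a) s \<oplus>\<^bsub>?L\<^esub> x = \<zero>\<^bsub>?L\<^esub>"
      using x M by (simp add: ops)
  qed
qed

lemma localization_hom_fraction:
  "localization_hom R (localization R M) (\<lambda>r. fraction R M r \<one>) M"
proof -
  let ?L = "localization R M" and ?h = "\<lambda>r. fraction R M r \<one>"
  note ops = fraction_mult fraction_add fraction_closed localization_one localization_zero
  interpret L: cring ?L by (rule localization_cring)
  have "ring_hom_cring R ?L ?h"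
  proof (rule ring_hom_cringI)
    show "?h \<in> Ring.ring_hom R ?L"
      using M by (intro ring_hom_memI) (simp_all add: ops)
  qed (rule is_cring localization_cring)+
  moreover have "\<exists>u\<in>M. \<exists>b\<in>carrier R. ?h u \<otimes>\<^bsub>?L\<^esub> y = ?h b" if y: "y \<in> carrier ?L" for y
  proof -
    obtain a s where x: "a \<in> carrier R" "s \<in> M" "y = fraction R M a s" using y by (rule localization_cases)
    moreover from this have "fraction R M (s \<otimes> a) s = fraction R M a \<one>"
      using M by (intro fraction_eqI) (auto simp: m_comm)
    ultimately have "?h s \<otimes>\<^bsub>?L\<^esub> y = ?h a" using M by (simp add: ops)
    with x show ?thesis by blast
  qed
  moreover have "\<exists>u\<in>M. u \<otimes> b = \<zero>" if b: "b \<in> carrier R" "?h b = \<zero>\<^bsub>?L\<^esub>" for b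
    using b M by (simp add: localization_zero fraction_eq_iff a_minus_def)
  ultimately show ?thesis
    using M by (intro localization_hom.intro localization_hom_axioms.intro) auto
qed

end

section \<open>Polynomial rings\<close>

text \<open>This is \<open>R[X][Z]\<close>: \<open>UPX (UP R)\<close> is the outer variable
  \<open>Z\<close>, and \<open>UPC (UP R) (UPX R)\<close> is \<open>X\<close> as a constant.\<close>

abbreviation UP2 :: "('a, 'b) ring_scheme \<Rightarrow> (nat \<Rightarrow> 'a, nat \<Rightarrow> nat \<Rightarrow> 'a) up_ring" where
  "UP2 R \<equiv> UP (UP R)"

definition UPC :: "('a, 'b) ring_scheme \<Rightarrow> 'a \<Rightarrow> nat \<Rightarrow> 'a" where
  "UPC R r = up_ring.monom (UP R) r 0"

definition UPX :: "('a, 'b) ring_scheme \<Rightarrow> nat \<Rightarrow> 'a" where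
  "UPX R = up_ring.monom (UP R) \<one>\<^bsub>R\<^esub> 1"

definition coeff_map :: "('a \<Rightarrow> 'c) \<Rightarrow> (nat \<Rightarrow> 'a) \<Rightarrow> nat \<Rightarrow> 'c" where
  "coeff_map h p = (\<lambda>i. h (p i))"

lemma ring_hom_cring_comp:
  assumes "ring_hom_cring R S f" "ring_hom_cring S T g"
  shows "ring_hom_cring R T (\<lambda>x. g (f x))"
proof -
  interpret f: ring_hom_cring R S f by fact
  interpret g: ring_hom_cring S T g by fact
  show ?thesis
    by (rule ring_hom_cringI[OF f.R.is_cring g.S.is_cring]) (rule ring_hom_memI; simp)
qed

lemma UP_cring_cring: "cring R \<Longrightarrow> cring (UP R)"
  by (rule UP_cring.UP_cring) (rule UP_cring.intro)

lemma UPX_closed [simp, intro]: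
  assumes "cring R"
  shows "UPX R \<in> carrier (UP R)"
proof -
  interpret UP_cring R "UP R" using assms by (simp_all add: UP_cring.intro)
  show ?thesis unfolding UPX_def by simp
qed

lemma UPC_hom:
  assumes "cring R"
  shows "ring_hom_cring R (UP R) (UPC R)"
proof -
  interpret UP_cring R "UP R" using assms by (simp_all add: UP_cring.intro)
  show ?thesis unfolding UPC_def
    by (rule ring_hom_cringI[OF assms P.is_cring const_ring_hom])
qed

lemma eval_hom:
  assumes "ring_hom_cring R S h" "s \<in> carrier S"
  shows "ring_hom_cring (UP R) S (UnivPoly.eval R S h s)"
    and "r \<in> carrier R \<Longrightarrow> UnivPoly.eval R S h s (UPC R r) = h r"
    and "UnivPoly.eval R S h s (UPX R) = s"
proof -
  interpret ring_hom_cring R S h by fact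
  interpret UP_pre_univ_prop R S h "UP R"
    by (simp_all add: UP_pre_univ_prop.intro assms(1) R.is_cring UP_cring.intro)
  show "ring_hom_cring (UP R) S (UnivPoly.eval R S h s)"
    by (rule ring_hom_cringI[OF P.is_cring S.is_cring eval_ring_hom[OF assms(2)]])
  show "r \<in> carrier R \<Longrightarrow> UnivPoly.eval R S h s (UPC R r) = h r"
    unfolding UPC_def using assms(2) by (rule eval_const)
  show "UnivPoly.eval R S h s (UPX R) = s"
    unfolding UPX_def using assms(2) by (rule eval_monom1)
qed

text \<open>\<open>R[X]\<close> is generated as a ring by the constants and \<open>X\<close>. This
  suits properties closed under sums and products: equality of two homomorphisms, and the
  divisibility statement \<open>shift_close\<close>.\<close>

lemma UP_induct [consumes 2, case_names const X add mult]:
  fixes R (structure)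
  assumes "cring R" and p: "p \<in> carrier (UP R)"
    and const: "\<And>r. r \<in> carrier R \<Longrightarrow> Q (UPC R r)" and X: "Q (UPX R)"
    and add: "\<And>p q. p \<in> carrier (UP R) \<Longrightarrow> q \<in> carrier (UP R) \<Longrightarrow> Q p \<Longrightarrow> Q q \<Longrightarrow> Q (p \<oplus>\<^bsub>UP R\<^esub> q)"
    and mult: "\<And>p q. p \<in> carrier (UP R) \<Longrightarrow> q \<in> carrier (UP R) \<Longrightarrow> Q p \<Longrightarrow> Q q \<Longrightarrow> Q (p \<otimes>\<^bsub>UP R\<^esub> q)"
  shows "Q p"
proof -
  interpret UP_cring R "UP R" using assms(1) by (simp_all add: UP_cring.intro)
  have mono: "Q (up_ring.monom (UP R) r n)" if r: "r \<in> carrier R" for r n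
  proof (induction n)
    case 0
    show ?case using const[OF r] by (simp add: UPC_def)
  next
    case (Suc n)
    have "up_ring.monom (UP R) r (Suc n) = up_ring.monom (UP R) r n \<otimes>\<^bsub>UP R\<^esub> UPX R"
      using r monom_mult[of r \<one> n 1] by (simp add: UPX_def)
    then show ?case using mult[OF _ _ Suc X] r by (simp add: UPX_def)
  qed
  have "Q (\<Oplus>\<^bsub>UP R\<^esub>i\<in>A. up_ring.monom (UP R) (up_ring.coeff (UP R) p i) i)" if "finite A" for A
    using that
  proof (induction A)
    case empty
    show ?case using mono[of \<zero> 0] by simp
  next
    case (insert i A)
    let ?t = "\<lambda>i. up_ring.monom (UP R) (up_ring.coeff (UP R) p i) i"
    have t: "?t i \<in> carrier (UP R)" for i using p by simp
    have "(\<Oplus>\<^bsub>UP R\<^esub>i\<in>insert i A. ?t i) = ?t i \<oplus>\<^bsub>UP R\<^esub> (\<Oplus>\<^bsub>UP R\<^esub>i\<in>A. ?t i)"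
      using insert(1,2) t by (intro P.finsum_insert) auto
    moreover have "(\<Oplus>\<^bsub>UP R\<^esub>i\<in>A. ?t i) \<in> carrier (UP R)" using t by (intro P.finsum_closed) auto
    moreover have "Q (?t i)" using p by (intro mono) simp
    ultimately show ?case using add[OF t _ _ insert(3)] by simp
  qed
  from this[of "{..deg R p}"] show ?thesis using up_repr[OF p] by simp
qed

lemma UP_hom_ext:
  assumes "ring_hom_cring (UP R) S f" "ring_hom_cring (UP R) S g" "cring R"
    and "\<And>r. r \<in> carrier R \<Longrightarrow> f (UPC R r) = g (UPC R r)" "f (UPX R) = g (UPX R)" "p \<in> carrier (UP R)"
  shows "f p = g p"
proof -
  interpret f: ring_hom_cring "UP R" S f by fact
  interpret g: ring_hom_cring "UP R" S g by fact
  from assms(3,6) show ?thesis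
    by (induction rule: UP_induct) (simp_all add: assms(4,5))
qed

lemma coeff_map_hom:
  fixes R (structure)
  assumes "ring_hom_cring R S h"
  shows "ring_hom_cring (UP R) (UP S) (coeff_map h)"
    and "r \<in> carrier R \<Longrightarrow> coeff_map h (UPC R r) = UPC S (h r)"
    and "coeff_map h (UPX R) = UPX S"
proof -
  interpret ring_hom_cring R S h by fact
  have closed: "coeff_map h p \<in> up S" if p: "p \<in> up R" for p
  proof -
    obtain n where "bound \<zero> n p" using R.bound_upD[OF p] by blast
    then have "bound \<zero>\<^bsub>S\<^esub> n (coeff_map h p)" by (auto simp: bound_def coeff_map_def)
    with p show ?thesis by (auto simp: up_def coeff_map_def)
  qed
  show "ring_hom_cring (UP R) (UP S) (coeff_map h)"
  proof (rule ring_hom_cringI[OF UP_cring_cring[OF R.is_cring] UP_cring_cring[OF S.is_cring]],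
      rule ring_hom_memI)
    fix p q assume "p \<in> carrier (UP R)" "q \<in> carrier (UP R)"
    then have p: "p \<in> up R" and q: "q \<in> up R" by (simp_all add: UP_def)
    have pc: "p i \<in> carrier R" "q i \<in> carrier R" for i using p q by auto
    show "coeff_map h p \<in> carrier (UP S)" using closed[OF p] by (simp add: UP_def)
    show "coeff_map h (p \<oplus>\<^bsub>UP R\<^esub> q) = coeff_map h p \<oplus>\<^bsub>UP S\<^esub> coeff_map h q"
      using p q closed pc by (auto simp: UP_def coeff_map_def)
    have "h (\<Oplus>i\<in>{..n}. p i \<otimes> q (n - i)) = (\<Oplus>\<^bsub>S\<^esub>i\<in>{..n}. h (p i) \<otimes>\<^bsub>S\<^esub> h (q (n - i)))" for n
      using pc by (subst hom_finsum) (auto simp: comp_def)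
    then show "coeff_map h (p \<otimes>\<^bsub>UP R\<^esub> q) = coeff_map h p \<otimes>\<^bsub>UP S\<^esub> coeff_map h q"
      using p q closed by (simp add: UP_def coeff_map_def)
  next
    show "coeff_map h \<one>\<^bsub>UP R\<^esub> = \<one>\<^bsub>UP S\<^esub>" by (auto simp: UP_def coeff_map_def)
  qed
  show "r \<in> carrier R \<Longrightarrow> coeff_map h (UPC R r) = UPC S (h r)"
    by (auto simp: UPC_def UP_def coeff_map_def)
  show "coeff_map h (UPX R) = UPX S"
    by (auto simp: UPX_def UP_def coeff_map_def)
qed

lemma UPC_mult_coeff:
  assumes "cring R" "r \<in> carrier R" "p \<in> carrier (UP R)"
  shows "UPC R r \<otimes>\<^bsub>UP R\<^esub> p = (\<lambda>i. r \<otimes>\<^bsub>R\<^esub> p i)"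
proof -
  interpret UP_cring R "UP R" using assms by (simp_all add: UP_cring.intro)
  have "UPC R r \<otimes>\<^bsub>UP R\<^esub> p = r \<odot>\<^bsub>UP R\<^esub> p"
    unfolding UPC_def using assms by (intro monom_mult_is_smult)
  also have "\<dots> = (\<lambda>i. r \<otimes>\<^bsub>R\<^esub> p i)" using assms(2,3) by (simp add: UP_def)
  finally show ?thesis .
qed

lemma UP_carrier_iff: "p \<in> carrier (UP R) \<longleftrightarrow> (\<forall>i. p i \<in> carrier R) \<and> (\<exists>n. bound \<zero>\<^bsub>R\<^esub> n p)"
  by (auto simp: UP_def up_def)

lemma UP_zero_fun: "\<zero>\<^bsub>UP R\<^esub> = (\<lambda>i. \<zero>\<^bsub>R\<^esub>)"
  by (simp add: UP_def)

text \<open>A polynomial has finitely many nonzero coefficients, so the product of their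
  denominators clears all of them, and a product of annihilators kills all of them.\<close>

lemma (in localization_hom) localization_hom_UP:
  "localization_hom (UP R) (UP S) (coeff_map h) (UPC R ` M)"
proof -
  interpret C: ring_hom_cring R "UP R" "UPC R" by (rule UPC_hom[OF R.is_cring])
  interpret D: ring_hom_cring "UP R" "UP S" "coeff_map h"
    by (rule coeff_map_hom(1)) (rule ring_hom_cring_axioms)
  have den: "\<exists>u\<in>M. \<exists>b. (\<forall>i. b i \<in> carrier R) \<and> (\<forall>i<N. h u \<otimes>\<^bsub>S\<^esub> y i = h (b i))"
    if y: "\<And>i. y i \<in> carrier S" for y and N :: nat
  proof (induction N)
    case 0
    then show ?case by (auto intro!: bexI[of _ \<one>] exI[of _ "\<lambda>_. \<zero>"])
  next
    case (Suc N)
    then obtain u b where u: "u \<in> M" "\<And>i. b i \<in> carrier R" "\<And>i. i < N \<Longrightarrow> h u \<otimes>\<^bsub>S\<^esub> y i = h (b i)" by blast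
    obtain v c where v: "v \<in> M" "c \<in> carrier R" "h v \<otimes>\<^bsub>S\<^esub> y N = h c" using denominator[OF y] by blast
    have "h (u \<otimes> v) \<otimes>\<^bsub>S\<^esub> y i = h ((\<lambda>i. if i < N then v \<otimes> b i else u \<otimes> c) i)" if i: "i < Suc N" for i
    proof (cases "i < N")
      case True
      have "h (u \<otimes> v) \<otimes>\<^bsub>S\<^esub> y i = h v \<otimes>\<^bsub>S\<^esub> (h u \<otimes>\<^bsub>S\<^esub> y i)" using u v y by (simp add: S.m_ac)
      then show ?thesis using True u v by simp
    next
      case False
      then have "i = N" using i by simp
      then show ?thesis using u v y by (simp add: S.m_assoc)
    qed
    then show ?case using u v
      by (intro bexI[of _ "u \<otimes> v"] exI[of _ "\<lambda>i. if i < N then v \<otimes> b i else u \<otimes> c"]) auto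
  qed
  have ann: "\<exists>u\<in>M. \<forall>i<N. u \<otimes> b i = \<zero>" if b: "\<And>i. b i \<in> carrier R" "\<And>i. h (b i) = \<zero>\<^bsub>S\<^esub>" for b and N :: nat
  proof (induction N)
    case 0
    then show ?case by auto
  next
    case (Suc N)
    then obtain u where u: "u \<in> M" "\<And>i. i < N \<Longrightarrow> u \<otimes> b i = \<zero>" by blast
    obtain v where v: "v \<in> M" "v \<otimes> b N = \<zero>" using annihilator[OF b] by blast
    have "u \<otimes> v \<otimes> b i = \<zero>" if i: "i < Suc N" for i
    proof (cases "i < N")
      case True
      have "u \<otimes> v \<otimes> b i = v \<otimes> (u \<otimes> b i)" using u(1) v(1) b(1) by (simp add: R.m_ac)
      then show ?thesis using u(2)[OF True] v(1) by simp
    next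
      case False
      then have "i = N" using i by simp
      then show ?thesis using u(1) v b(1) by (simp add: R.m_assoc)
    qed
    then show ?case using u(1) v(1) by blast
  qed
  show ?thesis
  proof (intro localization_hom.intro localization_hom_axioms.intro)
    show "ring_hom_cring (UP R) (UP S) (coeff_map h)" by (rule D.ring_hom_cring_axioms)
    show "UPC R ` M \<subseteq> carrier (UP R)" by auto
    show "\<one>\<^bsub>UP R\<^esub> \<in> UPC R ` M" using imageI[OF M_one, of "UPC R"] by (simp only: C.hom_one)
    show "s \<otimes>\<^bsub>UP R\<^esub> t \<in> UPC R ` M" if st: "s \<in> UPC R ` M" "t \<in> UPC R ` M" for s t
    proof -
      obtain a b where ab: "a \<in> M" "b \<in> M" "s = UPC R a" "t = UPC R b" using st by blast
      then have "s \<otimes>\<^bsub>UP R\<^esub> t = UPC R (a \<otimes> b)" by simp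
      then show ?thesis using ab by blast
    qed
    show "\<exists>u\<in>UPC R ` M. \<exists>b\<in>carrier (UP R). coeff_map h u \<otimes>\<^bsub>UP S\<^esub> y = coeff_map h b"
      if y: "y \<in> carrier (UP S)" for y
    proof -
      have yc: "\<And>i. y i \<in> carrier S" and "\<exists>n. bound \<zero>\<^bsub>S\<^esub> n y" using y by (auto simp: UP_carrier_iff)
      then obtain n where n: "bound \<zero>\<^bsub>S\<^esub> n y" by blast
      obtain u b where u: "u \<in> M" "\<And>i. b i \<in> carrier R" "\<And>i. i < Suc n \<Longrightarrow> h u \<otimes>\<^bsub>S\<^esub> y i = h (b i)"
        using den[of y "Suc n"] yc by blast
      \<comment> \<open>Cut off beyond the bound, because the numerators must form a
        polynomial.\<close>
      define b' where "b' i = (if i < Suc n then b i else \<zero>)" for i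
      have b': "b' \<in> carrier (UP R)"
        using u(2) by (auto simp: UP_carrier_iff b'_def bound_def intro!: exI[of _ n])
      have "h u \<otimes>\<^bsub>S\<^esub> y i = h (b' i)" for i
        using u n by (auto simp: b'_def bound_def)
      then have "coeff_map h (UPC R u) \<otimes>\<^bsub>UP S\<^esub> y = coeff_map h b'"
        using u(1) y coeff_map_hom(2)[OF ring_hom_cring_axioms]
        by (simp add: UPC_mult_coeff[OF S.is_cring]) (simp add: coeff_map_def)
      then show ?thesis using u(1) b' by blast
    qed
    show "\<exists>u\<in>UPC R ` M. u \<otimes>\<^bsub>UP R\<^esub> b = \<zero>\<^bsub>UP R\<^esub>"
      if b: "b \<in> carrier (UP R)" "coeff_map h b = \<zero>\<^bsub>UP S\<^esub>" for b
    proof -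
      have bc: "\<And>i. b i \<in> carrier R" and "\<exists>n. bound \<zero> n b" using b by (auto simp: UP_carrier_iff)
      then obtain n where n: "bound \<zero> n b" by blast
      have hb: "h (b i) = \<zero>\<^bsub>S\<^esub>" for i using b(2) by (metis UP_zero_fun coeff_map_def)
      obtain u where u: "u \<in> M" "\<And>i. i < Suc n \<Longrightarrow> u \<otimes> b i = \<zero>" using ann[of b "Suc n"] bc hb by blast
      have "u \<otimes> b i = \<zero>" for i
        using u n by (cases "i < Suc n") (auto simp: bound_def)
      then have "UPC R u \<otimes>\<^bsub>UP R\<^esub> b = \<zero>\<^bsub>UP R\<^esub>"
        using u(1) b(1) by (simp add: UPC_mult_coeff[OF R.is_cring] UP_zero_fun)
      then show ?thesis using u(1) by blast
    qed
  qed
qed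

text \<open>All coefficients of \<open>d\<close> are killed by \<open>u\<close> and the constant one is zero, so \<open>X \<mapsto> uX\<close> maps \<open>d\<close> to 0.\<close>

lemma eval_killed:
  assumes "cring R" "d \<in> carrier (UP R)" "u \<in> carrier R"
    and "UPC R u \<otimes>\<^bsub>UP R\<^esub> d = \<zero>\<^bsub>UP R\<^esub>"
    and "UnivPoly.eval R (UP R) (UPC R) \<zero>\<^bsub>UP R\<^esub> d = \<zero>\<^bsub>UP R\<^esub>"
  shows "UnivPoly.eval R (UP R) (UPC R) (UPC R u \<otimes>\<^bsub>UP R\<^esub> UPX R) d = \<zero>\<^bsub>UP R\<^esub>"
proof -
  interpret C: ring_hom_cring R "UP R" "UPC R" by (rule UPC_hom[OF assms(1)])
  interpret UP_cring R "UP R" using assms(1) by (simp_all add: UP_cring.intro)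
  have dc: "d i \<in> carrier R" for i using assms(2) by (simp add: UP_carrier_iff)
  have ud: "u \<otimes>\<^bsub>R\<^esub> d i = \<zero>\<^bsub>R\<^esub>" for i
    using assms(4) UPC_mult_coeff[OF assms(1,3,2)] by (metis UP_zero_fun)
  have ev: "UnivPoly.eval R (UP R) (UPC R) s d = (\<Oplus>\<^bsub>UP R\<^esub>i\<in>{..deg R d}. UPC R (d i) \<otimes>\<^bsub>UP R\<^esub> s [^]\<^bsub>UP R\<^esub> i)" for s
  proof -
    have "up_ring.coeff (UP R) d = d" using assms(2) by (simp add: UP_def)
    then show ?thesis using eval_on_carrier[OF assms(2), of "UP R" "UPC R" s] by (simp only:)
  qed
  \<comment> \<open>By \<open>0^0 = 1\<close> the value at zero is the constant term.\<close>
  have d0: "d 0 = \<zero>\<^bsub>R\<^esub>"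
  proof -
    have "(\<Oplus>\<^bsub>UP R\<^esub>i\<in>{..deg R d}. UPC R (d i) \<otimes>\<^bsub>UP R\<^esub> \<zero>\<^bsub>UP R\<^esub> [^]\<^bsub>UP R\<^esub> i) =
      (\<Oplus>\<^bsub>UP R\<^esub>i\<in>{..deg R d}. if 0 = i then UPC R (d i) else \<zero>\<^bsub>UP R\<^esub>)"
      using dc by (intro C.S.finsum_cong') (auto simp: C.S.nat_pow_zero)
    also have "\<dots> = UPC R (d 0)"
      using dc by (intro C.S.finsum_singleton) auto
    finally have "UPC R (d 0) = \<zero>\<^bsub>UP R\<^esub>" using ev assms(5) by simp
    then have "UPC R (d 0) 0 = \<zero>\<^bsub>R\<^esub>" by (simp add: UP_zero_fun)
    then show ?thesis using dc by (simp add: UPC_def UP_def)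
  qed
  have "UPC R (d i) \<otimes>\<^bsub>UP R\<^esub> (UPC R u \<otimes>\<^bsub>UP R\<^esub> UPX R) [^]\<^bsub>UP R\<^esub> i = \<zero>\<^bsub>UP R\<^esub>" for i
  proof (cases i)
    case 0
    then show ?thesis using d0 by simp
  next
    case (Suc j)
    let ?w = "(UPC R u \<otimes>\<^bsub>UP R\<^esub> UPX R) [^]\<^bsub>UP R\<^esub> j"
    have w: "?w \<in> carrier (UP R)" "UPX R \<in> carrier (UP R)" using assms(1,3) by auto
    have "UPC R (d i) \<otimes>\<^bsub>UP R\<^esub> (UPC R u \<otimes>\<^bsub>UP R\<^esub> UPX R) [^]\<^bsub>UP R\<^esub> i =
      UPC R (d i) \<otimes>\<^bsub>UP R\<^esub> (?w \<otimes>\<^bsub>UP R\<^esub> (UPC R u \<otimes>\<^bsub>UP R\<^esub> UPX R))"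
      by (simp add: Suc)
    \<comment> \<open>One of the \<open>i > 0\<close> factors \<open>uX\<close> gives up its
      \<open>u\<close>, which kills the coefficient.\<close>
    also have "\<dots> = (UPC R u \<otimes>\<^bsub>UP R\<^esub> UPC R (d i)) \<otimes>\<^bsub>UP R\<^esub> (?w \<otimes>\<^bsub>UP R\<^esub> UPX R)"
      using w dc assms(3) by (simp only: C.S.m_ac C.S.m_closed C.hom_closed)
    also have "UPC R u \<otimes>\<^bsub>UP R\<^esub> UPC R (d i) = \<zero>\<^bsub>UP R\<^esub>"
      using ud[of i] dc assms(3) C.hom_mult[of u "d i"] C.hom_zero by metis
    finally show ?thesis using w by simp
  qed
  then show ?thesis by (simp add: ev)
qed

text \<open>Zorn's lemma for the ideals above \<open>I\<close> that avoid \<open>\<one>\<close>; the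
  union of a nonempty chain of such ideals is again one.\<close>

lemma (in cring) ideal_in_maximalideal:
  assumes "ideal I R" "\<one> \<notin> I"
  shows "\<exists>\<mm>. maximalideal \<mm> R \<and> I \<subseteq> \<mm>"
proof -
  let ?A = "{J. ideal J R \<and> I \<subseteq> J \<and> \<one> \<notin> J}"
  have "\<exists>\<mm>\<in>?A. \<forall>X\<in>?A. \<mm> \<subseteq> X \<longrightarrow> X = \<mm>"
  proof (rule subset_Zorn_nonempty)
    show "?A \<noteq> {}" using assms by blast
    fix C assume C: "C \<noteq> {}" "subset.chain ?A C"
    then have "subset.chain {J. ideal J R} C" unfolding subset.chain_def by blast
    from chain_Union_is_ideal[OF this] have "ideal (\<Union>C) R" using C(1) by simp
    moreover have "I \<subseteq> \<Union>C" "\<one> \<notin> \<Union>C" using C unfolding subset.chain_def by blast+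
    ultimately show "\<Union>C \<in> ?A" by blast
  qed
  then obtain \<mm> where mA: "\<mm> \<in> ?A" and max: "\<forall>X\<in>?A. \<mm> \<subseteq> X \<longrightarrow> X = \<mm>" by (elim bexE)
  from mA have m: "ideal \<mm> R" "I \<subseteq> \<mm>" "\<one> \<notin> \<mm>" by simp_all
  have "maximalideal \<mm> R"
  proof (rule maximalidealI[OF m(1)])
    show "carrier R \<noteq> \<mm>" using m(3) by blast
    fix J assume J: "ideal J R" "\<mm> \<subseteq> J" "J \<subseteq> carrier R"
    show "J = \<mm> \<or> J = carrier R"
    proof (cases "\<one> \<in> J")
      case True
      then show ?thesis using ideal.one_imp_carrier[OF J(1)] by blast
    next
      case False
      then have "J \<in> ?A" using J(1,2) m(2) by simp
      then show ?thesis using max J(2) by simp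
    qed
  qed
  with m(2) show ?thesis by blast
qed

lemma map_mat_comp: "map_mat f (map_mat g A) = map_mat (\<lambda>x. f (g x)) A"
  by (rule eq_matI) simp_all

lemma map_mat_cong_carrier:
  assumes "A \<in> mats S m" "\<And>x. x \<in> carrier S \<Longrightarrow> f x = g x"
  shows "map_mat f A = map_mat g A"
  by (rule eq_matI) (use assms in auto)

section \<open>The local-global principle\<close>

text \<open>The substitution \<open>X \<mapsto> X + tZ\<close>, a homomorphism from
  \<open>R[X]\<close> to \<open>R[X][Z]\<close>.\<close>

definition shift :: "('a, 'b) ring_scheme \<Rightarrow> 'a \<Rightarrow> (nat \<Rightarrow> 'a) \<Rightarrow> nat \<Rightarrow> nat \<Rightarrow> 'a" where
  "shift R t = UnivPoly.eval R (UP2 R) (\<lambda>r. UPC (UP R) (UPC R r))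
     (UPC (UP R) (UPX R) \<oplus>\<^bsub>UP2 R\<^esub> UPC (UP R) (UPC R t) \<otimes>\<^bsub>UP2 R\<^esub> UPX (UP R))"

lemma UPCC_hom:
  assumes "cring R"
  shows "ring_hom_cring R (UP2 R) (\<lambda>r. UPC (UP R) (UPC R r))"
  by (rule ring_hom_cring_comp[OF UPC_hom[OF assms] UPC_hom[OF UP_cring_cring[OF assms]]])

lemma UP2_closed:
  assumes "cring R"
  shows "UPX (UP R) \<in> carrier (UP2 R)" "UPC (UP R) (UPX R) \<in> carrier (UP2 R)"
    "r \<in> carrier R \<Longrightarrow> UPC (UP R) (UPC R r) \<in> carrier (UP2 R)"
proof -
  interpret C: ring_hom_cring R "UP R" "UPC R" by (rule UPC_hom[OF assms])
  interpret D: ring_hom_cring "UP R" "UP2 R" "UPC (UP R)" by (rule UPC_hom[OF C.S.is_cring])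
  show "UPX (UP R) \<in> carrier (UP2 R)" "UPC (UP R) (UPX R) \<in> carrier (UP2 R)"
    "r \<in> carrier R \<Longrightarrow> UPC (UP R) (UPC R r) \<in> carrier (UP2 R)"
    using UPX_closed[OF assms] UPX_closed[OF C.S.is_cring] by simp_all
qed

lemma shift_hom:
  assumes "cring R" "t \<in> carrier R"
  shows "ring_hom_cring (UP R) (UP2 R) (shift R t)"
    and "r \<in> carrier R \<Longrightarrow> shift R t (UPC R r) = UPC (UP R) (UPC R r)"
    and "shift R t (UPX R) =
      UPC (UP R) (UPX R) \<oplus>\<^bsub>UP2 R\<^esub> UPC (UP R) (UPC R t) \<otimes>\<^bsub>UP2 R\<^esub> UPX (UP R)"
proof -
  interpret B: cring "UP2 R" by (intro UP_cring_cring assms)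
  have "UPC (UP R) (UPX R) \<oplus>\<^bsub>UP2 R\<^esub> UPC (UP R) (UPC R t) \<otimes>\<^bsub>UP2 R\<^esub> UPX (UP R) \<in> carrier (UP2 R)"
    using UP2_closed[OF assms(1)] assms(2) by simp
  note e = eval_hom[OF UPCC_hom[OF assms(1)] this]
  show "ring_hom_cring (UP R) (UP2 R) (shift R t)"
    and "r \<in> carrier R \<Longrightarrow> shift R t (UPC R r) = UPC (UP R) (UPC R r)"
    and "shift R t (UPX R) =
      UPC (UP R) (UPX R) \<oplus>\<^bsub>UP2 R\<^esub> UPC (UP R) (UPC R t) \<otimes>\<^bsub>UP2 R\<^esub> UPX (UP R)"
    unfolding shift_def by (rule e, assumption?)+
qed

text \<open>Homomorphisms on \<open>R[X]\<close> are determined by constants and \<open>X\<close>.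
  The identities below that follow a shift by another substitution are checked through this
  criterion.\<close>

lemma shift_comp:
  assumes "cring R" "t \<in> carrier R" "ring_hom_cring (UP2 R) S \<tau>" "ring_hom_cring (UP R) S g"
    and "\<And>r. r \<in> carrier R \<Longrightarrow> \<tau> (UPC (UP R) (UPC R r)) = g (UPC R r)"
    and "\<tau> (UPC (UP R) (UPX R)) \<oplus>\<^bsub>S\<^esub> \<tau> (UPC (UP R) (UPC R t)) \<otimes>\<^bsub>S\<^esub> \<tau> (UPX (UP R)) = g (UPX R)"
    and "p \<in> carrier (UP R)"
  shows "\<tau> (shift R t p) = g p"
proof -
  interpret \<tau>: ring_hom_cring "UP2 R" S \<tau> by fact
  have "\<tau> (shift R t (UPX R)) = g (UPX R)"
    using shift_hom(3)[OF assms(1,2)] UP2_closed[OF assms(1)] assms(2,6) by simp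
  then show ?thesis
    using UP_hom_ext[OF ring_hom_cring_comp[OF shift_hom(1)[OF assms(1,2)] assms(3)] assms(4) assms(1) _ _ assms(7)]
      shift_hom(2)[OF assms(1,2)] assms(5) by simp
qed

context localization_hom
begin

abbreviation (input) "h1 \<equiv> coeff_map h"
abbreviation (input) "h2 \<equiv> coeff_map (coeff_map h)"

lemma localization_hom_UP2:
  "localization_hom (UP2 R) (UP2 S) h2 (UPC (UP R) ` UPC R ` M)"
  by (rule localization_hom.localization_hom_UP[OF localization_hom_UP])

lemma h2_values:
  shows "p \<in> carrier (UP R) \<Longrightarrow> h2 (UPC (UP R) p) = UPC (UP S) (h1 p)"
    and "r \<in> carrier R \<Longrightarrow> h1 (UPC R r) = UPC S (h r)"
    and "h1 (UPX R) = UPX S" and "h2 (UPX (UP R)) = UPX (UP S)"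
  using coeff_map_hom[OF ring_hom_cring_axioms]
    coeff_map_hom[OF coeff_map_hom(1)[OF ring_hom_cring_axioms]] by blast+

text \<open>The difference \<open>f(X + t'Z) - f(X)\<close> is divisible by \<open>t'\<close>, and a
  suitable \<open>t\<close> makes up for the denominators of \<open>f\<close> as well. Claiming this
  for all multiples \<open>t'\<close> of \<open>t\<close> lets the bounds of two summands or factors
  be met together by their product.\<close>

lemma shift_close:
  assumes "f \<in> carrier (UP S)" "s \<in> UPC (UP R) ` UPC R ` M"
  shows "\<exists>t\<in>M. \<forall>t'\<in>M. (\<exists>r\<in>carrier R. t' = t \<otimes> r) \<longrightarrow>
    (\<exists>b\<in>carrier (UP2 R). shift S (h t') f = UPC (UP S) f \<oplus>\<^bsub>UP2 S\<^esub> h2 (s \<otimes>\<^bsub>UP2 R\<^esub> b))"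
  using S.is_cring assms
proof (induction arbitrary: s rule: UP_induct)
  interpret L2: localization_hom "UP2 R" "UP2 S" h2 "UPC (UP R) ` UPC R ` M"
    by (rule localization_hom_UP2)
  interpret C: ring_hom_cring "UP S" "UP2 S" "UPC (UP S)"
    by (rule UPC_hom[OF UP_cring_cring[OF S.is_cring]])
  {
    case (const r)
    have "shift S (h t') (UPC S r) = UPC (UP S) (UPC S r) \<oplus>\<^bsub>UP2 S\<^esub> h2 (s \<otimes>\<^bsub>UP2 R\<^esub> \<zero>\<^bsub>UP2 R\<^esub>)"
      if "t' \<in> M" for t'
      using that const shift_hom(2)[OF S.is_cring, of "h t'" r] UP2_closed(3)[OF S.is_cring, of r] by simp
    then show ?case by blast
  next
    case X
    then obtain u where u: "u \<in> M" "s = UPC (UP R) (UPC R u)" by blast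
    have "\<exists>b\<in>carrier (UP2 R). shift S (h t') (UPX S) =
        UPC (UP S) (UPX S) \<oplus>\<^bsub>UP2 S\<^esub> h2 (s \<otimes>\<^bsub>UP2 R\<^esub> b)"
      if t': "t' \<in> M" "r \<in> carrier R" "t' = u \<otimes> r" for t' r
    proof
      interpret C0: ring_hom_cring R "UP R" "UPC R" by (rule UPC_hom[OF R.is_cring])
      interpret D: ring_hom_cring R "UP2 R" "\<lambda>r. UPC (UP R) (UPC R r)" by (rule UPCC_hom[OF R.is_cring])
      \<comment> \<open>\<open>s\<close> is the constant \<open>u\<close> and
        \<open>t' = u r\<close>, so \<open>t' Z = s (r Z)\<close>.\<close>
      let ?b = "UPC (UP R) (UPC R r) \<otimes>\<^bsub>UP2 R\<^esub> UPX (UP R)"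
      have c: "UPX (UP R) \<in> carrier (UP2 R)" "UPC R t' \<in> carrier (UP R)"
        using UP2_closed[OF R.is_cring] C0.hom_closed[of t'] t'(1) by auto
      show "?b \<in> carrier (UP2 R)" using c D.hom_closed[OF t'(2)] by simp
      have "s \<otimes>\<^bsub>UP2 R\<^esub> ?b = UPC (UP R) (UPC R t') \<otimes>\<^bsub>UP2 R\<^esub> UPX (UP R)"
        using L2.R.m_assoc[OF D.hom_closed[OF M_carrier[OF u(1)]] D.hom_closed[OF t'(2)] c(1)]
          D.hom_mult[OF M_carrier[OF u(1)] t'(2)] by (simp only: u(2) t'(3))
      moreover have "h2 (UPC (UP R) (UPC R t')) = UPC (UP S) (UPC S (h t'))"
        using h2_values(1)[OF c(2)] h2_values(2)[of t'] t'(1) by simp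
      moreover have "UPC (UP R) (UPC R t') \<in> carrier (UP2 R)" using t'(1) D.hom_closed[of t'] by simp
      ultimately have "h2 (s \<otimes>\<^bsub>UP2 R\<^esub> ?b) = UPC (UP S) (UPC S (h t')) \<otimes>\<^bsub>UP2 S\<^esub> UPX (UP S)"
        using c h2_values(4) by simp
      then show "shift S (h t') (UPX S) = UPC (UP S) (UPX S) \<oplus>\<^bsub>UP2 S\<^esub> h2 (s \<otimes>\<^bsub>UP2 R\<^esub> ?b)"
        using shift_hom(3)[OF S.is_cring, of "h t'"] t'(1) by simp
    qed
    then show ?case using u(1) by blast
  next
    case (add f g)
    obtain t1 where t1: "t1 \<in> M" "\<And>t' r. t' \<in> M \<Longrightarrow> r \<in> carrier R \<Longrightarrow> t' = t1 \<otimes> r \<Longrightarrow>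
      \<exists>b\<in>carrier (UP2 R). shift S (h t') f = UPC (UP S) f \<oplus>\<^bsub>UP2 S\<^esub> h2 (s \<otimes>\<^bsub>UP2 R\<^esub> b)"
      using add.IH(1)[OF add.prems] by blast
    obtain t2 where t2: "t2 \<in> M" "\<And>t' r. t' \<in> M \<Longrightarrow> r \<in> carrier R \<Longrightarrow> t' = t2 \<otimes> r \<Longrightarrow>
      \<exists>b\<in>carrier (UP2 R). shift S (h t') g = UPC (UP S) g \<oplus>\<^bsub>UP2 S\<^esub> h2 (s \<otimes>\<^bsub>UP2 R\<^esub> b)"
      using add.IH(2)[OF add.prems] by blast
    have "\<exists>b\<in>carrier (UP2 R). shift S (h t') (f \<oplus>\<^bsub>UP S\<^esub> g) =
        UPC (UP S) (f \<oplus>\<^bsub>UP S\<^esub> g) \<oplus>\<^bsub>UP2 S\<^esub> h2 (s \<otimes>\<^bsub>UP2 R\<^esub> b)"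
      if t': "t' \<in> M" "r \<in> carrier R" "t' = t1 \<otimes> t2 \<otimes> r" for t' r
    proof -
      interpret H: ring_hom_cring "UP S" "UP2 S" "shift S (h t')"
        using t'(1) by (intro shift_hom(1)[OF S.is_cring]) simp
      have "t' = t1 \<otimes> (t2 \<otimes> r)" "t' = t2 \<otimes> (t1 \<otimes> r)" using t'(2,3) t1(1) t2(1) by (simp_all add: R.m_ac)
      then obtain b c where b: "b \<in> carrier (UP2 R)" "shift S (h t') f = UPC (UP S) f \<oplus>\<^bsub>UP2 S\<^esub> h2 (s \<otimes>\<^bsub>UP2 R\<^esub> b)"
        and c: "c \<in> carrier (UP2 R)" "shift S (h t') g = UPC (UP S) g \<oplus>\<^bsub>UP2 S\<^esub> h2 (s \<otimes>\<^bsub>UP2 R\<^esub> c)"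
        using t1(2)[OF t'(1), of "t2 \<otimes> r"] t2(2)[OF t'(1), of "t1 \<otimes> r"] t1(1) t2(1) t'(2) by auto
      have s: "s \<in> carrier (UP2 R)" using add.prems by (rule L2.M_carrier)
      have "shift S (h t') (f \<oplus>\<^bsub>UP S\<^esub> g) = UPC (UP S) (f \<oplus>\<^bsub>UP S\<^esub> g) \<oplus>\<^bsub>UP2 S\<^esub> h2 (s \<otimes>\<^bsub>UP2 R\<^esub> (b \<oplus>\<^bsub>UP2 R\<^esub> c))"
        using b c s add.hyps by (simp add: L2.S.r_distr L2.S.a_ac)
      then show ?thesis using b(1) c(1) by blast
    qed
    then show ?case using t1(1) t2(1) by blast
  next
    case (mult f g)
    have fg: "UPC (UP S) f \<in> carrier (UP2 S)" "UPC (UP S) g \<in> carrier (UP2 S)" using mult.hyps by simp_all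
    \<comment> \<open>The cross terms of the product contain \<open>f\<close> and \<open>g\<close>
      themselves, which lose their denominators only after multiplication by \<open>v\<close> and
      \<open>u\<close>. Hence \<open>f\<close> is treated for \<open>s u\<close> and
      \<open>g\<close> for \<open>s v\<close>.\<close>
    obtain u g0 where u: "u \<in> UPC (UP R) ` UPC R ` M" "g0 \<in> carrier (UP2 R)"
      "h2 u \<otimes>\<^bsub>UP2 S\<^esub> UPC (UP S) g = h2 g0" using L2.denominator[OF fg(2)] by blast
    obtain v f0 where v: "v \<in> UPC (UP R) ` UPC R ` M" "f0 \<in> carrier (UP2 R)"
      "h2 v \<otimes>\<^bsub>UP2 S\<^esub> UPC (UP S) f = h2 f0" using L2.denominator[OF fg(1)] by blast
    have s: "s \<in> carrier (UP2 R)" "u \<in> carrier (UP2 R)" "v \<in> carrier (UP2 R)"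
      using mult.prems u(1) v(1) L2.M_carrier by blast+
    obtain t1 where t1: "t1 \<in> M" "\<And>t' r. t' \<in> M \<Longrightarrow> r \<in> carrier R \<Longrightarrow> t' = t1 \<otimes> r \<Longrightarrow>
      \<exists>b\<in>carrier (UP2 R). shift S (h t') f = UPC (UP S) f \<oplus>\<^bsub>UP2 S\<^esub> h2 (s \<otimes>\<^bsub>UP2 R\<^esub> u \<otimes>\<^bsub>UP2 R\<^esub> b)"
      using mult.IH(1)[OF L2.M_mult[OF mult.prems u(1)]] by blast
    obtain t2 where t2: "t2 \<in> M" "\<And>t' r. t' \<in> M \<Longrightarrow> r \<in> carrier R \<Longrightarrow> t' = t2 \<otimes> r \<Longrightarrow>
      \<exists>b\<in>carrier (UP2 R). shift S (h t') g = UPC (UP S) g \<oplus>\<^bsub>UP2 S\<^esub> h2 (s \<otimes>\<^bsub>UP2 R\<^esub> v \<otimes>\<^bsub>UP2 R\<^esub> b)"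
      using mult.IH(2)[OF L2.M_mult[OF mult.prems v(1)]] by blast
    have "\<exists>b\<in>carrier (UP2 R). shift S (h t') (f \<otimes>\<^bsub>UP S\<^esub> g) =
        UPC (UP S) (f \<otimes>\<^bsub>UP S\<^esub> g) \<oplus>\<^bsub>UP2 S\<^esub> h2 (s \<otimes>\<^bsub>UP2 R\<^esub> b)"
      if t': "t' \<in> M" "r \<in> carrier R" "t' = t1 \<otimes> t2 \<otimes> r" for t' r
    proof -
      interpret H: ring_hom_cring "UP S" "UP2 S" "shift S (h t')"
        using t'(1) by (intro shift_hom(1)[OF S.is_cring]) simp
      have "t' = t1 \<otimes> (t2 \<otimes> r)" "t' = t2 \<otimes> (t1 \<otimes> r)" using t'(2,3) t1(1) t2(1) by (simp_all add: R.m_ac)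
      then obtain b c where b: "b \<in> carrier (UP2 R)"
        "shift S (h t') f = UPC (UP S) f \<oplus>\<^bsub>UP2 S\<^esub> h2 (s \<otimes>\<^bsub>UP2 R\<^esub> u \<otimes>\<^bsub>UP2 R\<^esub> b)"
        and c: "c \<in> carrier (UP2 R)"
        "shift S (h t') g = UPC (UP S) g \<oplus>\<^bsub>UP2 S\<^esub> h2 (s \<otimes>\<^bsub>UP2 R\<^esub> v \<otimes>\<^bsub>UP2 R\<^esub> c)"
        using t1(2)[OF t'(1), of "t2 \<otimes> r"] t2(2)[OF t'(1), of "t1 \<otimes> r"] t1(1) t2(1) t'(2) by auto
      \<comment> \<open>The cofactor of \<open>s\<close> in
        \<open>(f + s u b)(g + s v c) - f g\<close>, with \<open>u g\<close> and \<open>v f\<close>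
        replaced by the preimages \<open>g0\<close> and \<open>f0\<close>.\<close>
      let ?d = "b \<otimes>\<^bsub>UP2 R\<^esub> g0 \<oplus>\<^bsub>UP2 R\<^esub> f0 \<otimes>\<^bsub>UP2 R\<^esub> c \<oplus>\<^bsub>UP2 R\<^esub>
        u \<otimes>\<^bsub>UP2 R\<^esub> b \<otimes>\<^bsub>UP2 R\<^esub> (s \<otimes>\<^bsub>UP2 R\<^esub> v \<otimes>\<^bsub>UP2 R\<^esub> c)"
      have alg: "(F \<oplus>\<^bsub>UP2 S\<^esub> (s' \<otimes>\<^bsub>UP2 S\<^esub> u') \<otimes>\<^bsub>UP2 S\<^esub> b') \<otimes>\<^bsub>UP2 S\<^esub>
          (G \<oplus>\<^bsub>UP2 S\<^esub> (s' \<otimes>\<^bsub>UP2 S\<^esub> v') \<otimes>\<^bsub>UP2 S\<^esub> c') =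
        F \<otimes>\<^bsub>UP2 S\<^esub> G \<oplus>\<^bsub>UP2 S\<^esub> s' \<otimes>\<^bsub>UP2 S\<^esub> (b' \<otimes>\<^bsub>UP2 S\<^esub> (u' \<otimes>\<^bsub>UP2 S\<^esub> G) \<oplus>\<^bsub>UP2 S\<^esub>
          (v' \<otimes>\<^bsub>UP2 S\<^esub> F) \<otimes>\<^bsub>UP2 S\<^esub> c' \<oplus>\<^bsub>UP2 S\<^esub>
          u' \<otimes>\<^bsub>UP2 S\<^esub> b' \<otimes>\<^bsub>UP2 S\<^esub> (s' \<otimes>\<^bsub>UP2 S\<^esub> v' \<otimes>\<^bsub>UP2 S\<^esub> c'))"
        if "F \<in> carrier (UP2 S)" "G \<in> carrier (UP2 S)" "s' \<in> carrier (UP2 S)" "u' \<in> carrier (UP2 S)"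
          "v' \<in> carrier (UP2 S)" "b' \<in> carrier (UP2 S)" "c' \<in> carrier (UP2 S)" for F G s' u' v' b' c'
        using that by (simp add: L2.S.l_distr L2.S.r_distr L2.S.m_ac L2.S.a_ac)
      have "shift S (h t') (f \<otimes>\<^bsub>UP S\<^esub> g) = UPC (UP S) (f \<otimes>\<^bsub>UP S\<^esub> g) \<oplus>\<^bsub>UP2 S\<^esub> h2 (s \<otimes>\<^bsub>UP2 R\<^esub> ?d)"
        using alg[OF fg, of "h2 s" "h2 u" "h2 v" "h2 b" "h2 c"] b c s u(2) v(2) mult.hyps
        unfolding u(3) v(3) by simp
      moreover have "?d \<in> carrier (UP2 R)" using b(1) c(1) s u(2) v(2) by simp
      ultimately show ?thesis by blast
    qed
    then show ?case using t1(1) t2(1) by blast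
  }
qed

end

abbreviation subst_Z :: "('a, 'b) ring_scheme \<Rightarrow> (nat \<Rightarrow> nat \<Rightarrow> 'a) \<Rightarrow> (nat \<Rightarrow> nat \<Rightarrow> 'a) \<Rightarrow> nat \<Rightarrow> nat \<Rightarrow> 'a" where
  "subst_Z R z \<equiv> UnivPoly.eval (UP R) (UP2 R) (UPC (UP R)) z"

lemma subst_Z_hom:
  assumes "cring R" "z \<in> carrier (UP2 R)"
  shows "ring_hom_cring (UP2 R) (UP2 R) (subst_Z R z)"
    and "p \<in> carrier (UP R) \<Longrightarrow> subst_Z R z (UPC (UP R) p) = UPC (UP R) p"
    and "subst_Z R z (UPX (UP R)) = z"
  using eval_hom[OF UPC_hom[OF UP_cring_cring[OF assms(1)]] assms(2)] by blast+

lemma subst_Z_shift: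
  assumes "cring R" "t \<in> carrier R" "u \<in> carrier R" "p \<in> carrier (UP R)"
  shows "subst_Z R (UPC (UP R) (UPC R u) \<otimes>\<^bsub>UP2 R\<^esub> UPX (UP R)) (shift R t p) = shift R (t \<otimes>\<^bsub>R\<^esub> u) p"
proof -
  interpret R: cring R by fact
  interpret B: cring "UP2 R" by (intro UP_cring_cring assms)
  interpret C: ring_hom_cring R "UP R" "UPC R" by (rule UPC_hom[OF assms(1)])
  interpret D: ring_hom_cring R "UP2 R" "\<lambda>r. UPC (UP R) (UPC R r)" by (rule UPCC_hom[OF assms(1)])
  let ?z = "UPC (UP R) (UPC R u) \<otimes>\<^bsub>UP2 R\<^esub> UPX (UP R)"
  have z: "?z \<in> carrier (UP2 R)" using UP2_closed[OF assms(1)] assms(3) by simp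
  have tu: "t \<otimes>\<^bsub>R\<^esub> u \<in> carrier R" using assms by simp
  note s = subst_Z_hom[OF assms(1) z]
  show ?thesis
  proof (rule shift_comp[OF assms(1,2) s(1) shift_hom(1)[OF assms(1) tu] _ _ assms(4)])
    show "subst_Z R ?z (UPC (UP R) (UPC R r)) = shift R (t \<otimes>\<^bsub>R\<^esub> u) (UPC R r)" if "r \<in> carrier R" for r
      using s(2)[of "UPC R r"] shift_hom(2)[OF assms(1) tu that] that by simp
    have "UPC (UP R) (UPC R t) \<otimes>\<^bsub>UP2 R\<^esub> ?z = UPC (UP R) (UPC R (t \<otimes>\<^bsub>R\<^esub> u)) \<otimes>\<^bsub>UP2 R\<^esub> UPX (UP R)"
      using B.m_assoc[OF D.hom_closed[OF assms(2)] D.hom_closed[OF assms(3)] UP2_closed(1)[OF assms(1)]]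
        D.hom_mult[OF assms(2,3)] by (simp only:)
    then show "subst_Z R ?z (UPC (UP R) (UPX R)) \<oplus>\<^bsub>UP2 R\<^esub>
      subst_Z R ?z (UPC (UP R) (UPC R t)) \<otimes>\<^bsub>UP2 R\<^esub> subst_Z R ?z (UPX (UP R)) = shift R (t \<otimes>\<^bsub>R\<^esub> u) (UPX R)"
      using s(2)[OF UPX_closed[OF assms(1)]] s(2)[OF C.hom_closed[OF assms(2)]] s(3) shift_hom(3)[OF assms(1) tu]
      by (simp only:)
  qed
qed

lemma subst_Z_zero_shift:
  assumes "cring R" "t \<in> carrier R" "p \<in> carrier (UP R)"
  shows "subst_Z R \<zero>\<^bsub>UP2 R\<^esub> (shift R t p) = UPC (UP R) p"
proof -
  interpret B: cring "UP2 R" by (intro UP_cring_cring assms)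
  interpret C: ring_hom_cring R "UP R" "UPC R" by (rule UPC_hom[OF assms(1)])
  note s = subst_Z_hom[OF assms(1) B.zero_closed]
  note cl = UP2_closed[OF assms(1)]
  show ?thesis
    by (rule shift_comp[OF assms(1,2) s(1) UPC_hom[OF C.S.is_cring] _ _ assms(3)])
      (simp_all add: s C.hom_closed UPX_closed assms cl)
qed

lemma subst_Z_zero_idem:
  assumes "cring R" "x \<in> carrier (UP2 R)"
  shows "subst_Z R \<zero>\<^bsub>UP2 R\<^esub> (subst_Z R \<zero>\<^bsub>UP2 R\<^esub> x) = subst_Z R \<zero>\<^bsub>UP2 R\<^esub> x"
proof -
  interpret B: cring "UP2 R" by (intro UP_cring_cring assms)
  note s = subst_Z_hom[OF assms(1) B.zero_closed]
  interpret Z: ring_hom_cring "UP2 R" "UP2 R" "subst_Z R \<zero>\<^bsub>UP2 R\<^esub>" by (rule s(1))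
  show ?thesis
    by (rule UP_hom_ext[OF ring_hom_cring_comp[OF s(1) s(1)] s(1) UP_cring_cring[OF assms(1)] _ _ assms(2)])
      (simp_all add: s)
qed

lemma (in localization_hom) finite_annihilator:
  assumes "finite A" "A \<subseteq> carrier R" "\<And>x. x \<in> A \<Longrightarrow> h x = \<zero>\<^bsub>S\<^esub>"
  shows "\<exists>u\<in>M. \<forall>x\<in>A. u \<otimes> x = \<zero>"
  using assms
proof (induction A)
  case empty
  then show ?case by blast
next
  case (insert a A)
  then obtain u where u: "u \<in> M" "\<And>x. x \<in> A \<Longrightarrow> u \<otimes> x = \<zero>" by blast
  obtain v where v: "v \<in> M" "v \<otimes> a = \<zero>" using annihilator[of a] insert.prems by blast
  have "u \<otimes> v \<otimes> x = \<zero>" if x: "x \<in> insert a A" for x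
  proof (cases "x = a")
    case True
    then show ?thesis using u(1) v insert.prems by (simp add: R.m_assoc)
  next
    case False
    then have xA: "x \<in> A" "x \<in> carrier R" using x insert.prems by auto
    then have "u \<otimes> v \<otimes> x = v \<otimes> (u \<otimes> x)" using u(1) v(1) by (simp add: R.m_ac)
    then show ?thesis using u(2)[OF xA(1)] v(1) by simp
  qed
  then show ?case using u(1) v(1) by blast
qed

context localization_hom
begin

lemma h2_shift:
  assumes "t \<in> carrier R" "p \<in> carrier (UP R)"
  shows "h2 (shift R t p) = shift S (h t) (h1 p)"
proof -
  interpret C: ring_hom_cring R "UP R" "UPC R" by (rule UPC_hom[OF R.is_cring])
  have ht: "h t \<in> carrier S" using assms(1) by simp
  note c1 = coeff_map_hom(1)[OF ring_hom_cring_axioms]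
  show ?thesis
  proof (rule shift_comp[OF R.is_cring assms(1) coeff_map_hom(1)[OF c1]
        ring_hom_cring_comp[OF c1 shift_hom(1)[OF S.is_cring ht]] _ _ assms(2)])
    show "h2 (UPC (UP R) (UPC R r)) = shift S (h t) (h1 (UPC R r))" if "r \<in> carrier R" for r
      using that h2_values(1)[OF C.hom_closed[OF that]] h2_values(2)[OF that]
        shift_hom(2)[OF S.is_cring ht hom_closed[OF that]] by (simp only:)
    show "h2 (UPC (UP R) (UPX R)) \<oplus>\<^bsub>UP2 S\<^esub> h2 (UPC (UP R) (UPC R t)) \<otimes>\<^bsub>UP2 S\<^esub> h2 (UPX (UP R)) =
      shift S (h t) (h1 (UPX R))"
      using h2_values(1)[OF C.hom_closed[OF assms(1)]] h2_values(1)[OF UPX_closed[OF R.is_cring]] h2_values(2)[OF assms(1)]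
        h2_values(3,4) shift_hom(3)[OF S.is_cring ht] by (simp only:)
  qed
qed

lemma h2_subst_Z_zero:
  assumes "x \<in> carrier (UP2 R)"
  shows "h2 (subst_Z R \<zero>\<^bsub>UP2 R\<^esub> x) = subst_Z S \<zero>\<^bsub>UP2 S\<^esub> (h2 x)"
proof -
  interpret H1: ring_hom_cring "UP R" "UP S" h1 by (rule coeff_map_hom(1)[OF ring_hom_cring_axioms])
  interpret H2: ring_hom_cring "UP2 R" "UP2 S" h2
    by (rule coeff_map_hom(1)[OF coeff_map_hom(1)[OF ring_hom_cring_axioms]])
  note r = subst_Z_hom[OF R.is_cring H2.R.zero_closed] and s = subst_Z_hom[OF S.is_cring H2.S.zero_closed]
  show ?thesis
    by (rule UP_hom_ext[OF ring_hom_cring_comp[OF r(1) H2.ring_hom_cring_axioms]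
          ring_hom_cring_comp[OF H2.ring_hom_cring_axioms s(1)] H1.R.is_cring _ _ assms])
      (simp_all add: r s h2_values)
qed

text \<open>The factor \<open>k\<close> between the two matrices over \<open>B'\<close> is lifted to
  \<open>B\<close> and corrected at \<open>Z = 0\<close>. The remaining error has image zero and
  value zero at \<open>Z = 0\<close>, so \<open>eval_killed\<close> removes it after rescaling
  \<open>Z\<close>.\<close>

lemma local_shift:
  assumes two: "\<one> \<oplus> \<one> \<in> Units R" and n: "n \<ge> 2" and \<alpha>: "\<alpha> \<in> mats (UP R) (2 * n)"
    and W: "map_mat h1 \<alpha> \<in> elem_words (UP S) n"
  shows "\<exists>t\<in>M. \<exists>\<beta>\<in>elem_words (UP2 R) n.
    map_mat (shift R t) \<alpha> = matrix_mult (UP2 R) \<beta> (map_mat (UPC (UP R)) \<alpha>)"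
proof -
  interpret L2: localization_hom "UP2 R" "UP2 S" h2 "UPC (UP R) ` UPC R ` M"
    by (rule localization_hom_UP2)
  interpret H1: ring_hom_cring "UP R" "UP S" h1 by (rule coeff_map_hom(1)[OF ring_hom_cring_axioms])
  interpret C: ring_hom_cring "UP R" "UP2 R" "UPC (UP R)" by (rule UPC_hom[OF H1.R.is_cring])
  interpret CS: ring_hom_cring "UP S" "UP2 S" "UPC (UP S)" by (rule UPC_hom[OF H1.S.is_cring])
  interpret D: ring_hom_cring R "UP2 R" "\<lambda>r. UPC (UP R) (UPC R r)" by (rule UPCC_hom[OF R.is_cring])
  interpret Z: ring_hom_cring "UP2 R" "UP2 R" "subst_Z R \<zero>\<^bsub>UP2 R\<^esub>"
    by (rule subst_Z_hom(1)[OF R.is_cring L2.R.zero_closed])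
  interpret ZS: ring_hom_cring "UP2 S" "UP2 S" "subst_Z S \<zero>\<^bsub>UP2 S\<^esub>"
    by (rule subst_Z_hom(1)[OF S.is_cring L2.S.zero_closed])
  let ?B = "UP2 R" and ?BS = "UP2 S" and ?zev = "subst_Z R \<zero>\<^bsub>UP2 R\<^esub>"
    and ?zevS = "subst_Z S \<zero>\<^bsub>UP2 S\<^esub>"
  let ?EW = "elem_words ?B n" and ?m = "2 * n"
  note EWc = L2.R.words_closed[OF L2.R.elem_gens_closed]
  have two2: "\<one>\<^bsub>?B\<^esub> \<oplus>\<^bsub>?B\<^esub> \<one>\<^bsub>?B\<^esub> \<in> Units ?B"
  proof -
    have "UPC (UP R) (UPC R (\<one> \<oplus> \<one>)) = \<one>\<^bsub>?B\<^esub> \<oplus>\<^bsub>?B\<^esub> \<one>\<^bsub>?B\<^esub>"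
      using D.hom_add[OF R.one_closed R.one_closed] D.hom_one by (simp only:)
    then show ?thesis using D.hom_Units[OF two] by simp
  qed
  define past where "past t t' \<longleftrightarrow> t \<in> carrier R \<and> (\<exists>r\<in>carrier R. t' = t \<otimes> r)" for t t'
  \<comment> \<open>Divisibility by \<open>\<one>\<close> suffices here: the coefficients in
    \<open>k\<close> then lie in the image of \<open>h2\<close>, which is what lifting
    requires.\<close>
  have "\<exists>t\<in>M. \<forall>t'\<in>M. past t t' \<longrightarrow> (\<exists>k\<in>root_words ?BS n (L2.multiples \<one>\<^bsub>?B\<^esub>).
    map_mat (shift S (h t')) (map_mat h1 \<alpha>) = matrix_mult ?BS k (map_mat (UPC (UP S)) (map_mat h1 \<alpha>)))"
  proof (rule L2.translate_elem_words[OF two2, where T = M and A = "UP S" and \<sigma> = "\<lambda>t. shift S (h t)" and past = past])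
    show "ring_hom_cring (UP S) ?BS (shift S (h t))" if "t \<in> M" for t
      using that by (intro shift_hom(1)[OF S.is_cring]) simp
    show "ring_hom_cring (UP S) ?BS (UPC (UP S))" by (rule CS.ring_hom_cring_axioms)
    show "M \<noteq> {}" using M_one by blast
    show "\<exists>t''\<in>M. past t t'' \<and> past t' t''" if "t \<in> M" "t' \<in> M" for t t'
    proof (intro bexI conjI)
      show "past t (t \<otimes> t')" "past t' (t \<otimes> t')" using that R.m_comm[of t t'] unfolding past_def by blast+
      show "t \<otimes> t' \<in> M" using that by simp
    qed
    show "past t t''" if "past t t'" "past t' t''" for t t' t''
      using that R.m_assoc R.m_closed unfolding past_def by metis
    show "\<exists>t\<in>M. \<forall>t'\<in>M. past t t' \<longrightarrow> (\<exists>b\<in>carrier ?B. shift S (h t') f = UPC (UP S) f \<oplus>\<^bsub>?BS\<^esub> h2 (s \<otimes>\<^bsub>?B\<^esub> b))"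
      if "f \<in> carrier (UP S)" "s \<in> UPC (UP R) ` UPC R ` M" for f s
      using shift_close[OF that] unfolding past_def by blast
    show "map_mat h1 \<alpha> \<in> elem_words (UP S) n" by (rule W)
    show "\<one>\<^bsub>?B\<^esub> \<in> UPC (UP R) ` UPC R ` M" by (rule L2.M_one)
  qed
  then obtain t where t: "t \<in> M" and tk: "past t t \<longrightarrow> (\<exists>k\<in>root_words ?BS n (L2.multiples \<one>\<^bsub>?B\<^esub>).
    map_mat (shift S (h t)) (map_mat h1 \<alpha>) = matrix_mult ?BS k (map_mat (UPC (UP S)) (map_mat h1 \<alpha>)))" by blast
  have tc: "t \<in> carrier R" using t by simp
  have "past t t" unfolding past_def using tc R.r_one[OF tc] R.one_closed by metis
  with tk obtain k where k: "k \<in> root_words ?BS n (L2.multiples \<one>\<^bsub>?B\<^esub>)"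
    "map_mat (shift S (h t)) (map_mat h1 \<alpha>) = matrix_mult ?BS k (map_mat (UPC (UP S)) (map_mat h1 \<alpha>))" by blast
  have "L2.multiples \<one>\<^bsub>?B\<^esub> \<subseteq> h2 ` carrier ?B" unfolding L2.multiples_def by auto
  then have "root_gens ?BS n (L2.multiples \<one>\<^bsub>?B\<^esub>) \<subseteq> root_gens ?BS n (h2 ` carrier ?B)"
    unfolding root_gens_def by blast
  then have "k \<in> root_words ?BS n (h2 ` carrier ?B)" using words_mono k(1) by blast
  then obtain v where v: "v \<in> root_words ?B n (carrier ?B)" "map_mat h2 v = k"
    using L2.lift_root_words by blast
  have vE: "v \<in> ?EW" using v(1) L2.R.root_gens_elementary[OF two2 n] by blast
  have vc: "v \<in> mats ?B ?m" by (rule EWc[OF vE])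
  let ?E = "map_mat (shift R t) \<alpha>" and ?a = "map_mat (UPC (UP R)) \<alpha>" and ?w = "map_mat (UPC (UP S)) (map_mat h1 \<alpha>)"
  interpret sh: ring_hom_cring "UP R" ?B "shift R t" by (rule shift_hom(1)[OF R.is_cring tc])
  have Ec: "?E \<in> mats ?B ?m" and ac: "?a \<in> mats ?B ?m" using \<alpha> by auto
  have h1\<alpha>: "map_mat h1 \<alpha> \<in> mats (UP S) ?m" using \<alpha> by auto
  have wc: "?w \<in> mats ?BS ?m" using h1\<alpha> by auto
  have kc: "k \<in> mats ?BS ?m" using vc v(2) L2.map_mat_closed by blast
  have h2E: "map_mat h2 ?E = matrix_mult ?BS k ?w"
  proof -
    have "map_mat h2 ?E = map_mat (shift S (h t)) (map_mat h1 \<alpha>)"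
      unfolding map_mat_comp using h2_shift[OF tc] by (intro map_mat_cong_carrier[OF \<alpha>]) blast
    then show ?thesis using k(2) by simp
  qed
  have h2a: "map_mat h2 ?a = ?w"
    unfolding map_mat_comp using h2_values(1) by (intro map_mat_cong_carrier[OF \<alpha>]) blast
  have zE: "map_mat ?zev ?E = ?a"
    unfolding map_mat_comp using subst_Z_zero_shift[OF R.is_cring tc] by (intro map_mat_cong_carrier[OF \<alpha>]) blast
  have za: "map_mat ?zev ?a = ?a"
    unfolding map_mat_comp using subst_Z_hom(2)[OF R.is_cring L2.R.zero_closed]
    by (intro map_mat_cong_carrier[OF \<alpha>]) blast
  have zw: "map_mat ?zevS ?w = ?w"
    unfolding map_mat_comp[of ?zevS] using subst_Z_hom(2)[OF S.is_cring L2.S.zero_closed]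
    by (intro map_mat_cong_carrier[OF h1\<alpha>]) blast
  have h2z: "map_mat h2 (map_mat ?zev A) = map_mat ?zevS (map_mat h2 A)" if "A \<in> mats ?B ?m" for A
    unfolding map_mat_comp using h2_subst_Z_zero by (intro map_mat_cong_carrier[OF that]) blast
  \<comment> \<open>At \<open>Z = 0\<close> the equation becomes \<open>w = k(0) w\<close>, and
    \<open>w\<close> is a word, hence has a right inverse.\<close>
  have zk: "map_mat ?zevS k = matrix_one ?BS ?m"
  proof -
    have zkc: "map_mat ?zevS k \<in> mats ?BS ?m" using kc by (rule ZS.map_mat_closed)
    have "?w = map_mat h2 (map_mat ?zev ?E)" unfolding zE h2a ..
    also have "\<dots> = map_mat ?zevS (matrix_mult ?BS k ?w)" unfolding h2z[OF Ec] h2E ..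
    also have "\<dots> = matrix_mult ?BS (map_mat ?zevS k) ?w" using ZS.map_mat_mult[OF kc wc] zw by simp
    finally have wk: "?w = matrix_mult ?BS (map_mat ?zevS k) ?w" .
    have "?w \<in> elem_words ?BS n" using W by (rule CS.map_elem_words)
    then obtain w' where w': "w' \<in> elem_words ?BS n" "matrix_mult ?BS ?w w' = matrix_one ?BS ?m"
      using L2.S.elem_words_inverse by blast
    have w'c: "w' \<in> mats ?BS ?m" using w'(1) by (rule L2.S.words_closed[OF L2.S.elem_gens_closed])
    have "matrix_mult ?BS (map_mat ?zevS k) (matrix_mult ?BS ?w w') = matrix_mult ?BS ?w w'"
      using L2.S.matrix_mult_assoc[OF zkc wc w'c] wk by (simp only:)
    then show ?thesis using w'(2) zkc by simp
  qed
  \<comment> \<open>The value of the lift at \<open>Z = 0\<close>. It need not be the identity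
    although its image is, so its inverse \<open>v'\<close> is used as a correction;
    \<open>v'\<close> itself maps to the identity.\<close>
  let ?v0 = "map_mat ?zev v"
  have v0E: "?v0 \<in> ?EW" using vE by (rule Z.map_elem_words)
  then obtain v' where v': "v' \<in> ?EW" "matrix_mult ?B ?v0 v' = matrix_one ?B ?m"
    using L2.R.elem_words_inverse by blast
  have v0c: "?v0 \<in> mats ?B ?m" and v'c: "v' \<in> mats ?B ?m" using v0E v'(1) by (auto intro: EWc)
  have h2v': "map_mat h2 v' = matrix_one ?BS ?m"
  proof -
    have "map_mat h2 ?v0 = matrix_one ?BS ?m" using h2z[OF vc] v(2) zk by simp
    then show ?thesis
      using L2.map_mat_mult[OF v0c v'c] v'(2) L2.map_mat_one[of ?m] L2.map_mat_closed[OF v'c] by simp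
  qed
  \<comment> \<open>Still a lift of \<open>k\<close>, and now the identity at
    \<open>Z = 0\<close>.\<close>
  define \<beta> where "\<beta> = matrix_mult ?B v v'"
  have \<beta>E: "\<beta> \<in> ?EW" unfolding \<beta>_def by (rule L2.R.words_mult[OF L2.R.elem_gens_closed vE v'(1)])
  have \<beta>c: "\<beta> \<in> mats ?B ?m" by (rule EWc[OF \<beta>E])
  have h2\<beta>: "map_mat h2 \<beta> = k"
    unfolding \<beta>_def using L2.map_mat_mult[OF vc v'c] v(2) h2v' kc by simp
  have z\<beta>: "map_mat ?zev \<beta> = matrix_one ?B ?m"
  proof -
    have "map_mat ?zev ?v0 = ?v0"
      unfolding map_mat_comp using subst_Z_zero_idem[OF R.is_cring] by (intro map_mat_cong_carrier[OF vc]) blast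
    then have "map_mat ?zev \<beta> = map_mat ?zev (matrix_mult ?B ?v0 v')"
      unfolding \<beta>_def Z.map_mat_mult[OF vc v'c] Z.map_mat_mult[OF v0c v'c] by simp
    then show ?thesis unfolding v'(2) Z.map_mat_one .
  qed
  let ?F = "matrix_mult ?B \<beta> ?a"
  have Fc: "?F \<in> mats ?B ?m" using \<beta>c ac by (rule L2.R.matrix_mult_closed)
  have h2F: "map_mat h2 ?F = map_mat h2 ?E"
    using L2.map_mat_mult[OF \<beta>c ac] h2\<beta> h2a h2E by simp
  have zF: "map_mat ?zev ?F = map_mat ?zev ?E"
    using Z.map_mat_mult[OF \<beta>c ac] z\<beta> za zE ac by simp
  define e where "e i j = ?E $$ (i, j)" for i j
  define f where "f i j = ?F $$ (i, j)" for i j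
  have entry: "e i j \<in> carrier ?B" "f i j \<in> carrier ?B" "h2 (f i j) = h2 (e i j)" "?zev (f i j) = ?zev (e i j)"
    if ij: "i < ?m" "j < ?m" for i j
  proof -
    show "e i j \<in> carrier ?B" "f i j \<in> carrier ?B"
      unfolding e_def f_def using mats_entry[OF Ec ij] mats_entry[OF Fc ij] by blast+
    have d: "i < dim_row ?E" "j < dim_col ?E" "i < dim_row ?F" "j < dim_col ?F"
      using ij mats_dim[OF Ec] mats_dim[OF Fc] by simp_all
    show "h2 (f i j) = h2 (e i j)" unfolding e_def f_def
      using arg_cong[OF h2F, of "\<lambda>A. A $$ (i, j)"] unfolding index_map_mat(1)[OF d(1,2)] index_map_mat(1)[OF d(3,4)] .
    show "?zev (f i j) = ?zev (e i j)" unfolding e_def f_def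
      using arg_cong[OF zF, of "\<lambda>A. A $$ (i, j)"] unfolding index_map_mat(1)[OF d(1,2)] index_map_mat(1)[OF d(3,4)] .
  qed
  \<comment> \<open>The finitely many entries of the error. They all have image zero, so one
    denominator kills them together.\<close>
  let ?A = "(\<lambda>(i, j). e i j \<ominus>\<^bsub>?B\<^esub> f i j) ` ({..<?m} \<times> {..<?m})"
  have "\<exists>u\<in>UPC (UP R) ` UPC R ` M. \<forall>x\<in>?A. u \<otimes>\<^bsub>?B\<^esub> x = \<zero>\<^bsub>?B\<^esub>"
  proof (rule L2.finite_annihilator)
    fix x assume "x \<in> ?A"
    then obtain i j where ij: "i < ?m" "j < ?m" "x = e i j \<ominus>\<^bsub>?B\<^esub> f i j" by auto
    show "h2 x = \<zero>\<^bsub>?BS\<^esub>"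
      using entry[OF ij(1,2)] L2.hom_closed[OF entry(1)[OF ij(1,2)]] unfolding ij(3)
      by (simp only: a_minus_def L2.hom_add L2.hom_a_inv L2.R.a_inv_closed L2.S.r_neg)
  next
    show "?A \<subseteq> carrier ?B"
    proof
      fix x assume "x \<in> ?A"
      then obtain i j where "i < ?m" "j < ?m" "x = e i j \<ominus>\<^bsub>?B\<^esub> f i j" by auto
      then show "x \<in> carrier ?B" using L2.R.minus_closed[OF entry(1,2)] by simp
    qed
  qed simp
  then obtain u where u: "u \<in> UPC (UP R) ` UPC R ` M" "\<forall>x\<in>?A. u \<otimes>\<^bsub>?B\<^esub> x = \<zero>\<^bsub>?B\<^esub>" by (elim bexE)
  from u(1) obtain a where a: "a \<in> M" "u = UPC (UP R) (UPC R a)" by (elim imageE) simp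
  note ua = u(2)[unfolded a(2), rule_format]
  interpret C1: ring_hom_cring R "UP R" "UPC R" by (rule UPC_hom[OF R.is_cring])
  have aR: "a \<in> carrier R" using a(1) by simp
  have aX: "UPC R a \<in> carrier (UP R)" using aR by (rule C1.hom_closed)
  \<comment> \<open>Replacing \<open>Z\<close> by \<open>aZ\<close> annihilates the error and turns
    the shift by \<open>t\<close> into the shift by \<open>t \<otimes> a\<close>.\<close>
  let ?z = "UPC (UP R) (UPC R a) \<otimes>\<^bsub>?B\<^esub> UPX (UP R)"
  have zc: "?z \<in> carrier ?B" using UP2_closed[OF R.is_cring] aR by (intro L2.R.m_closed) blast+
  interpret U: ring_hom_cring ?B ?B "subst_Z R ?z" by (rule subst_Z_hom(1)[OF R.is_cring zc])
  have "map_mat (subst_Z R ?z) ?E = map_mat (subst_Z R ?z) ?F"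
  proof (rule eq_matI)
    fix i j assume "i < dim_row (map_mat (subst_Z R ?z) ?F)" "j < dim_col (map_mat (subst_Z R ?z) ?F)"
    then have ij: "i < ?m" "j < ?m" using mats_dim[OF Fc] by simp_all
    have d: "i < dim_row ?E" "j < dim_col ?E" "i < dim_row ?F" "j < dim_col ?F"
      using ij mats_dim[OF Ec] mats_dim[OF Fc] by simp_all
    note ef = entry[OF ij]
    have d0: "?zev (e i j \<ominus>\<^bsub>?B\<^esub> f i j) = \<zero>\<^bsub>?B\<^esub>"
      using ef Z.hom_closed[OF ef(1)]
      by (simp only: a_minus_def Z.hom_add Z.hom_a_inv L2.R.a_inv_closed L2.R.r_neg)
    have dA: "e i j \<ominus>\<^bsub>?B\<^esub> f i j \<in> ?A" using ij by auto
    have "subst_Z R ?z (e i j \<ominus>\<^bsub>?B\<^esub> f i j) = \<zero>\<^bsub>?B\<^esub>"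
      by (rule eval_killed[OF H1.R.is_cring L2.R.minus_closed[OF ef(1,2)] aX ua[OF dA] d0])
    then have "subst_Z R ?z (e i j) \<ominus>\<^bsub>?B\<^esub> subst_Z R ?z (f i j) = \<zero>\<^bsub>?B\<^esub>"
      using ef by (simp only: a_minus_def U.hom_add U.hom_a_inv L2.R.a_inv_closed)
    then have "subst_Z R ?z (e i j) = subst_Z R ?z (f i j)"
      using L2.R.r_right_minus_eq U.hom_closed[OF ef(1)] U.hom_closed[OF ef(2)] by blast
    then show "map_mat (subst_Z R ?z) ?E $$ (i, j) = map_mat (subst_Z R ?z) ?F $$ (i, j)"
      unfolding index_map_mat(1)[OF d(1,2)] index_map_mat(1)[OF d(3,4)] e_def f_def .
  qed (use mats_dim[OF Ec] mats_dim[OF Fc] in simp_all)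
  moreover have "map_mat (subst_Z R ?z) ?E = map_mat (shift R (t \<otimes> a)) \<alpha>"
    unfolding map_mat_comp using subst_Z_shift[OF R.is_cring tc aR] by (intro map_mat_cong_carrier[OF \<alpha>]) blast
  moreover have "map_mat (subst_Z R ?z) ?F = matrix_mult ?B (map_mat (subst_Z R ?z) \<beta>) ?a"
  proof -
    have "map_mat (subst_Z R ?z) ?a = ?a"
      unfolding map_mat_comp using subst_Z_hom(2)[OF R.is_cring zc] by (intro map_mat_cong_carrier[OF \<alpha>]) blast
    then show ?thesis using U.map_mat_mult[OF \<beta>c ac] by simp
  qed
  moreover have "map_mat (subst_Z R ?z) \<beta> \<in> ?EW" using \<beta>E by (rule U.map_elem_words)
  ultimately show ?thesis using M_mult[OF t a(1)] by auto
qed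

end

text \<open>The analogue of the ideal in Quillen's patching argument.\<close>

definition shift_ideal :: "('a, 'b) ring_scheme \<Rightarrow> nat \<Rightarrow> (nat \<Rightarrow> 'a) mat \<Rightarrow> 'a set" where
  "shift_ideal R n \<alpha> = {t \<in> carrier R. \<exists>\<beta>\<in>elem_words (UP2 R) n.
     map_mat (shift R t) \<alpha> = matrix_mult (UP2 R) \<beta> (map_mat (UPC (UP R)) \<alpha>)}"

context cring
begin

text \<open>Substitute \<open>Z \<mapsto> uZ\<close> in the equation for \<open>t\<close>. The
  matrix \<open>\<alpha>(X)\<close> is unaffected, and words go to words.\<close>

lemma shift_ideal_mult:
  assumes \<alpha>: "\<alpha> \<in> mats (UP R) (2 * n)" and t: "t \<in> shift_ideal R n \<alpha>" and u: "u \<in> carrier R"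
  shows "t \<otimes> u \<in> shift_ideal R n \<alpha>"
proof -
  let ?z = "UPC (UP R) (UPC R u) \<otimes>\<^bsub>UP2 R\<^esub> UPX (UP R)"
  obtain \<beta> where tc: "t \<in> carrier R" and \<beta>: "\<beta> \<in> elem_words (UP2 R) n"
    "map_mat (shift R t) \<alpha> = matrix_mult (UP2 R) \<beta> (map_mat (UPC (UP R)) \<alpha>)"
    using t by (auto simp: shift_ideal_def)
  interpret C: ring_hom_cring "UP R" "UP2 R" "UPC (UP R)" by (rule UPC_hom[OF UP_cring_cring[OF is_cring]])
  have zc: "?z \<in> carrier (UP2 R)" using UP2_closed[OF is_cring] u by (intro C.S.m_closed) blast+
  interpret U: ring_hom_cring "UP2 R" "UP2 R" "subst_Z R ?z" by (rule subst_Z_hom(1)[OF is_cring zc])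
  have \<beta>c: "\<beta> \<in> mats (UP2 R) (2 * n)" using C.S.words_closed[OF C.S.elem_gens_closed \<beta>(1)] .
  have ac: "map_mat (UPC (UP R)) \<alpha> \<in> mats (UP2 R) (2 * n)" using \<alpha> by (rule C.map_mat_closed)
  have "map_mat (shift R (t \<otimes> u)) \<alpha> = map_mat (subst_Z R ?z) (map_mat (shift R t) \<alpha>)"
    unfolding map_mat_comp using subst_Z_shift[OF is_cring tc u]
    by (intro map_mat_cong_carrier[OF \<alpha>, symmetric]) blast
  also have "\<dots> = matrix_mult (UP2 R) (map_mat (subst_Z R ?z) \<beta>) (map_mat (subst_Z R ?z) (map_mat (UPC (UP R)) \<alpha>))"
    unfolding \<beta>(2) by (rule U.map_mat_mult[OF \<beta>c ac])
  also have "map_mat (subst_Z R ?z) (map_mat (UPC (UP R)) \<alpha>) = map_mat (UPC (UP R)) \<alpha>"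
    unfolding map_mat_comp using subst_Z_hom(2)[OF is_cring zc] by (intro map_mat_cong_carrier[OF \<alpha>]) blast
  finally show ?thesis
    using U.map_elem_words[OF \<beta>(1)] tc u unfolding shift_ideal_def by blast
qed

text \<open>Substituting \<open>X \<mapsto> X + tZ\<close> in
  \<open>\<alpha>(X + uZ) = \<gamma> \<alpha>(X)\<close> makes the right factor
  \<open>\<alpha>(X + tZ)\<close>, which is \<open>\<beta> \<alpha>(X)\<close>. So the factor for
  \<open>t \<oplus> u\<close> is the image of \<open>\<gamma>\<close> times
  \<open>\<beta>\<close>.\<close>

lemma shift_ideal_add:
  assumes \<alpha>: "\<alpha> \<in> mats (UP R) (2 * n)" and t: "t \<in> shift_ideal R n \<alpha>" and u: "u \<in> shift_ideal R n \<alpha>"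
  shows "t \<oplus> u \<in> shift_ideal R n \<alpha>"
proof -
  let ?B = "UP2 R" and ?Z = "UPX (UP R)"
  obtain \<beta> where tc: "t \<in> carrier R" and \<beta>: "\<beta> \<in> elem_words ?B n"
    "map_mat (shift R t) \<alpha> = matrix_mult ?B \<beta> (map_mat (UPC (UP R)) \<alpha>)"
    using t by (auto simp: shift_ideal_def)
  obtain \<gamma> where uc: "u \<in> carrier R" and \<gamma>: "\<gamma> \<in> elem_words ?B n"
    "map_mat (shift R u) \<alpha> = matrix_mult ?B \<gamma> (map_mat (UPC (UP R)) \<alpha>)"
    using u by (auto simp: shift_ideal_def)
  interpret C0: ring_hom_cring R "UP R" "UPC R" by (rule UPC_hom[OF is_cring])
  interpret C: ring_hom_cring "UP R" ?B "UPC (UP R)" by (rule UPC_hom[OF C0.S.is_cring])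
  interpret D: ring_hom_cring R ?B "\<lambda>r. UPC (UP R) (UPC R r)" by (rule UPCC_hom[OF is_cring])
  interpret T: ring_hom_cring "UP R" ?B "shift R t" by (rule shift_hom(1)[OF is_cring tc])
  have Zc: "?Z \<in> carrier ?B" using UP2_closed(1)[OF is_cring] .
  \<comment> \<open>The substitution \<open>X \<mapsto> X + tZ\<close> with \<open>Z\<close> fixed,
    on \<open>R[X][Z]\<close>.\<close>
  define \<tau> where "\<tau> = UnivPoly.eval (UP R) ?B (shift R t) ?Z"
  note \<tau> = eval_hom[OF T.ring_hom_cring_axioms Zc, folded \<tau>_def]
  interpret \<tau>: ring_hom_cring ?B ?B \<tau> by (rule \<tau>(1))
  have tu: "t \<oplus> u \<in> carrier R" using tc uc by simp
  have sh: "\<tau> (shift R u p) = shift R (t \<oplus> u) p" if p: "p \<in> carrier (UP R)" for p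
  proof (rule shift_comp[OF is_cring uc \<tau>(1) shift_hom(1)[OF is_cring tu] _ _ p])
    show "\<tau> (UPC (UP R) (UPC R r)) = shift R (t \<oplus> u) (UPC R r)" if r: "r \<in> carrier R" for r
      using \<tau>(2)[OF C0.hom_closed[OF r]] shift_hom(2)[OF is_cring tc r] shift_hom(2)[OF is_cring tu r] by (simp only:)
    have "\<tau> (UPC (UP R) (UPX R)) \<oplus>\<^bsub>?B\<^esub> \<tau> (UPC (UP R) (UPC R u)) \<otimes>\<^bsub>?B\<^esub> \<tau> ?Z =
      (UPC (UP R) (UPX R) \<oplus>\<^bsub>?B\<^esub> UPC (UP R) (UPC R t) \<otimes>\<^bsub>?B\<^esub> ?Z) \<oplus>\<^bsub>?B\<^esub> UPC (UP R) (UPC R u) \<otimes>\<^bsub>?B\<^esub> ?Z"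
      using \<tau>(2)[OF C0.hom_closed[OF uc]] \<tau>(2)[OF UPX_closed[OF is_cring]] \<tau>(3)
        shift_hom(2)[OF is_cring tc uc] shift_hom(3)[OF is_cring tc] by (simp only:)
    also have "\<dots> = UPC (UP R) (UPX R) \<oplus>\<^bsub>?B\<^esub> UPC (UP R) (UPC R (t \<oplus> u)) \<otimes>\<^bsub>?B\<^esub> ?Z"
      using D.hom_add[OF tc uc] D.hom_closed[OF tc] D.hom_closed[OF uc] Zc UP2_closed(2)[OF is_cring]
      by (simp only: C.S.l_distr C.S.a_assoc C.S.m_closed)
    finally show "\<tau> (UPC (UP R) (UPX R)) \<oplus>\<^bsub>?B\<^esub> \<tau> (UPC (UP R) (UPC R u)) \<otimes>\<^bsub>?B\<^esub> \<tau> ?Z = shift R (t \<oplus> u) (UPX R)"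
      using shift_hom(3)[OF is_cring tu] by (simp only:)
  qed
  note Wc = C.S.words_closed[OF C.S.elem_gens_closed]
  have ac: "map_mat (UPC (UP R)) \<alpha> \<in> mats ?B (2 * n)" using \<alpha> by (rule C.map_mat_closed)
  have "map_mat (shift R (t \<oplus> u)) \<alpha> = map_mat \<tau> (map_mat (shift R u) \<alpha>)"
    unfolding map_mat_comp using sh by (intro map_mat_cong_carrier[OF \<alpha>, symmetric]) blast
  also have "\<dots> = matrix_mult ?B (map_mat \<tau> \<gamma>) (map_mat \<tau> (map_mat (UPC (UP R)) \<alpha>))"
    unfolding \<gamma>(2) by (rule \<tau>.map_mat_mult[OF Wc[OF \<gamma>(1)] ac])
  also have "map_mat \<tau> (map_mat (UPC (UP R)) \<alpha>) = map_mat (shift R t) \<alpha>"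
    unfolding map_mat_comp using \<tau>(2) by (intro map_mat_cong_carrier[OF \<alpha>]) blast
  also have "matrix_mult ?B (map_mat \<tau> \<gamma>) \<dots> =
    matrix_mult ?B (matrix_mult ?B (map_mat \<tau> \<gamma>) \<beta>) (map_mat (UPC (UP R)) \<alpha>)"
    unfolding \<beta>(2) by (rule C.S.matrix_mult_assoc[symmetric, OF \<tau>.map_mat_closed[OF Wc[OF \<gamma>(1)]] Wc[OF \<beta>(1)] ac])
  finally show ?thesis
    using C.S.words_mult[OF C.S.elem_gens_closed \<tau>.map_elem_words[OF \<gamma>(1)] \<beta>(1)] tu
    unfolding shift_ideal_def by blast
qed

lemma shift_ideal_zero:
  assumes \<alpha>: "\<alpha> \<in> mats (UP R) (2 * n)"
  shows "\<zero> \<in> shift_ideal R n \<alpha>"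
proof -
  let ?B = "UP2 R"
  interpret C0: ring_hom_cring R "UP R" "UPC R" by (rule UPC_hom[OF is_cring])
  interpret C: ring_hom_cring "UP R" ?B "UPC (UP R)" by (rule UPC_hom[OF C0.S.is_cring])
  have "shift R \<zero> p = UPC (UP R) p" if p: "p \<in> carrier (UP R)" for p
    by (rule UP_hom_ext[OF shift_hom(1)[OF is_cring zero_closed] C.ring_hom_cring_axioms is_cring _ _ p])
      (simp_all add: shift_hom[OF is_cring] UP2_closed[OF is_cring])
  then have "map_mat (shift R \<zero>) \<alpha> = map_mat (UPC (UP R)) \<alpha>"
    by (intro map_mat_cong_carrier[OF \<alpha>]) blast
  also have "\<dots> = matrix_mult ?B (matrix_one ?B (2 * n)) (map_mat (UPC (UP R)) \<alpha>)"
    using C.S.matrix_mult_one_left[OF C.map_mat_closed[OF \<alpha>]] by simp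
  finally show ?thesis
    unfolding shift_ideal_def using words.one by blast
qed

lemma ideal_shift_ideal:
  assumes \<alpha>: "\<alpha> \<in> mats (UP R) (2 * n)"
  shows "ideal (shift_ideal R n \<alpha>) R"
proof (rule idealI[OF ring_axioms])
  have sub: "shift_ideal R n \<alpha> \<subseteq> carrier R" by (auto simp: shift_ideal_def)
  show "subgroup (shift_ideal R n \<alpha>) (add_monoid R)"
  proof (rule add.subgroupI[OF sub])
    show "shift_ideal R n \<alpha> \<noteq> {}" using shift_ideal_zero[OF \<alpha>] by blast
    show "\<ominus> a \<in> shift_ideal R n \<alpha>" if a: "a \<in> shift_ideal R n \<alpha>" for a
    proof -
      have ac: "a \<in> carrier R" using a sub by blast
      have "a \<otimes> (\<ominus> \<one>) = \<ominus> a" using ac by (simp add: r_minus)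
      then show ?thesis using shift_ideal_mult[OF \<alpha> a, of "\<ominus> \<one>"] by simp
    qed
  qed (rule shift_ideal_add[OF \<alpha>])
  fix a x assume ax: "a \<in> shift_ideal R n \<alpha>" "x \<in> carrier R"
  show "a \<otimes> x \<in> shift_ideal R n \<alpha>" by (rule shift_ideal_mult[OF \<alpha> ax])
  then show "x \<otimes> a \<in> shift_ideal R n \<alpha>" using ax sub m_comm[of a x] by auto
qed

text \<open>The equation \<open>\<alpha>(X + Z) = \<beta> \<alpha>(X)\<close> at
  \<open>X = 0\<close> reads \<open>\<alpha>(Z) = \<beta>(0, Z)\<close>, since
  \<open>\<alpha>(0)\<close> is the identity.\<close>

lemma elem_words_of_translation:
  assumes \<alpha>: "\<alpha> \<in> mats (UP R) (2 * n)" and 0: "map_mat (UnivPoly.eval R R id \<zero>) \<alpha> = matrix_one R (2 * n)"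
    and 1: "\<one> \<in> shift_ideal R n \<alpha>"
  shows "\<alpha> \<in> elem_words (UP R) n"
proof -
  let ?P = "UP R" and ?B = "UP2 R" and ?ev = "UnivPoly.eval R R id \<zero>"
  obtain \<beta> where \<beta>: "\<beta> \<in> elem_words ?B n"
    "map_mat (shift R \<one>) \<alpha> = matrix_mult ?B \<beta> (map_mat (UPC (UP R)) \<alpha>)"
    using 1 by (auto simp: shift_ideal_def)
  interpret C0: ring_hom_cring R ?P "UPC R" by (rule UPC_hom[OF is_cring])
  interpret C: ring_hom_cring ?P ?B "UPC ?P" by (rule UPC_hom[OF C0.S.is_cring])
  have idh: "ring_hom_cring R R id" by (rule ring_hom_cringI[OF is_cring is_cring]) (rule ring_hom_memI; simp)
  note ev = eval_hom[OF idh zero_closed]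
  interpret EV: ring_hom_cring ?P R ?ev by (rule ev(1))
  \<comment> \<open>\<open>\<epsilon>\<close> sends \<open>X\<close> to zero, and its extension
    \<open>\<tau>\<close> sends \<open>Z\<close> to \<open>X\<close>, so that the result lies in
    \<open>R[X]\<close> again.\<close>
  define \<epsilon> where "\<epsilon> = UnivPoly.eval R ?P (UPC R) \<zero>\<^bsub>?P\<^esub>"
  note \<epsilon> = eval_hom[OF C0.ring_hom_cring_axioms C0.S.zero_closed, folded \<epsilon>_def]
  define \<tau> where "\<tau> = UnivPoly.eval ?P ?P \<epsilon> (UPX R)"
  note \<tau> = eval_hom[OF \<epsilon>(1) UPX_closed[OF is_cring], folded \<tau>_def]
  interpret \<tau>: ring_hom_cring ?B ?P \<tau> by (rule \<tau>(1))
  have idP: "ring_hom_cring ?P ?P (\<lambda>p. p)"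
    by (rule ring_hom_cringI[OF C0.S.is_cring C0.S.is_cring]) (rule ring_hom_memI; simp)
  have \<tau>_shift: "\<tau> (shift R \<one> p) = p" if p: "p \<in> carrier ?P" for p
  proof (rule shift_comp[OF is_cring one_closed \<tau>(1) idP _ _ p])
    show "\<tau> (UPC ?P (UPC R r)) = UPC R r" if "r \<in> carrier R" for r
      using \<tau>(2)[OF C0.hom_closed[OF that]] \<epsilon>(2)[OF that] by simp
    have "\<tau> (UPC ?P (UPC R \<one>)) = \<one>\<^bsub>?P\<^esub>" by simp
    then show "\<tau> (UPC ?P (UPX R)) \<oplus>\<^bsub>?P\<^esub> \<tau> (UPC ?P (UPC R \<one>)) \<otimes>\<^bsub>?P\<^esub> \<tau> (UPX ?P) = UPX R"
      using \<tau>(2)[OF UPX_closed[OF is_cring]] \<epsilon>(3) \<tau>(3) UPX_closed[OF is_cring] by simp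
  qed
  have \<tau>_const: "\<tau> (UPC ?P p) = UPC R (?ev p)" if p: "p \<in> carrier ?P" for p
  proof -
    have "\<epsilon> p = UPC R (?ev p)"
      by (rule UP_hom_ext[OF \<epsilon>(1) ring_hom_cring_comp[OF ev(1) C0.ring_hom_cring_axioms] is_cring _ _ p])
        (simp_all add: \<epsilon> ev)
    then show ?thesis using \<tau>(2)[OF p] by simp
  qed
  have "\<alpha> = map_mat \<tau> (map_mat (shift R \<one>) \<alpha>)"
    unfolding map_mat_comp using map_mat_cong_carrier[OF \<alpha>, of "\<lambda>p. \<tau> (shift R \<one> p)" "\<lambda>p. p"] \<tau>_shift
    by (simp add: map_mat_def mat_eq_iff)
  also have "\<dots> = matrix_mult ?P (map_mat \<tau> \<beta>) (map_mat \<tau> (map_mat (UPC ?P) \<alpha>))"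
    unfolding \<beta>(2)
    by (rule \<tau>.map_mat_mult[OF C.S.words_closed[OF C.S.elem_gens_closed \<beta>(1)] C.map_mat_closed[OF \<alpha>]])
  also have "map_mat \<tau> (map_mat (UPC ?P) \<alpha>) = map_mat (UPC R) (map_mat ?ev \<alpha>)"
    unfolding map_mat_comp using \<tau>_const by (intro map_mat_cong_carrier[OF \<alpha>]) blast
  also have "\<dots> = matrix_one ?P (2 * n)" unfolding 0 by (rule C0.map_mat_one)
  finally show ?thesis
    using \<tau>.map_elem_words[OF \<beta>(1)] C0.S.words_closed[OF C0.S.elem_gens_closed \<tau>.map_elem_words[OF \<beta>(1)]]
    by simp
qed

end

theorem theorem4p6:
  fixes R :: "('a, 'b) ring_scheme" (structure)
    and n :: nat
    and \<alpha> :: "(nat \<Rightarrow> 'a) mat"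
  assumes "cring R"
    and "\<one> \<oplus> \<one> \<in> Units R"
    and "n \<ge> 2"
    and "\<alpha> \<in> carrier (Sp n (UP R))"
    and "map_mat (UnivPoly.eval R R id \<zero>) \<alpha> = matrix_one R (2 * n)"
    and "\<And>\<mm>. maximalideal \<mm> R \<Longrightarrow>
           map_mat (poly_localize_at R \<mm>) \<alpha> \<in> H_sub n (UP (localization_at R \<mm>))"
  shows "\<alpha> \<in> H_sub n (UP R)"
proof -
  interpret cring R by fact
  interpret C: ring_hom_cring R "UP R" "UPC R" by (rule UPC_hom[OF is_cring])
  have \<alpha>: "\<alpha> \<in> mats (UP R) (2 * n)" using assms(4) by (simp add: Sp_def SL_def mats_def)
  have "\<one> \<in> shift_ideal R n \<alpha>"
  proof (rule ccontr)
    assume "\<one> \<notin> shift_ideal R n \<alpha>"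
    then obtain \<mm> where m: "maximalideal \<mm> R" "shift_ideal R n \<alpha> \<subseteq> \<mm>"
      using ideal_in_maximalideal[OF ideal_shift_ideal[OF \<alpha>]] by blast
    interpret m: primeideal \<mm> R using m(1) by (rule maximalideal_prime)
    let ?M = "carrier R - \<mm>"
    interpret M: multiplicative_subset R ?M
    proof unfold_locales
      show "\<one> \<in> ?M" using m.one_imp_carrier m.I_notcarr by blast
      show "s \<otimes> t \<in> ?M" if "s \<in> ?M" "t \<in> ?M" for s t
        using that m.I_prime[of s t] by auto
    qed blast
    interpret L: localization_hom R "localization_at R \<mm>" "\<lambda>r. fraction R ?M r \<one>" ?M
      unfolding localization_at_def by (rule M.localization_hom_fraction)
    \<comment> \<open>Carries the unit 2 from the localization to its polynomial ring, where
      \<open>H_sub_words\<close> uses it to turn the hypothesis at \<open>\<mm>\<close> into a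
      statement about words.\<close>
    interpret CL: ring_hom_cring "localization_at R \<mm>" "UP (localization_at R \<mm>)" "UPC (localization_at R \<mm>)"
      by (rule UPC_hom[OF L.S.is_cring])
    have "\<one>\<^bsub>UP (localization_at R \<mm>)\<^esub> \<oplus>\<^bsub>UP (localization_at R \<mm>)\<^esub> \<one>\<^bsub>UP (localization_at R \<mm>)\<^esub>
      \<in> Units (UP (localization_at R \<mm>))"
      using CL.hom_Units[OF L.hom_Units[OF assms(2)]] by simp
    moreover have "poly_localize_at R \<mm> = coeff_map (\<lambda>r. fraction R ?M r \<one>)"
      by (intro ext) (simp add: poly_localize_at_def coeff_map_def)
    ultimately have "map_mat (coeff_map (\<lambda>r. fraction R ?M r \<one>)) \<alpha>
      \<in> words (UP (localization_at R \<mm>)) (2 * n) (elem_gens (UP (localization_at R \<mm>)) n)"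
      using assms(6)[OF m(1)] CL.S.H_sub_words by simp
    from L.local_shift[OF assms(2,3) \<alpha> this] obtain t where "t \<in> ?M" "t \<in> shift_ideal R n \<alpha>"
      unfolding shift_ideal_def by blast
    with m(2) show False by blast
  qed
  then have "\<alpha> \<in> elem_words (UP R) n"
    by (rule elem_words_of_translation[OF \<alpha> assms(5)])
  moreover have "\<one>\<^bsub>UP R\<^esub> \<oplus>\<^bsub>UP R\<^esub> \<one>\<^bsub>UP R\<^esub> \<in> Units (UP R)"
    using C.hom_Units[OF assms(2)] by simp
  ultimately show ?thesis using C.S.H_sub_words by simp
qed

end
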